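(* Let $\Omega\subset\mathbb{R}^n$ be non-empty and open, and let $s\in\mathbb{R}$. For $t\in\mathbb{R}$ denote by $|^t_\Omega:\widetilde H^t(\Omega)\to H^t(\Omega)$ the restriction operator $U\mapsto U|_\Omega$ acting on $\widetilde H^t(\Omega)$. Then: (i) $|^s_\Omega:\widetilde H^s(\Omega)\to H^s(\Omega)$ is bijective if and only if $|^{-s}_\Omega:\widetilde H^{-s}(\Omega)\to H^{-s}(\Omega)$ is bijective. (ii) $|^{-s}_\Omega:\widetilde H^{-s}(\Omega)\to H^{-s}(\Omega)$ is injective if and only if $|^{s}_\Omega:\widetilde H^{s}(\Omega)\to H^{s}(\Omega)$ has dense image; i.e. if and only if $H^s_0(\Omega)=H^s(\Omega)$.
   Context: Here $n\in\mathbb{N}$. $\mathscr{D}(\mathbb{R}^n)$ is the space of compactly supported smooth functions on $\mathbb{R}^n$; for open $\Omega\subset\mathbb{R}^n$, $\mathscr{D}(\Omega)=\{u\in\mathscr{D}(\mathbb{R}^n):\operatorname{supp}u\subset\Omega\}$. $\mathscr{D}^*(\Omega)$ is the space of distributions on $\Omega$ (anti-linear continuous functionals on $\mathscr{D}(\Omega)$), and $\mathscr{S}^*(\mathbb{R}^n)$ is the space of tempered distributions (anti-linear continuous functionals on the Schwartz space). The Fourier transform is $\hat u(\xi)=(2\pi)^{-n/2}\int_{\mathbb{R}^n}e^{-i\xi\cdot x}u(x)\,dx$, extended to $\mathscr{S}^*(\mathbb{R}^n)$. For $s\in\mathbb{R}$, $H^s(\mathbb{R}^n)$ is the Hilbert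 space of $u\in\mathscr{S}^*(\mathbb{R}^n)$ with $\|u\|_{H^s(\mathbb{R}^n)}^2=\int_{\mathbb{R}^n}(1+|\xi|^2)^s|\hat u(\xi)|^2\,d\xi<\infty$. $\widetilde H^s(\Omega)$ is the closure of $\mathscr{D}(\Omega)$ in $H^s(\mathbb{R}^n)$, with the norm of $H^s(\mathbb{R}^n)$. $H^s(\Omega)=\{u\in\mathscr{D}^*(\Omega):u=U|_\Omega\text{ for some }U\in H^s(\mathbb{R}^n)\}$, where $U|_\Omega$ is the restriction of the distribution $U$ to $\Omega$, with norm $\|u\|_{H^s(\Omega)}=\min\{\|U\|_{H^s(\mathbb{R}^n)}:U\in H^s(\mathbb{R}^n),\ U|_\Omega=u\}$. $H^s_0(\Omega)$ is the closure of $\{\phi|_\Omega:\phi\in\mathscr{D}(\Omega)\}$ in $H^s(\Omega)$. *)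

theory Defs
  imports "HOL-Analysis.Analysis"
begin

type_synonym 'n fn = "real ^ 'n \<Rightarrow> complex"

section \<open>Smooth functions\<close>

definition partial_deriv :: "'n \<Rightarrow> 'n::finite fn \<Rightarrow> 'n fn" where
  "partial_deriv i f = (\<lambda>x. frechet_derivative f (at x) (axis i 1))"

text \<open>A list \<^term>\<open>is\<close> of coordinates plays the role of a multi-index.\<close>

definition partial_derivs :: "'n list \<Rightarrow> 'n::finite fn \<Rightarrow> 'n fn" where
  "partial_derivs is f = foldr partial_deriv is f"

definition smooth :: "'n::finite fn \<Rightarrow> bool" where
  "smooth f \<longleftrightarrow> (\<forall>is. partial_derivs is f differentiable_on UNIV)"

definition supp :: "'n::finite fn \<Rightarrow> (real ^ 'n) set" where
  "supp f = closure {x. f x \<noteq> 0}"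

section \<open>Test functions and Schwartz functions, with their topologies\<close>

definition seminorm_topology :: "'n::finite fn set \<Rightarrow> ('i \<Rightarrow> 'n fn \<Rightarrow> real) \<Rightarrow> 'n fn topology" where
  "seminorm_topology X p =
     topology_generated_by {{g \<in> X. p i (g - f) < e} |i f e. f \<in> X \<and> e > 0}"

definition schwartz_seminorm :: "nat \<times> 'n list \<Rightarrow> 'n::finite fn \<Rightarrow> real" where
  "schwartz_seminorm = (\<lambda>(k, is) f. SUP x. (1 + norm x) ^ k * norm (partial_derivs is f x))"

definition schwartz :: "'n::finite fn set" where
  "schwartz = {f. smooth f \<and>
     (\<forall>k is. bdd_above (range (\<lambda>x. (1 + norm x) ^ k * norm (partial_derivs is f x))))}"

definition schwartz_topology :: "'n::finite fn topology" where
  "schwartz_topology = seminorm_topology schwartz schwartz_seminorm"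

definition test_fns :: "(real ^ 'n::finite) set \<Rightarrow> 'n fn set" where
  "test_fns \<Omega> = {f. smooth f \<and> compact (supp f) \<and> supp f \<subseteq> \<Omega>}"

definition test_fns_in_topology :: "(real ^ 'n::finite) set \<Rightarrow> 'n fn topology" where
  "test_fns_in_topology K =
     seminorm_topology (test_fns K) (\<lambda>is f. SUP x. norm (partial_derivs is f x))"

text \<open>
  The usual (inductive limit) topology of the test functions: a local base at 0 is formed by the
  convex balanced sets whose intersection with the functions supported in \<^term>\<open>K\<close> is open there,
  for every compact \<^term>\<open>K\<close> contained in \<^term>\<open>\<Omega>\<close>.
\<close>

definition test_nbhds :: "(real ^ 'n::finite) set \<Rightarrow> 'n fn set set" where
  "test_nbhds \<Omega> = {W. W \<subseteq> test_fns \<Omega> \<and> W \<noteq> {} \<and>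
     (\<forall>f\<in>W. \<forall>g\<in>W. \<forall>t\<in>{0..1}. (\<lambda>x. of_real (1 - t) * f x + of_real t * g x) \<in> W) \<and>
     (\<forall>f\<in>W. \<forall>c. norm c \<le> 1 \<longrightarrow> (\<lambda>x. c * f x) \<in> W) \<and>
     (\<forall>K. compact K \<and> K \<subseteq> \<Omega> \<longrightarrow> openin (test_fns_in_topology K) (W \<inter> test_fns K))}"

definition test_topology :: "(real ^ 'n::finite) set \<Rightarrow> 'n fn topology" where
  "test_topology \<Omega> =
     topology_generated_by {{g \<in> test_fns \<Omega>. g - f \<in> W} |f W. f \<in> test_fns \<Omega> \<and> W \<in> test_nbhds \<Omega>}"

section \<open>Distributions\<close>

text \<open>
  A functional on a space \<^term>\<open>X\<close> of functions is encoded as a function on all of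
  \<^typ>\<open>'n fn\<close> that is 0 off \<^term>\<open>X\<close>, so that equality and pointwise subtraction of
  functionals are those of HOL functions.
\<close>

definition antidual :: "'n::finite fn set \<Rightarrow> 'n fn topology \<Rightarrow> ('n fn \<Rightarrow> complex) set" where
  "antidual X T = {u.
     (\<forall>f\<in>X. \<forall>g\<in>X. u (\<lambda>x. f x + g x) = u f + u g) \<and>
     (\<forall>f\<in>X. \<forall>c. u (\<lambda>x. c * f x) = cnj c * u f) \<and>
     continuous_map T euclidean u \<and>
     (\<forall>f. f \<notin> X \<longrightarrow> u f = 0)}"

definition distributions :: "(real ^ 'n::finite) set \<Rightarrow> ('n fn \<Rightarrow> complex) set" where
  "distributions \<Omega> = antidual (test_fns \<Omega>) (test_topology \<Omega>)"

definition tempered :: "('n::finite fn \<Rightarrow> complex) set" where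
  "tempered = antidual schwartz schwartz_topology"

definition dist_restrict :: "(real ^ 'n::finite) set \<Rightarrow> ('n fn \<Rightarrow> complex) \<Rightarrow> 'n fn \<Rightarrow> complex" where
  "dist_restrict \<Omega> U = (\<lambda>f. if f \<in> test_fns \<Omega> then U f else 0)"

definition dist_of_fn :: "'n::finite fn \<Rightarrow> 'n fn \<Rightarrow> complex" where
  "dist_of_fn g = (\<lambda>f. if f \<in> schwartz then (\<integral>x. g x * cnj (f x) \<partial>lborel) else 0)"

section \<open>Fourier transform\<close>

definition fourier :: "'n::finite fn \<Rightarrow> 'n fn" where
  "fourier f = (\<lambda>\<xi>. of_real ((2 * pi) powr (- real CARD('n) / 2)) *
     (\<integral>x. exp (- \<i> * of_real (\<xi> \<bullet> x)) * f x \<partial>lborel))"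

text \<open>
  The transform of \<^term>\<open>u\<close> is \<^term>\<open>u\<close> composed with the inverse transform
  \<^term>\<open>\<lambda>\<xi>. fourier f (- \<xi>)\<close> (not the transform itself), since the functionals are anti-linear;
  with this choice it extends \<^const>\<open>fourier\<close>.
\<close>

definition fourier_dist :: "('n::finite fn \<Rightarrow> complex) \<Rightarrow> 'n fn \<Rightarrow> complex" where
  "fourier_dist u = (\<lambda>f. if f \<in> schwartz then u (\<lambda>\<xi>. fourier f (- \<xi>)) else 0)"

section \<open>Sobolev spaces\<close>

text \<open>
  The transform of \<^term>\<open>u\<close> is the function \<^term>\<open>g\<close>, which is unique almost everywhere and
  for which the squared \<open>H\<^sup>s\<close>-norm is finite.
\<close>

definition is_fourier_fn :: "real \<Rightarrow> ('n::finite fn \<Rightarrow> complex) \<Rightarrow> 'n fn \<Rightarrow> bool" where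
  "is_fourier_fn s u g \<longleftrightarrow> g \<in> borel_measurable lborel \<and>
     integrable lborel (\<lambda>\<xi>. (1 + (norm \<xi>)\<^sup>2) powr s * (norm (g \<xi>))\<^sup>2) \<and>
     fourier_dist u = dist_of_fn g"

definition Hs :: "real \<Rightarrow> ('n::finite fn \<Rightarrow> complex) set" where
  "Hs s = {u \<in> tempered. \<exists>g. is_fourier_fn s u g}"

definition Hs_norm :: "real \<Rightarrow> ('n::finite fn \<Rightarrow> complex) \<Rightarrow> real" where
  "Hs_norm s u = (let g = SOME g. is_fourier_fn s u g in
     sqrt (\<integral>\<xi>. (1 + (norm \<xi>)\<^sup>2) powr s * (norm (g \<xi>))\<^sup>2 \<partial>lborel))"

definition norm_closure ::
  "('b \<Rightarrow> complex) set \<Rightarrow> (('b \<Rightarrow> complex) \<Rightarrow> real) \<Rightarrow> ('b \<Rightarrow> complex) set \<Rightarrow> ('b \<Rightarrow> complex) set" where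
  "norm_closure X N A = {u \<in> X. \<forall>e>0. \<exists>v\<in>A. N (u - v) < e}"

definition Hs_tilde :: "real \<Rightarrow> (real ^ 'n::finite) set \<Rightarrow> ('n fn \<Rightarrow> complex) set" where
  "Hs_tilde s \<Omega> = norm_closure (Hs s) (Hs_norm s) (dist_of_fn ` test_fns \<Omega>)"

definition Hs_on :: "real \<Rightarrow> (real ^ 'n::finite) set \<Rightarrow> ('n fn \<Rightarrow> complex) set" where
  "Hs_on s \<Omega> = {u \<in> distributions \<Omega>. \<exists>U\<in>Hs s. u = dist_restrict \<Omega> U}"

text \<open>The infimum is attained, hence is the minimum.\<close>

definition Hs_on_norm :: "real \<Rightarrow> (real ^ 'n::finite) set \<Rightarrow> ('n fn \<Rightarrow> complex) \<Rightarrow> real" where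
  "Hs_on_norm s \<Omega> u = Inf {Hs_norm s U |U. U \<in> Hs s \<and> dist_restrict \<Omega> U = u}"

definition Hs_zero :: "real \<Rightarrow> (real ^ 'n::finite) set \<Rightarrow> ('n fn \<Rightarrow> complex) set" where
  "Hs_zero s \<Omega> = norm_closure (Hs_on s \<Omega>) (Hs_on_norm s \<Omega>)
     ((\<lambda>f. dist_restrict \<Omega> (dist_of_fn f)) ` test_fns \<Omega>)"

end

theory Submission
  imports Defs "HOL-Probability.Probability"
begin

text \<open>
  Multiplying the Fourier transform by \<open>(1 + |\<xi>|^2)^(s/2)\<close> identifies \<open>H^s\<close> with the Hilbert space \<open>L^2\<close>,
  in such a way that the action of an element of \<open>H^s\<close> on test functions, seen as elements of \<open>H^(-s)\<close>,
  becomes the inner product. Write \<open>D(s)\<close> for the image of the test functions on \<open>\<Omega>\<close>. The subspace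
  \<open>Hs_tilde s \<Omega>\<close> corresponds to the closure of \<open>D(s)\<close>, and the kernel of the restriction to \<open>\<Omega>\<close> to the
  orthogonal complement of \<open>D(-s)\<close>. Density of \<open>D(s) + D(-s)\<^sup>\<bottom>\<close> means that its complement, which is
  \<open>D(s)\<^sup>\<bottom>\<close> intersected with the closure of \<open>D(-s)\<close>, is trivial; this is injectivity at \<open>-s\<close>. Bijectivity
  at \<open>s\<close> says that the whole space is the direct sum of \<open>closure D(s)\<close> and \<open>D(-s)\<^sup>\<bottom>\<close>; passing to adjoints of the
  projections exchanges \<open>s\<close> and \<open>-s\<close>.
\<close>

section \<open>Schwartz functions\<close>

text \<open>The identification with \<open>L2\<close> hinges on uniqueness almost everywhere of the
  transform of an element of \<open>H^s\<close>, because \<open>Hs_norm\<close> selects one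
  representative by choice. This is why inversion on Schwartz functions is established, together
  with the fact that Schwartz functions separate measurable functions. The decay of transforms is
  kept quantitative, in terms of finitely many seminorms, since membership in
  \<open>tempered\<close> and \<open>distributions\<close> demands continuity for concretely given
  topologies. The inner product on \<open>L2\<close> is the real part of the complex pairing, so all
  complements are taken in a real Hilbert space. In the exchange of \<open>s\<close> and
  \<open>- s\<close>, surjectivity gives injectivity of the adjoint directly, whereas injectivity
  gives it only a dense range. That the range is closed requires a lower bound for the adjoint,
  which comes from uniform boundedness.\<close>

lemma partial_derivs_Nil [simp]: "partial_derivs [] f = f"
  by (simp add: partial_derivs_def)

lemma partial_derivs_Cons [simp]:
  "partial_derivs (i # is) f = partial_deriv i (partial_derivs is f)"
  by (simp add: partial_derivs_def)

lemma partial_derivs_append: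
  "partial_derivs (is @ js) f = partial_derivs is (partial_derivs js f)"
  by (simp add: partial_derivs_def)

lemma partial_deriv_eq:
  assumes "(f has_derivative f') (at x)"
  shows "partial_deriv i f x = f' (axis i 1)"
  unfolding partial_deriv_def using frechet_derivative_at[OF assms] by simp

text \<open>Iterated derivatives of \<open>f\<close> stay in \<open>S\<close>, so an estimate for
  the members of \<open>S\<close> themselves already covers every derivative. Later closure proofs
  thereby avoid inductions over lists of coordinates.\<close>

lemma schwartz_coinduct:
  assumes "f \<in> S"
    and "\<And>f x. f \<in> S \<Longrightarrow> f differentiable (at x)"
    and "\<And>f k. f \<in> S \<Longrightarrow> \<exists>C. \<forall>x. (1 + norm x) ^ k * norm (f x) \<le> C"
    and "\<And>f i. f \<in> S \<Longrightarrow> partial_deriv i f \<in> S"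
  shows "f \<in> schwartz"
proof -
  have S: "partial_derivs is f \<in> S" for "is"
    by (induction "is") (auto simp: assms)
  show ?thesis
    unfolding schwartz_def smooth_def
  proof (intro CollectI conjI allI)
    show "partial_derivs is f differentiable_on UNIV" for "is"
      using assms(2)[OF S] by (auto simp: differentiable_on_def intro: differentiable_at_withinI)
    show "bdd_above (range (\<lambda>x. (1 + norm x) ^ k * norm (partial_derivs is f x)))" for k "is"
      using assms(3)[OF S] by (auto simp: bdd_above_def)
  qed
qed

lemma schwartz_partial_derivs:
  assumes "f \<in> schwartz"
  shows "partial_derivs is f \<in> schwartz"
  using assms unfolding schwartz_def smooth_def
  by (auto simp: partial_derivs_append[symmetric])

lemma schwartz_partial_deriv: "f \<in> schwartz \<Longrightarrow> partial_deriv i f \<in> schwartz"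
  using schwartz_partial_derivs[of f "[i]"] by simp

lemma schwartz_differentiable: "f \<in> schwartz \<Longrightarrow> f differentiable (at x)"
  using partial_derivs_Nil[of f]
  by (auto simp: schwartz_def smooth_def differentiable_on_def dest!: spec[of _ "[]"])

lemma schwartz_has_derivative:
  "f \<in> schwartz \<Longrightarrow> (f has_derivative frechet_derivative f (at x)) (at x)"
  using schwartz_differentiable frechet_derivative_works by blast

lemma schwartz_continuous: "f \<in> schwartz \<Longrightarrow> continuous_on A f"
  by (meson continuous_at_imp_continuous_on differentiable_imp_continuous_within schwartz_differentiable)

lemma schwartz_measurable [measurable_dest]: "f \<in> schwartz \<Longrightarrow> f \<in> borel_measurable borel"
  by (intro borel_measurable_continuous_onI schwartz_continuous)

lemma schwartz_seminorm_ge: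
  assumes "f \<in> schwartz"
  shows "(1 + norm x) ^ k * norm (partial_derivs is f x) \<le> schwartz_seminorm (k, is) f"
  using assms unfolding schwartz_seminorm_def schwartz_def
  by (auto intro!: cSUP_upper)

lemma schwartz_bounded:
  assumes "f \<in> schwartz"
  shows "\<exists>C. \<forall>x. (1 + norm x) ^ k * norm (f x) \<le> C"
  using schwartz_seminorm_ge[OF assms, of _ k "[]"] by auto

lemma schwartz_seminorm_nonneg:
  fixes f :: "'a::finite fn"
  assumes "f \<in> schwartz"
  shows "0 \<le> schwartz_seminorm i f"
proof -
  obtain k js where i: "i = (k, js)"
    by (cases i)
  have "0 \<le> (1 + norm (0::real ^ 'a)) ^ k * norm (partial_derivs js f 0)"
    by simp
  with schwartz_seminorm_ge[OF assms, of 0 k js] show ?thesis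
    unfolding i by linarith
qed

section \<open>Derivative rules and multipliers of Schwartz functions\<close>

lemma partial_deriv_add:
  assumes "f differentiable (at x)" "g differentiable (at x)"
  shows "partial_deriv i (\<lambda>x. f x + g x) x = partial_deriv i f x + partial_deriv i g x"
  using assms unfolding frechet_derivative_works
  by (subst partial_deriv_eq[OF has_derivative_add]) (auto simp: partial_deriv_def)

lemma partial_deriv_mult:
  assumes "f differentiable (at x)" "g differentiable (at x)"
  shows "partial_deriv i (\<lambda>x. f x * g x) x = partial_deriv i f x * g x + f x * partial_deriv i g x"
  using assms unfolding frechet_derivative_works
  by (subst partial_deriv_eq[OF has_derivative_mult]) (auto simp: partial_deriv_def)

lemma partial_deriv_cmult:
  assumes "f differentiable (at x)"
  shows "partial_deriv i (\<lambda>x. c * f x) x = c * partial_deriv i f x"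
  using assms unfolding frechet_derivative_works
  by (subst partial_deriv_eq[OF has_derivative_mult_right]) (auto simp: partial_deriv_def)

text \<open>The module over the multipliers \<open>M\<close> generated by \<open>B\<close>.
  Differentiating a product leads to a sum of products, which stays in this module; it therefore
  serves as invariant for \<open>schwartz_coinduct\<close> and replaces the Leibniz formula for
  higher derivatives.\<close>

inductive_set mult_closure :: "'n::finite fn set \<Rightarrow> 'n fn set \<Rightarrow> 'n fn set" for B M where
  base: "f \<in> B \<Longrightarrow> f \<in> mult_closure B M"
| add: "f \<in> mult_closure B M \<Longrightarrow> g \<in> mult_closure B M \<Longrightarrow> (\<lambda>x. f x + g x) \<in> mult_closure B M"
| cmult: "f \<in> mult_closure B M \<Longrightarrow> (\<lambda>x. c * f x) \<in> mult_closure B M"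
| mult: "m \<in> M \<Longrightarrow> f \<in> mult_closure B M \<Longrightarrow> (\<lambda>x. m x * f x) \<in> mult_closure B M"

text \<open>Polynomial growth of a multiplier is paid for by using the decay of \<open>f\<close>
  with a larger exponent. The last assumption asks that the derivative of a multiplier act on the
  closure rather than belong to \<open>M\<close>: it may be a constant, as for coordinates, or a
  polynomial in multipliers, as for logistic functions.\<close>

lemma mult_closure_subset_schwartz:
  fixes B M :: "'n::finite fn set"
  assumes B: "\<And>f x. f \<in> B \<Longrightarrow> f differentiable (at x)"
    "\<And>f k. f \<in> B \<Longrightarrow> \<exists>C. \<forall>x. (1 + norm x) ^ k * norm (f x) \<le> C"
    "\<And>f i. f \<in> B \<Longrightarrow> partial_deriv i f \<in> mult_closure B M"
    and M: "\<And>m x. m \<in> M \<Longrightarrow> m differentiable (at x)"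
    "\<And>m. m \<in> M \<Longrightarrow> \<exists>l. \<forall>x. norm (m x) \<le> (1 + norm x) ^ l"
    "\<And>m f i. m \<in> M \<Longrightarrow> f \<in> mult_closure B M \<Longrightarrow> (\<lambda>x. partial_deriv i m x * f x) \<in> mult_closure B M"
  shows "mult_closure B M \<subseteq> schwartz"
proof -
  have diff: "f differentiable (at x)" if "f \<in> mult_closure B M" for f x
    using that
  proof induction
    case (mult m f)
    then show ?case using differentiable_mult[OF M(1)] by blast
  next
    case (add f g)
    then show ?case using differentiable_add by blast
  next
    case (cmult f c)
    then show ?case using differentiable_mult[OF differentiable_const] by blast
  qed (rule B)
  have bound: "\<exists>C. \<forall>x. (1 + norm x) ^ k * norm (f x) \<le> C" if "f \<in> mult_closure B M" for f k
    using that
  proof (induction arbitrary: k)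
    case (add f g)
    obtain C D where "\<And>x. (1 + norm x) ^ k * norm (f x) \<le> C" "\<And>x. (1 + norm x) ^ k * norm (g x) \<le> D"
      using add.IH by meson
    then have "(1 + norm x) ^ k * norm (f x + g x) \<le> C + D" for x
      using mult_left_mono[OF norm_triangle_ineq[of "f x" "g x"], of "(1 + norm x) ^ k"]
      by (smt (verit) distrib_left norm_ge_zero zero_le_power)
    then show ?case by blast
  next
    case (cmult f c)
    obtain C where "\<And>x. (1 + norm x) ^ k * norm (f x) \<le> C"
      using cmult.IH by meson
    then have "(1 + norm x) ^ k * norm (c * f x) \<le> norm c * C" for x
      using mult_left_mono[of "(1 + norm x) ^ k * norm (f x)" C "norm c"]
      by (simp add: norm_mult ac_simps)
    then show ?case by blast
  next
    case (mult m f)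
    obtain l where l: "\<And>x. norm (m x) \<le> (1 + norm x) ^ l"
      using M(2) mult.hyps by meson
    obtain C where C: "\<And>x. (1 + norm x) ^ (k + l) * norm (f x) \<le> C"
      using mult.IH by meson
    have "(1 + norm x) ^ k * norm (m x * f x) \<le> C" for x
    proof -
      have "(1 + norm x) ^ k * norm (m x * f x) \<le> (1 + norm x) ^ k * ((1 + norm x) ^ l * norm (f x))"
        unfolding norm_mult by (intro mult_left_mono mult_right_mono l) auto
      with C[of x] show ?thesis by (simp add: power_add ac_simps)
    qed
    then show ?case by blast
  qed (rule B)
  have deriv: "partial_deriv i f \<in> mult_closure B M" if "f \<in> mult_closure B M" for f i
    using that
  proof induction
    case (add f g)
    then have "partial_deriv i (\<lambda>x. f x + g x) = (\<lambda>x. partial_deriv i f x + partial_deriv i g x)"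
      using partial_deriv_add diff by blast
    then show ?case using add.IH mult_closure.add by metis
  next
    case (cmult f c)
    then have "partial_deriv i (\<lambda>x. c * f x) = (\<lambda>x. c * partial_deriv i f x)"
      using partial_deriv_cmult diff by blast
    then show ?case using cmult.IH mult_closure.cmult by metis
  next
    case (mult m f)
    then have "partial_deriv i (\<lambda>x. m x * f x) = (\<lambda>x. partial_deriv i m x * f x + m x * partial_deriv i f x)"
      using partial_deriv_mult M(1) diff by blast
    then show ?case
      using mult_closure.add[OF M(3)[OF mult.hyps] mult_closure.mult[OF mult.hyps(1) mult.IH]] by simp
  qed (rule B)
  show ?thesis
    using schwartz_coinduct[OF _ diff bound deriv] by blast
qed

lemma schwartz_mult_closure:
  fixes M :: "'n::finite fn set"
  assumes "\<And>m x. m \<in> M \<Longrightarrow> m differentiable (at x)"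
    and "\<And>m. m \<in> M \<Longrightarrow> \<exists>l. \<forall>x. norm (m x) \<le> (1 + norm x) ^ l"
    and "\<And>m f i. m \<in> M \<Longrightarrow> f \<in> mult_closure schwartz M \<Longrightarrow> (\<lambda>x. partial_deriv i m x * f x) \<in> mult_closure schwartz M"
  shows "mult_closure schwartz M \<subseteq> schwartz"
  by (rule mult_closure_subset_schwartz[OF schwartz_differentiable schwartz_bounded
      mult_closure.base[OF schwartz_partial_deriv] assms])

lemma schwartz_add: "f \<in> schwartz \<Longrightarrow> g \<in> schwartz \<Longrightarrow> (\<lambda>x. f x + g x) \<in> schwartz"
  using schwartz_mult_closure[of "{}"] mult_closure.add[OF mult_closure.base mult_closure.base, where B = schwartz and M = "{}"]
  by blast

lemma schwartz_cmult: "f \<in> schwartz \<Longrightarrow> (\<lambda>x. c * f x) \<in> schwartz"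
  using schwartz_mult_closure[of "{}"] mult_closure.cmult[OF mult_closure.base, where B = schwartz and M = "{}"]
  by blast

lemma schwartz_diff: "f \<in> schwartz \<Longrightarrow> g \<in> schwartz \<Longrightarrow> f - g \<in> schwartz"
  using schwartz_add[OF _ schwartz_cmult[of g "-1"], of f] by (simp add: fun_diff_def)

section \<open>Conjugation, affine substitutions and multiplication by coordinates\<close>

lemma partial_deriv_cnj:
  assumes "f differentiable (at x)"
  shows "partial_deriv i (\<lambda>x. cnj (f x)) x = cnj (partial_deriv i f x)"
  using assms unfolding frechet_derivative_works
  by (subst partial_deriv_eq[OF has_derivative_cnj]) (auto simp: partial_deriv_def)

lemma schwartz_cnj:
  assumes "f \<in> schwartz"
  shows "(\<lambda>x. cnj (f x)) \<in> schwartz"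
proof (rule schwartz_coinduct[where S = "{\<lambda>x. cnj (f x) |f. f \<in> schwartz}"], goal_cases)
  case 1
  then show ?case using assms by blast
next
  case (2 f x)
  then show ?case
    using has_derivative_cnj[OF schwartz_has_derivative] unfolding differentiable_def by blast
next
  case (3 h k)
  then show ?case using schwartz_bounded by auto
next
  case (4 h i)
  then obtain f where h: "h = (\<lambda>x. cnj (f x))" "f \<in> schwartz" by auto
  then have "partial_deriv i h = (\<lambda>x. cnj (partial_deriv i f x))"
    by (auto simp: partial_deriv_cnj schwartz_differentiable)
  then show ?case using h schwartz_partial_deriv by auto
qed

lemma has_derivative_shift:
  fixes f :: "'n::finite fn"
  assumes "(f has_derivative f') (at (r *\<^sub>R x + a))"
  shows "((\<lambda>x. f (r *\<^sub>R x + a)) has_derivative (\<lambda>h. f' (r *\<^sub>R h))) (at x)"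
  by (rule has_derivative_compose[where f = "\<lambda>x. r *\<^sub>R x + a", OF _ assms])
    (auto intro!: derivative_eq_intros)

lemma schwartz_affine:
  fixes f :: "'n::finite fn"
  assumes "f \<in> schwartz" and r: "r \<noteq> 0"
  shows "(\<lambda>x. f (r *\<^sub>R x + a)) \<in> schwartz"
\<comment> \<open>The family carries a scalar \<open>c\<close> because each differentiation brings
  out a factor \<open>r\<close>.\<close>
proof (rule schwartz_coinduct[where S = "{\<lambda>x. c * f (r *\<^sub>R x + a) |c f. f \<in> schwartz}"], goal_cases)
  case 1
  then show ?case using assms by (auto intro!: exI[of _ 1] exI[of _ f])
next
  case (2 h x)
  then obtain c f where "h = (\<lambda>x. c * f (r *\<^sub>R x + a))" "f \<in> schwartz" by auto
  then show ?case
    using differentiableI[OF has_derivative_mult_right[OF has_derivative_shift[OF schwartz_has_derivative]]]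
    by simp
next
  case (3 h k)
  then obtain c f where h: "h = (\<lambda>x. c * f (r *\<^sub>R x + a))" "f \<in> schwartz" by auto
  obtain C where C: "\<And>x. (1 + norm x) ^ k * norm (f x) \<le> C"
    using schwartz_bounded h(2) by meson
  \<comment> \<open>Solving \<open>y = r x + a\<close> for \<open>x\<close> bounds
    \<open>norm x\<close> by \<open>(norm y + norm a) / \<bar>r\<bar>\<close>; \<open>M\<close>
    collects the resulting constants.\<close>
  define M where "M = max 1 (norm a + 1) * (1 + 1 / \<bar>r\<bar>)"
  have M: "1 + norm x \<le> M * (1 + norm (r *\<^sub>R x + a))" for x
  proof -
    let ?y = "r *\<^sub>R x + a"
    have "norm x = norm ((1 / r) *\<^sub>R (?y - a))" using r by simp
    also have "\<dots> \<le> 1 / \<bar>r\<bar> * (norm ?y + norm a)"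
      unfolding norm_scaleR by (intro mult_mono norm_triangle_ineq4) (auto simp: abs_if)
    finally have "1 + norm x \<le> 1 + 1 / \<bar>r\<bar> * (norm ?y + norm a)" by simp
    also have "\<dots> \<le> (1 + 1 / \<bar>r\<bar>) * (1 + norm a + norm ?y)"
      by (simp add: algebra_simps)
    also have "\<dots> \<le> (1 + 1 / \<bar>r\<bar>) * ((1 + norm a) * (1 + norm ?y))"
      by (intro mult_left_mono) (auto simp: algebra_simps)
    finally show ?thesis by (simp add: M_def ac_simps)
  qed
  have M0: "0 \<le> M" by (simp add: M_def)
  have "(1 + norm x) ^ k * norm (h x) \<le> M ^ k * (norm c * C)" for x
  proof -
    have "(1 + norm x) ^ k * norm (h x) \<le> (M * (1 + norm (r *\<^sub>R x + a))) ^ k * norm (h x)"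
      by (intro mult_right_mono power_mono M) auto
    also have "\<dots> = M ^ k * (norm c * ((1 + norm (r *\<^sub>R x + a)) ^ k * norm (f (r *\<^sub>R x + a))))"
      by (simp add: h power_mult_distrib norm_mult ac_simps)
    also have "\<dots> \<le> M ^ k * (norm c * C)"
      by (intro mult_left_mono C) (auto simp: M0)
    finally show ?thesis .
  qed
  then show ?case by auto
next
  case (4 h i)
  then obtain c f where h: "h = (\<lambda>x. c * f (r *\<^sub>R x + a))" "f \<in> schwartz" by auto
  have "partial_deriv i h x = (c * of_real r) * partial_deriv i f (r *\<^sub>R x + a)" for x
  proof -
    note d = schwartz_has_derivative[OF h(2), of "r *\<^sub>R x + a"]
    have "partial_deriv i h x = c * frechet_derivative f (at (r *\<^sub>R x + a)) (r *\<^sub>R axis i 1)"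
      unfolding h(1) by (rule partial_deriv_eq[OF has_derivative_mult_right[OF has_derivative_shift[OF d]]])
    also have "\<dots> = c * (r *\<^sub>R partial_deriv i f (r *\<^sub>R x + a))"
      unfolding partial_deriv_def
      by (simp only: linear_cmul[OF bounded_linear.linear[OF has_derivative_bounded_linear[OF d]]])
    finally show ?thesis by (simp add: scaleR_conv_of_real)
  qed
  then show ?case using h schwartz_partial_deriv by blast
qed

lemma schwartz_uminus_arg: "f \<in> schwartz \<Longrightarrow> (\<lambda>x. f (- x)) \<in> schwartz"
  using schwartz_affine[of f "-1" 0] by simp

lemma schwartz_translate: "f \<in> schwartz \<Longrightarrow> (\<lambda>x. f (x + a)) \<in> schwartz"
  using schwartz_affine[of f 1 a] by simp

lemma has_derivative_coord:
  "((\<lambda>x::real^'n::finite. complex_of_real (x $ j)) has_derivative (\<lambda>h. of_real (h $ j))) (at x)"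
  by (auto intro!: derivative_eq_intros bounded_linear_vec_nth
      simp: bounded_linear_vec_nth[THEN bounded_linear_imp_has_derivative])

lemma partial_deriv_coord:
  "partial_deriv i (\<lambda>x::real ^ 'n::finite. complex_of_real (x $ j)) x = (if i = j then 1 else 0)"
  by (subst partial_deriv_eq[OF has_derivative_coord]) (auto simp: axis_def)

lemma norm_coord_le: "norm (complex_of_real (x $ j)) \<le> (1 + norm x) ^ 1" for x :: "real ^ 'n::finite"
  using component_le_norm_cart[of x j] by simp

lemma schwartz_coord_mult:
  fixes f :: "'n::finite fn"
  assumes "f \<in> schwartz"
  shows "(\<lambda>x. of_real (x $ j) * f x) \<in> schwartz"
proof -
  let ?M = "{\<lambda>x::real ^ 'n. complex_of_real (x $ j)}"
  have "mult_closure schwartz ?M \<subseteq> schwartz"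
  proof (rule schwartz_mult_closure)
    show "m differentiable (at x)" if "m \<in> ?M" for m x
      using that differentiableI[OF has_derivative_coord] by simp
    show "\<exists>l. \<forall>x. norm (m x) \<le> (1 + norm x) ^ l" if "m \<in> ?M" for m
      using that norm_coord_le by blast
    show "(\<lambda>x. partial_deriv i m x * f x) \<in> mult_closure schwartz ?M"
      if "m \<in> ?M" "f \<in> mult_closure schwartz ?M" for m f i
      using that mult_closure.cmult[OF that(2), of "if i = j then 1 else 0"]
      by (simp add: partial_deriv_coord)
  qed
  then show ?thesis
    using mult_closure.mult[OF _ mult_closure.base[OF assms], of _ ?M] by blast
qed

section \<open>Integration on Euclidean space\<close>

lemma Basis_vec_image: "(Basis :: (real ^ 'n::finite) set) = (\<lambda>j. axis j 1) ` UNIV"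
  by (auto simp: Basis_vec_def)

lemma inj_axis: "inj (\<lambda>j. axis j (1::real) :: real ^ 'n::finite)"
  by (auto simp: inj_on_def axis_eq_axis)

text \<open>Lebesgue measure on vectors is the image of a product measure indexed by
  \<open>Basis\<close>, whereas the integrand is indexed by coordinates. The map \<open>axis\<close>
  identifies the two index sets, \<open>\<iota>\<close> inverts it, and Fubini for finite products
  applies.\<close>

lemma
  fixes g :: "'n::finite \<Rightarrow> real \<Rightarrow> 'b::{real_normed_field, banach, second_countable_topology}"
  assumes g: "\<And>j. integrable lborel (g j)"
  shows integrable_lborel_prod: "integrable lborel (\<lambda>x::real ^ 'n. \<Prod>j\<in>UNIV. g j (x $ j))"
    and integral_lborel_prod:
      "(\<integral>x. (\<Prod>j\<in>UNIV. g j (x $ j)) \<partial>(lborel :: (real ^ 'n) measure)) = (\<Prod>j\<in>UNIV. \<integral>t. g j t \<partial>lborel)"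
proof -
  interpret product_sigma_finite "\<lambda>_ :: real ^ 'n. lborel :: real measure"
    by standard
  define \<iota> :: "real ^ 'n \<Rightarrow> 'n" where "\<iota> = inv (\<lambda>j. axis j 1)"
  have \<iota>: "\<iota> (axis j 1) = j" for j
    unfolding \<iota>_def by (rule inv_f_f[OF inj_axis])
  define T :: "(real ^ 'n \<Rightarrow> real) \<Rightarrow> real ^ 'n" where "T = (\<lambda>f. \<Sum>b\<in>Basis. f b *\<^sub>R b)"
  have T: "T f $ j = f (axis j 1)" for f j
  proof -
    have "T f $ j = T f \<bullet> axis j 1" by (simp add: inner_axis)
    also have "\<dots> = f (axis j 1)"
      unfolding T_def by (rule inner_sum_left_Basis) (simp add: axis_in_Basis_iff)
    finally show ?thesis .
  qed
  have Tm: "T \<in> (\<Pi>\<^sub>M b\<in>Basis. lborel) \<rightarrow>\<^sub>M borel"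
    unfolding T_def by measurable
  have eq: "(\<Prod>j\<in>UNIV. g j (T f $ j)) = (\<Prod>b\<in>Basis. g (\<iota> b) (f b))" for f
    unfolding T Basis_vec_image by (subst prod.reindex[OF inj_axis]) (simp add: \<iota>)
  have lb: "lborel = distr (\<Pi>\<^sub>M b\<in>Basis. lborel) borel T"
    unfolding T_def by (rule lborel_eq)
  have [measurable]: "g j \<in> borel_measurable borel" for j
    using borel_measurable_integrable[OF g] by simp
  have m: "(\<lambda>x::real ^ 'n. \<Prod>j\<in>UNIV. g j (x $ j)) \<in> borel_measurable borel"
    by measurable
  show "integrable lborel (\<lambda>x::real ^ 'n. \<Prod>j\<in>UNIV. g j (x $ j))"
    unfolding lb by (subst integrable_distr_eq[OF Tm m], unfold eq)
      (rule product_integrable_prod, simp, rule g)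
  have "(\<integral>x. (\<Prod>j\<in>UNIV. g j (x $ j)) \<partial>(lborel :: (real ^ 'n) measure)) =
      (\<integral>f. (\<Prod>b\<in>Basis. g (\<iota> b) (f b)) \<partial>(\<Pi>\<^sub>M b\<in>Basis. lborel))"
    unfolding lb by (subst integral_distr[OF Tm m], unfold eq) (rule refl)
  also have "\<dots> = (\<Prod>b\<in>Basis. \<integral>t. g (\<iota> b) t \<partial>lborel)"
    by (rule product_integral_prod) (auto simp: g)
  also have "\<dots> = (\<Prod>j\<in>UNIV. \<integral>t. g j t \<partial>lborel)"
    unfolding Basis_vec_image by (subst prod.reindex[OF inj_axis]) (simp add: \<iota>)
  finally show "(\<integral>x. (\<Prod>j\<in>UNIV. g j (x $ j)) \<partial>(lborel :: (real ^ 'n) measure)) = (\<Prod>j\<in>UNIV. \<integral>t. g j t \<partial>lborel)" .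
qed

lemma integral_lborel_affine:
  fixes f :: "'a::euclidean_space \<Rightarrow> 'b::{banach, second_countable_topology}"
  assumes f: "integrable lborel f" and c: "c \<noteq> 0"
  shows "(\<integral>x. f x \<partial>lborel) = \<bar>c\<bar> ^ DIM('a) *\<^sub>R (\<integral>x. f (t + c *\<^sub>R x) \<partial>lborel)"
proof -
  have [measurable]: "f \<in> borel_measurable borel"
    using borel_measurable_integrable[OF f] by simp
  have [measurable]: "(\<lambda>x. t + c *\<^sub>R x) \<in> borel \<rightarrow>\<^sub>M borel"
    by measurable
  have "(\<integral>x. f x \<partial>lborel) = (\<integral>x. f x \<partial>density (distr lborel borel (\<lambda>x. t + c *\<^sub>R x)) (\<lambda>_. ennreal (\<bar>c\<bar> ^ DIM('a))))"
    using lborel_affine[OF c, of t] by simp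
  also have "\<dots> = \<bar>c\<bar> ^ DIM('a) *\<^sub>R (\<integral>x. f (t + c *\<^sub>R x) \<partial>lborel)"
    by (simp add: integral_density integral_distr)
  finally show "(\<integral>x. f x \<partial>lborel) = \<bar>c\<bar> ^ DIM('a) *\<^sub>R (\<integral>x. f (t + c *\<^sub>R x) \<partial>lborel)" .
qed

section \<open>An integrable majorant for Schwartz functions\<close>

lemma integrable_inverse_one_plus_power2: "integrable lborel (\<lambda>t::real. 1 / (1 + t\<^sup>2))"
  using integrable_inverse_1_plus_square by (simp add: set_integrable_def divide_inverse)

text \<open>The exponent grants each coordinate a factor \<open>(1 + norm x)^2\<close>, which is at
  least \<open>1 + x_j^2\<close>; hence a product of the one-dimensional functions
  \<open>1 / (1 + t^2)\<close> dominates \<open>decay\<close>.\<close>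

definition decay :: "real ^ 'n::finite \<Rightarrow> real" where
  "decay x = 1 / (1 + norm x) ^ (2 * CARD('n))"

lemma decay_pos: "0 < decay x"
  by (simp add: decay_def add_pos_nonneg)

lemma integrable_decay: "integrable lborel (decay :: real ^ 'n::finite \<Rightarrow> real)"
proof (rule Bochner_Integration.integrable_bound)
  show "integrable lborel (\<lambda>x::real ^ 'n. \<Prod>j\<in>UNIV. 1 / (1 + (x $ j)\<^sup>2))"
    by (rule integrable_lborel_prod) (rule integrable_inverse_one_plus_power2)
  show "(decay :: real ^ 'n \<Rightarrow> real) \<in> borel_measurable lborel"
    unfolding decay_def by measurable
  have "norm (decay x) \<le> norm (\<Prod>j\<in>UNIV. 1 / (1 + (x $ j)\<^sup>2))" for x :: "real ^ 'n"
  proof -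
    have "(x $ j)\<^sup>2 \<le> (norm x)\<^sup>2" for j
      using component_le_norm_cart[of x j] by (simp add: abs_le_square_iff[symmetric])
    then have "1 + (x $ j)\<^sup>2 \<le> (1 + norm x)\<^sup>2" for j
      by (simp add: power2_sum add_increasing2)
    then have "1 / (1 + norm x)\<^sup>2 \<le> 1 / (1 + (x $ j)\<^sup>2)" for j
      by (intro frac_le) (auto intro: add_pos_nonneg)
    then have "(\<Prod>j\<in>(UNIV::'n set). 1 / (1 + norm x)\<^sup>2) \<le> (\<Prod>j\<in>UNIV. 1 / (1 + (x $ j)\<^sup>2))"
      by (intro prod_mono) auto
    moreover have "0 \<le> (\<Prod>j\<in>UNIV. 1 / (1 + (x $ j)\<^sup>2))"
      by (intro prod_nonneg) auto
    ultimately show ?thesis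
      by (simp add: decay_def power_mult power_one_over)
  qed
  then show "AE x in lborel. norm (decay (x :: real ^ 'n)) \<le> norm (\<Prod>j\<in>UNIV. 1 / (1 + (x $ j)\<^sup>2))"
    by simp
qed

lemma norm_le_decay:
  fixes f :: "'n::finite fn"
  assumes "(1 + norm x) ^ (2 * CARD('n)) * norm (f x) \<le> C"
  shows "norm (f x) \<le> C * decay x"
  using assms by (simp add: decay_def field_simps add_pos_nonneg)

lemma schwartz_norm_le_decay:
  fixes f :: "'n::finite fn"
  assumes "f \<in> schwartz"
  shows "norm (f x) \<le> schwartz_seminorm (2 * CARD('n), []) f * decay x"
  using schwartz_seminorm_ge[OF assms, of x "2 * CARD('n)" "[]"] by (intro norm_le_decay) simp

lemma schwartz_integrable:
  fixes f :: "'n::finite fn"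
  assumes "f \<in> schwartz"
  shows "integrable lborel f"
proof (rule Bochner_Integration.integrable_bound)
  show "integrable lborel (\<lambda>x. schwartz_seminorm (2 * CARD('n), []) f * decay x)"
    by (intro integrable_mult_right integrable_decay)
  show "f \<in> borel_measurable lborel"
    using schwartz_measurable[OF assms] by simp
  show "AE x in lborel. norm (f x) \<le> norm (schwartz_seminorm (2 * CARD('n), []) f * decay x)"
    using schwartz_norm_le_decay[OF assms] by (intro AE_I2) (simp add: order_trans[OF _ abs_ge_self])
qed

lemma schwartz_integral_norm_le:
  fixes f :: "'n::finite fn"
  assumes "f \<in> schwartz"
  shows "(\<integral>x. norm (f x) \<partial>lborel) \<le> integral\<^sup>L lborel (decay :: real ^ 'n \<Rightarrow> real) * schwartz_seminorm (2 * CARD('n), []) f"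
proof -
  have "(\<integral>x. norm (f x) \<partial>lborel) \<le> (\<integral>x. schwartz_seminorm (2 * CARD('n), []) f * decay (x :: real ^ 'n) \<partial>lborel)"
    using schwartz_norm_le_decay[OF assms]
    by (rule Bochner_Integration.integral_mono[OF
        integrable_norm[OF schwartz_integrable[OF assms]] integrable_mult_right[OF integrable_decay]])
  then show ?thesis by (simp add: mult.commute)
qed

section \<open>The Fourier transform of Schwartz functions\<close>

lemma norm_phase [simp]: "norm (exp (- (\<i> * complex_of_real t))) = 1"
  by (simp add: norm_exp_eq_Re)

lemma phase_measurable [measurable]: "(\<lambda>x. exp (- (\<i> * complex_of_real (\<xi> \<bullet> x)))) \<in> borel_measurable borel"
  for \<xi> :: "'a::euclidean_space"
  by (intro borel_measurable_continuous_onI continuous_intros)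

lemma integrable_phase:
  fixes f :: "'a::euclidean_space \<Rightarrow> complex"
  assumes "integrable lborel f"
  shows "integrable lborel (\<lambda>x. exp (- \<i> * of_real (\<xi> \<bullet> x)) * f x)"
proof (rule Bochner_Integration.integrable_bound[OF assms])
  have [measurable]: "f \<in> borel_measurable borel" using borel_measurable_integrable[OF assms] by simp
  show "(\<lambda>x. exp (- \<i> * of_real (\<xi> \<bullet> x)) * f x) \<in> borel_measurable lborel"
    by simp
  show "AE x in lborel. norm (exp (- \<i> * of_real (\<xi> \<bullet> x)) * f x) \<le> norm (f x)"
    by (simp add: norm_mult)
qed

lemma norm_fourier_le:
  fixes f :: "'n::finite fn"
  assumes "integrable lborel f"
  shows "norm (fourier f \<xi>) \<le> (2 * pi) powr (- real CARD('n) / 2) * (\<integral>x. norm (f x) \<partial>lborel)"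
proof -
  have "norm (\<integral>x. exp (- \<i> * of_real (\<xi> \<bullet> x)) * f x \<partial>lborel) \<le> (\<integral>x. norm (exp (- \<i> * of_real (\<xi> \<bullet> x)) * f x) \<partial>lborel)"
    by (rule integral_norm_bound)
  then show ?thesis
    unfolding fourier_def norm_mult by (intro mult_mono) auto
qed

lemma fourier_add:
  assumes "integrable lborel f" "integrable lborel g"
  shows "fourier (\<lambda>x. f x + g x) \<xi> = fourier f \<xi> + fourier g \<xi>"
  unfolding fourier_def distrib_left
  by (subst Bochner_Integration.integral_add[OF integrable_phase[OF assms(1)] integrable_phase[OF assms(2)]])
    (simp add: distrib_left)

lemma fourier_cmult: "fourier (\<lambda>x. c * f x) \<xi> = c * fourier f \<xi>"
proof -
  have "(\<integral>x. exp (- \<i> * of_real (\<xi> \<bullet> x)) * (c * f x) \<partial>lborel) = (\<integral>x. c * (exp (- \<i> * of_real (\<xi> \<bullet> x)) * f x) \<partial>lborel)"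
    by (simp add: ac_simps)
  then show ?thesis by (simp add: fourier_def)
qed

lemma fourier_uminus_arg:
  assumes "integrable lborel f"
  shows "fourier (\<lambda>x. f (- x)) \<xi> = fourier f (- \<xi>)"
  using integral_lborel_affine[OF integrable_phase[OF assms, of "- \<xi>"], of "-1" 0]
  by (simp add: fourier_def)

lemma fourier_cnj: "cnj (fourier f \<xi>) = fourier (\<lambda>x. cnj (f x)) (- \<xi>)"
proof -
  have "cnj (\<integral>x. exp (- \<i> * of_real (\<xi> \<bullet> x)) * f x \<partial>lborel) = (\<integral>x. cnj (exp (- \<i> * of_real (\<xi> \<bullet> x)) * f x) \<partial>lborel)"
    by (rule Bochner_Integration.integral_cnj[symmetric])
  also have "\<dots> = (\<integral>x. exp (- \<i> * of_real (- \<xi> \<bullet> x)) * cnj (f x) \<partial>lborel)"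
    by (intro Bochner_Integration.integral_cong) (simp_all add: exp_cnj)
  finally show ?thesis by (simp add: fourier_def)
qed

lemma fourier_translate:
  assumes "integrable lborel f"
  shows "fourier (\<lambda>x. f (x + a)) \<xi> = exp (\<i> * of_real (\<xi> \<bullet> a)) * fourier f \<xi>"
proof -
  have "(\<integral>x. exp (- \<i> * of_real (\<xi> \<bullet> x)) * f x \<partial>lborel) =
    (\<integral>x. exp (- \<i> * of_real (\<xi> \<bullet> a)) * (exp (- \<i> * of_real (\<xi> \<bullet> x)) * f (x + a)) \<partial>lborel)"
    by (subst integral_lborel_affine[OF integrable_phase[OF assms], of 1 _ a])
      (simp_all add: inner_add_right algebra_simps exp_add[symmetric] flip: mult.assoc)
  then have "fourier f \<xi> = exp (- \<i> * of_real (\<xi> \<bullet> a)) * fourier (\<lambda>x. f (x + a)) \<xi>"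
    by (simp add: fourier_def)
  then show ?thesis
    by (simp add: exp_minus field_simps)
qed

lemma fourier_scale:
  fixes f :: "'n::finite fn"
  assumes "integrable lborel f" and "r > 0"
  shows "fourier f ((1 / r) *\<^sub>R \<xi>) = of_real (r ^ CARD('n)) * fourier (\<lambda>x. f (r *\<^sub>R x)) \<xi>"
proof -
  have "(\<integral>x. exp (- \<i> * of_real (((1 / r) *\<^sub>R \<xi>) \<bullet> x)) * f x \<partial>lborel) =
      r ^ CARD('n) *\<^sub>R (\<integral>x. exp (- \<i> * of_real (\<xi> \<bullet> x)) * f (r *\<^sub>R x) \<partial>lborel)"
    using assms(2)
    by (subst integral_lborel_affine[OF integrable_phase[OF assms(1)], of r _ 0]) auto
  then show ?thesis by (simp add: fourier_def scaleR_conv_of_real)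
qed

lemma fourier_measurable [measurable]:
  fixes f :: "'n::finite fn"
  assumes [measurable]: "f \<in> borel_measurable borel"
  shows "fourier f \<in> borel_measurable borel"
proof -
  have [measurable]: "(\<lambda>(\<xi>, x). exp (- \<i> * of_real (\<xi> \<bullet> x)) * f x) \<in> borel_measurable (borel \<Otimes>\<^sub>M (lborel :: (real ^ 'n) measure))"
    by measurable
  show ?thesis
    unfolding fourier_def by measurable
qed

text \<open>The kernel is symmetric and of modulus one, so both sides are iterated forms of one
  absolutely convergent double integral.\<close>

lemma fourier_duality:
  fixes f g :: "'n::finite fn"
  assumes f: "integrable lborel f" and g: "integrable lborel g"
  shows "(\<integral>x. fourier f x * g x \<partial>lborel) = (\<integral>x. f x * fourier g x \<partial>lborel)"
proof -
  have [measurable]: "f \<in> borel_measurable borel" "g \<in> borel_measurable borel"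
    using borel_measurable_integrable[OF f] borel_measurable_integrable[OF g] by simp_all
  let ?h = "\<lambda>x y. exp (- \<i> * of_real (y \<bullet> x)) * f x * g y"
  have int: "integrable (lborel \<Otimes>\<^sub>M lborel) (case_prod ?h)"
  proof (rule lborel_pair.Fubini_integrable)
    show "case_prod ?h \<in> borel_measurable (lborel \<Otimes>\<^sub>M lborel)"
      by measurable
    show "integrable lborel (\<lambda>x. \<integral>y. norm (case (x, y) of (x, y) \<Rightarrow> ?h x y) \<partial>lborel)"
      using f by (simp add: norm_mult)
    show "AE x in lborel. integrable lborel (\<lambda>y. case (x, y) of (x, y) \<Rightarrow> ?h x y)"
    proof (rule AE_I2)
      fix x
      have "integrable lborel (\<lambda>y. f x * (exp (- \<i> * of_real (x \<bullet> y)) * g y))"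
        by (intro integrable_mult_right integrable_phase g)
      then show "integrable lborel (\<lambda>y. case (x, y) of (x, y) \<Rightarrow> ?h x y)"
        by (simp add: ac_simps inner_commute)
    qed
  qed
  let ?\<kappa> = "complex_of_real ((2 * pi) powr (- real CARD('n) / 2))"
  have "(\<integral>y. fourier f y * g y \<partial>lborel) = ?\<kappa> * (\<integral>y. (\<integral>x. ?h x y \<partial>lborel) \<partial>lborel)"
    by (simp add: fourier_def flip: integral_mult_left_zero integral_mult_right_zero) (simp add: ac_simps)
  also have "(\<integral>y. (\<integral>x. ?h x y \<partial>lborel) \<partial>lborel) = (\<integral>x. (\<integral>y. ?h x y \<partial>lborel) \<partial>lborel)"
    by (rule lborel_pair.Fubini_integral[OF int])
  also have "?\<kappa> * \<dots> = (\<integral>x. f x * fourier g x \<partial>lborel)"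
    by (simp add: fourier_def inner_commute flip: integral_mult_left_zero integral_mult_right_zero) (simp add: ac_simps)
  finally show ?thesis .
qed

section \<open>Transforms of derivatives\<close>

lemma decay_le_of_near:
  fixes x y :: "real ^ 'n::finite"
  assumes "norm (y - x) \<le> 1"
  shows "decay y \<le> 4 ^ CARD('n) * decay x"
proof -
  have "1 + norm x \<le> 2 * (1 + norm y)"
  proof -
    have "norm x \<le> norm y + norm (y - x)"
      using norm_triangle_sub[of x y] by (simp add: norm_minus_commute)
    also have "\<dots> \<le> 1 + 2 * norm y"
      using assms norm_ge_zero[of y] by (simp del: norm_ge_zero)
    finally show ?thesis by simp
  qed
  then have "(1 + norm x) ^ (2 * CARD('n)) \<le> (2 * (1 + norm y)) ^ (2 * CARD('n))"
    by (intro power_mono) auto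
  also have "\<dots> = 4 ^ CARD('n) * (1 + norm y) ^ (2 * CARD('n))"
    unfolding power_mult_distrib by (simp add: power_mult)
  finally show ?thesis
    by (simp add: decay_def field_simps add_pos_nonneg)
qed

text \<open>Mean value inequality along a segment in direction \<open>j\<close>. For
  \<open>t \<le> 1\<close> its points are within distance 1 of \<open>x\<close>, where
  \<open>1 + norm\<close> is at least half its value at \<open>x\<close>; this accounts for the
  factor \<open>4 ^ CARD('n)\<close>. After division by \<open>t\<close> the bound is an integrable
  majorant independent of \<open>t\<close>.\<close>

lemma schwartz_increment_le:
  fixes f :: "'n::finite fn"
  assumes f: "f \<in> schwartz" and t: "0 < t" "t \<le> 1"
  shows "norm (f (x + t *\<^sub>R axis j 1) - f x) \<le>
    t * (schwartz_seminorm (2 * CARD('n), []) (partial_deriv j f) * (4 ^ CARD('n) * decay x))"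
proof -
  let ?S = "schwartz_seminorm (2 * CARD('n), []) (partial_deriv j f)"
  let ?u = "axis j (1::real)"
  have "norm ((\<lambda>s. f (x + s *\<^sub>R ?u)) t - (\<lambda>s. f (x + s *\<^sub>R ?u)) 0) \<le> (?S * (4 ^ CARD('n) * decay x)) * norm (t - 0)"
  proof (rule differentiable_bound)
    show "convex {0..t}" by simp
    fix s assume s: "s \<in> {0..t}"
    let ?f' = "frechet_derivative f (at (x + s *\<^sub>R ?u))"
    show "((\<lambda>s. f (x + s *\<^sub>R ?u)) has_derivative (\<lambda>h. ?f' (h *\<^sub>R ?u))) (at s within {0..t})"
      by (rule has_derivative_at_withinI, rule has_derivative_compose[where f = "\<lambda>s. x + s *\<^sub>R ?u", OF _ schwartz_has_derivative[OF f]])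
        (auto intro!: derivative_eq_intros)
    have "norm (partial_deriv j f (x + s *\<^sub>R ?u)) \<le> ?S * decay (x + s *\<^sub>R ?u)"
      by (rule schwartz_norm_le_decay[OF schwartz_partial_deriv[OF f]])
    also have "\<dots> \<le> ?S * (4 ^ CARD('n) * decay x)"
      using s t by (intro mult_left_mono decay_le_of_near schwartz_seminorm_nonneg schwartz_partial_deriv f) auto
    finally have *: "norm (partial_deriv j f (x + s *\<^sub>R ?u)) \<le> ?S * (4 ^ CARD('n) * decay x)" .
    have "?f' (h *\<^sub>R ?u) = h *\<^sub>R partial_deriv j f (x + s *\<^sub>R ?u)" for h
      unfolding partial_deriv_def
      by (rule linear_cmul[OF bounded_linear.linear[OF has_derivative_bounded_linear[OF schwartz_has_derivative[OF f]]]])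
    with * show "onorm (\<lambda>h. ?f' (h *\<^sub>R ?u)) \<le> ?S * (4 ^ CARD('n) * decay x)"
      by (intro onorm_le) (simp add: mult.commute[of _ "\<bar>_\<bar>"] mult_left_mono)
  qed (use t in auto)
  then show ?thesis using t by (simp add: mult.commute)
qed

lemma schwartz_difference_quotient:
  fixes f :: "'n::finite fn"
  assumes f: "f \<in> schwartz" and t: "t \<longlonglongrightarrow> 0" "\<And>m. (0::real) < t m"
  shows "(\<lambda>m. (f (x + t m *\<^sub>R axis j 1) - f x) / of_real (t m)) \<longlonglongrightarrow> partial_deriv j f x"
proof -
  let ?u = "axis j (1::real)"
  let ?f' = "frechet_derivative f (at x)"
  have "((\<lambda>h. norm (f (x + h) - f x - ?f' h) / norm h) \<longlongrightarrow> 0) (at 0)"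
    using schwartz_has_derivative[OF f] unfolding has_derivative_at by blast
  moreover have "filterlim (\<lambda>m. t m *\<^sub>R ?u) (at 0) sequentially"
    unfolding filterlim_at
  proof (intro conjI)
    show "(\<lambda>m. t m *\<^sub>R ?u) \<longlonglongrightarrow> 0"
      using tendsto_scaleR[OF t(1) tendsto_const[of ?u]] by simp
    show "\<forall>\<^sub>F m in sequentially. t m *\<^sub>R ?u \<in> UNIV \<and> t m *\<^sub>R ?u \<noteq> 0"
      using t(2) by (simp add: axis_eq_0_iff less_imp_neq[symmetric])
  qed
  ultimately have "(\<lambda>m. norm (f (x + t m *\<^sub>R ?u) - f x - ?f' (t m *\<^sub>R ?u)) / norm (t m *\<^sub>R ?u)) \<longlonglongrightarrow> 0"
    by (rule filterlim_compose)
  moreover have "norm (f (x + t m *\<^sub>R ?u) - f x - ?f' (t m *\<^sub>R ?u)) / norm (t m *\<^sub>R ?u) =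
      norm ((f (x + t m *\<^sub>R ?u) - f x) / of_real (t m) - partial_deriv j f x)" for m
  proof -
    have "?f' (t m *\<^sub>R ?u) = of_real (t m) * partial_deriv j f x"
      unfolding partial_deriv_def scaleR_conv_of_real[symmetric]
      by (rule linear_cmul[OF bounded_linear.linear[OF has_derivative_bounded_linear[OF schwartz_has_derivative[OF f]]]])
    moreover have "norm (t m *\<^sub>R ?u) = norm (complex_of_real (t m))" by simp
    ultimately have "norm (f (x + t m *\<^sub>R ?u) - f x - ?f' (t m *\<^sub>R ?u)) / norm (t m *\<^sub>R ?u) =
        norm ((f (x + t m *\<^sub>R ?u) - f x - of_real (t m) * partial_deriv j f x) / of_real (t m))"
      by (simp only: norm_divide)
    then show ?thesis
      using t(2)[of m] by (simp add: diff_divide_distrib)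
  qed
  ultimately show ?thesis
    by (simp add: tendsto_norm_zero_iff LIM_zero_iff)
qed

text \<open>In place of integration by parts, translation turns the difference quotient of
  \<open>f\<close> into the factor \<open>(exp (i \<xi>_j t) - 1) / t\<close> on the transform. The
  transformed quotients are then followed to their limit in two ways: by dominated convergence, and
  by the derivative of the exponential at 0.\<close>

lemma fourier_partial_deriv:
  fixes f :: "'n::finite fn"
  assumes f: "f \<in> schwartz"
  shows "fourier (partial_deriv j f) \<xi> = \<i> * of_real (\<xi> $ j) * fourier f \<xi>"
proof (rule LIMSEQ_unique)
  let ?u = "axis j (1::real) :: real ^ 'n"
  define t :: "nat \<Rightarrow> real" where "t m = inverse (real (Suc m))" for m
  have t: "t \<longlonglongrightarrow> 0" "\<And>m. 0 < t m" "\<And>m. t m \<le> 1"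
    unfolding t_def by (rule LIMSEQ_inverse_real_of_nat) (auto simp: inverse_eq_divide)
  define q where "q m x = (f (x + t m *\<^sub>R ?u) - f x) / of_real (t m)" for m x
  have [measurable]: "f \<in> borel_measurable borel" "partial_deriv j f \<in> borel_measurable borel"
    using schwartz_measurable f schwartz_partial_deriv by blast+
  have [measurable]: "q m \<in> borel_measurable borel" for m
    unfolding q_def by measurable
  have "(\<lambda>m. \<integral>x. exp (- \<i> * of_real (\<xi> \<bullet> x)) * q m x \<partial>lborel) \<longlonglongrightarrow>
      (\<integral>x. exp (- \<i> * of_real (\<xi> \<bullet> x)) * partial_deriv j f x \<partial>lborel)"
  proof (rule integral_dominated_convergence)
    let ?S = "schwartz_seminorm (2 * CARD('n), []) (partial_deriv j f)"
    show "integrable lborel (\<lambda>x. ?S * (4 ^ CARD('n) * decay (x :: real ^ 'n)))"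
      by (intro integrable_mult_right integrable_decay)
    show "AE x in lborel. (\<lambda>m. exp (- \<i> * of_real (\<xi> \<bullet> x)) * q m x) \<longlonglongrightarrow>
        exp (- \<i> * of_real (\<xi> \<bullet> x)) * partial_deriv j f x"
      unfolding q_def by (intro AE_I2 tendsto_intros schwartz_difference_quotient f t)
    show "AE x in lborel. norm (exp (- \<i> * of_real (\<xi> \<bullet> x)) * q m x) \<le> ?S * (4 ^ CARD('n) * decay x)" for m
      using schwartz_increment_le[OF f t(2)[of m] t(3)[of m], of _ j] t(2)[of m]
      by (intro AE_I2) (simp add: norm_mult q_def norm_divide pos_divide_le_eq mult.commute)
  qed simp_all
  then show "(\<lambda>m. fourier (q m) \<xi>) \<longlonglongrightarrow> fourier (partial_deriv j f) \<xi>"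
    unfolding fourier_def by (rule tendsto_mult_left)
  have q: "fourier (q m) \<xi> = (exp (\<i> * of_real (\<xi> $ j) * of_real (t m)) - 1) / of_real (t m) * fourier f \<xi>" for m
  proof -
    have int: "integrable lborel (\<lambda>x. f (x + t m *\<^sub>R ?u))" "integrable lborel (\<lambda>x. -1 * f x)"
      using schwartz_integrable[OF schwartz_translate[OF f]] schwartz_integrable[OF f] by simp_all
    have "q m = (\<lambda>x. (1 / of_real (t m)) * (f (x + t m *\<^sub>R ?u) + -1 * f x))"
      by (simp add: q_def fun_eq_iff)
    then have "fourier (q m) \<xi> = 1 / of_real (t m) * (exp (\<i> * of_real (\<xi> \<bullet> (t m *\<^sub>R ?u))) * fourier f \<xi> + -1 * fourier f \<xi>)"
      by (simp only: fourier_cmult fourier_add[OF int] fourier_translate[OF schwartz_integrable[OF f]])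
    then show ?thesis
      by (simp add: algebra_simps inner_axis diff_divide_distrib)
  qed
  have "((\<lambda>z. exp (\<i> * of_real (\<xi> $ j) * z)) has_field_derivative \<i> * of_real (\<xi> $ j)) (at 0)"
    by (auto intro!: derivative_eq_intros)
  then have "((\<lambda>z. (exp (\<i> * of_real (\<xi> $ j) * (0 + z)) - exp (\<i> * of_real (\<xi> $ j) * 0)) / z) \<longlongrightarrow> \<i> * of_real (\<xi> $ j)) (at 0)"
    unfolding DERIV_def .
  moreover have "filterlim (\<lambda>m. complex_of_real (t m)) (at 0) sequentially"
    unfolding filterlim_at
    using tendsto_of_real[OF t(1), where 'a = complex] t(2) by (simp add: less_imp_neq[symmetric])
  ultimately have "(\<lambda>m. (exp (\<i> * of_real (\<xi> $ j) * (0 + of_real (t m))) - exp (\<i> * of_real (\<xi> $ j) * 0)) / of_real (t m))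
      \<longlonglongrightarrow> \<i> * of_real (\<xi> $ j)"
    by (rule filterlim_compose)
  then show "(\<lambda>m. fourier (q m) \<xi>) \<longlonglongrightarrow> \<i> * of_real (\<xi> $ j) * fourier f \<xi>"
    unfolding q by (intro tendsto_mult_right) simp
qed

lemma fourier_partial_derivs_replicate:
  assumes "f \<in> schwartz"
  shows "fourier (partial_derivs (replicate m j) f) \<xi> = (\<i> * of_real (\<xi> $ j)) ^ m * fourier f \<xi>"
  by (induction m) (simp_all add: fourier_partial_deriv schwartz_partial_derivs assms)

section \<open>Smoothness and decay of the transform\<close>

lemma norm_exp_minus_one_minus_le:
  "norm (exp (- \<i> * of_real t) - 1 + \<i> * of_real t) \<le> t\<^sup>2 / 2"
  using iexp_approx1[of "- t" 1] by (simp add: power2_eq_square algebra_simps)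

lemma integrable_norm_power_mult:
  fixes f :: "'n::finite fn"
  assumes f: "f \<in> schwartz"
  shows "integrable lborel (\<lambda>x. (norm x) ^ k * norm (f x))"
proof -
  let ?C = "schwartz_seminorm (k + 2 * CARD('n), []) f"
  have [measurable]: "f \<in> borel_measurable borel"
    using schwartz_measurable f by blast
  show ?thesis
  proof (rule Bochner_Integration.integrable_bound)
    show "integrable lborel (\<lambda>x. ?C * decay (x :: real ^ 'n))"
      by (intro integrable_mult_right integrable_decay)
    have "norm x ^ k * norm (f x) \<le> ?C * decay x" for x
    proof -
      have "(1 + norm x) ^ (2 * CARD('n)) * norm (norm x ^ k * f x) \<le> (1 + norm x) ^ (k + 2 * CARD('n)) * norm (f x)"
        by (simp add: norm_mult norm_power power_add mult.assoc mult.left_commute mult_mono power_mono)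
      also have "\<dots> \<le> ?C"
        using schwartz_seminorm_ge[OF f, of x _ "[]"] by simp
      finally have "norm (norm x ^ k * f x) \<le> ?C * decay x"
        by (rule norm_le_decay[of x "\<lambda>x. norm x ^ k * f x"])
      then show ?thesis by (simp add: norm_mult norm_power)
    qed
    then show "AE x in lborel. norm (norm x ^ k * norm (f x)) \<le> norm (?C * decay x)"
      by (intro AE_I2) (simp add: norm_mult order_trans[OF _ abs_ge_self])
  qed simp
qed

text \<open>The exponential differs from its linear part by at most half the square of the phase.
  The error of the linear approximation is therefore at most \<open>M\<close> times the square of
  the increment, with \<open>M\<close> half the second moment of \<open>norm (f x)\<close> times the
  Fourier constant.\<close>

lemma fourier_has_derivative:
  fixes f :: "'n::finite fn"
  assumes f: "f \<in> schwartz"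
  shows "(fourier f has_derivative (\<lambda>h. \<Sum>j\<in>UNIV. of_real (h $ j) * (- \<i> * fourier (\<lambda>x. of_real (x $ j) * f x) \<xi>))) (at \<xi>)"
    (is "(_ has_derivative ?D) _")
proof -
  let ?\<kappa> = "(2 * pi) powr (- real CARD('n) / 2)"
  define M where "M = ?\<kappa> * ((\<integral>x. (norm x)\<^sup>2 * norm (f x) \<partial>lborel) / 2)"
  have intf: "integrable lborel f"
    by (rule schwartz_integrable[OF f])
  have intj: "integrable lborel (\<lambda>x. of_real (x $ j) * f x)" for j
    by (intro schwartz_integrable schwartz_coord_mult f)
  have [measurable]: "f \<in> borel_measurable borel"
    using schwartz_measurable f by blast
  have M: "norm (fourier f \<eta> - fourier f \<xi> - ?D (\<eta> - \<xi>)) \<le> M * (norm (\<eta> - \<xi>))\<^sup>2" for \<eta>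
  proof -
    let ?h = "\<eta> - \<xi>"
    let ?e = "\<lambda>\<xi> x. exp (- \<i> * of_real (\<xi> \<bullet> x))"
    let ?r = "\<lambda>x. ?e \<xi> x * f x * (exp (- \<i> * of_real (?h \<bullet> x)) - 1 + \<i> * of_real (?h \<bullet> x))"
    \<comment> \<open>The remainder is expanded so that its linear term becomes a sum of integrands
      of transforms of \<open>x_j f\<close>.\<close>
    have r: "?r x = ?e \<eta> x * f x - ?e \<xi> x * f x + (\<Sum>j\<in>UNIV. \<i> * of_real (?h $ j) * (?e \<xi> x * (of_real (x $ j) * f x)))" for x
    proof -
      have "?e \<xi> x * exp (- \<i> * of_real (?h \<bullet> x)) = ?e \<eta> x"
        unfolding exp_add[symmetric] by (simp add: inner_diff_left algebra_simps)
      moreover have "complex_of_real (?h \<bullet> x) = (\<Sum>j\<in>UNIV. of_real (?h $ j) * of_real (x $ j))"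
        by (simp add: inner_vec_def)
      moreover have "(\<Sum>j\<in>UNIV. \<i> * of_real (?h $ j) * (?e \<xi> x * (of_real (x $ j) * f x))) =
          ?e \<xi> x * f x * (\<i> * (\<Sum>j\<in>UNIV. of_real (?h $ j) * of_real (x $ j)))"
        unfolding sum_distrib_left by (intro sum.cong) simp_all
      moreover have "?r x = (?e \<xi> x * exp (- \<i> * of_real (?h \<bullet> x))) * f x - ?e \<xi> x * f x + ?e \<xi> x * f x * (\<i> * of_real (?h \<bullet> x))"
        by (simp only: ring_distribs mult_1_right mult.assoc mult.commute[of "f x" "exp _"] )
      ultimately show ?thesis
        by simp
    qed
    have "(\<integral>x. ?r x \<partial>lborel) = (\<integral>x. ?e \<eta> x * f x \<partial>lborel) - (\<integral>x. ?e \<xi> x * f x \<partial>lborel) +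
        (\<Sum>j\<in>UNIV. \<i> * of_real (?h $ j) * (\<integral>x. ?e \<xi> x * (of_real (x $ j) * f x) \<partial>lborel))"
      unfolding r using integrable_phase[OF intf] integrable_phase[OF intj]
      by (simp add: Bochner_Integration.integral_add Bochner_Integration.integral_diff Bochner_Integration.integral_sum
          Bochner_Integration.integrable_diff Bochner_Integration.integrable_sum)
    then have "?\<kappa> * (\<integral>x. ?r x \<partial>lborel) = fourier f \<eta> - fourier f \<xi> - ?D ?h"
    proof -
      have "?\<kappa> * (\<Sum>j\<in>UNIV. \<i> * of_real (?h $ j) * (\<integral>x. ?e \<xi> x * (of_real (x $ j) * f x) \<partial>lborel)) = - ?D ?h"
        unfolding fourier_def sum_distrib_left sum_negf[symmetric] by (intro sum.cong) simp_all
      moreover assume "(\<integral>x. ?r x \<partial>lborel) = (\<integral>x. ?e \<eta> x * f x \<partial>lborel) - (\<integral>x. ?e \<xi> x * f x \<partial>lborel) +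
        (\<Sum>j\<in>UNIV. \<i> * of_real (?h $ j) * (\<integral>x. ?e \<xi> x * (of_real (x $ j) * f x) \<partial>lborel))"
      ultimately show ?thesis
        by (simp only: fourier_def[of f] distrib_left right_diff_distrib) simp
    qed
    then have "norm (fourier f \<eta> - fourier f \<xi> - ?D ?h) = norm (?\<kappa> * (\<integral>x. ?r x \<partial>lborel))"
      by (rule arg_cong[OF sym])
    also have "\<dots> = ?\<kappa> * norm (\<integral>x. ?r x \<partial>lborel)"
      by (simp only: norm_mult norm_of_real) simp
    finally have "norm (fourier f \<eta> - fourier f \<xi> - ?D ?h) = ?\<kappa> * norm (\<integral>x. ?r x \<partial>lborel)" .
    also have "norm (\<integral>x. ?r x \<partial>lborel) \<le> (\<integral>x. (norm ?h)\<^sup>2 / 2 * ((norm x)\<^sup>2 * norm (f x)) \<partial>lborel)"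
    proof (rule order_trans[OF integral_norm_bound integral_mono_AE])
      show int: "integrable lborel (\<lambda>x. (norm ?h)\<^sup>2 / 2 * ((norm x)\<^sup>2 * norm (f x)))"
        by (intro integrable_mult_right integrable_norm_power_mult f)
      have b: "norm (?r x) \<le> (norm ?h)\<^sup>2 / 2 * ((norm x)\<^sup>2 * norm (f x))" for x
      proof -
        have "norm (?r x) = norm (f x) * norm (exp (- \<i> * of_real (?h \<bullet> x)) - 1 + \<i> * of_real (?h \<bullet> x))"
          by (simp add: norm_mult)
        also have "\<dots> \<le> norm (f x) * ((?h \<bullet> x)\<^sup>2 / 2)"
          by (intro mult_left_mono norm_exp_minus_one_minus_le) simp
        also have "\<dots> \<le> norm (f x) * ((norm ?h * norm x)\<^sup>2 / 2)"
          using Cauchy_Schwarz_ineq2[of ?h x]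
          by (intro mult_left_mono divide_right_mono) (auto simp: abs_le_square_iff[symmetric])
        finally show ?thesis by (simp add: power_mult_distrib ac_simps)
      qed
      then show "AE x in lborel. norm (?r x) \<le> (norm ?h)\<^sup>2 / 2 * ((norm x)\<^sup>2 * norm (f x))"
        by simp
      have "integrable lborel ?r"
        by (rule Bochner_Integration.integrable_bound[OF int])
          (simp, intro AE_I2 order_trans[OF b], simp)
      then show "integrable lborel (\<lambda>x. norm (?r x))"
        by (rule integrable_norm)
    qed
    also have "\<dots> = (norm ?h)\<^sup>2 * ((\<integral>x. (norm x)\<^sup>2 * norm (f x) \<partial>lborel) / 2)"
      by simp
    finally show ?thesis by (simp add: M_def ac_simps mult_left_mono)
  qed
  show ?thesis
    unfolding has_derivative_at_alt
  proof (intro conjI allI impI)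
    show "bounded_linear ?D"
      by (intro bounded_linear_sum bounded_linear_mult_const bounded_linear_compose[OF bounded_linear_of_real] bounded_linear_vec_nth)
    fix e :: real assume e: "e > 0"
    have M0: "0 \<le> M" unfolding M_def by simp
    show "\<exists>d>0. \<forall>\<eta>. norm (\<eta> - \<xi>) < d \<longrightarrow> norm (fourier f \<eta> - fourier f \<xi> - ?D (\<eta> - \<xi>)) \<le> e * norm (\<eta> - \<xi>)"
    proof (intro exI[of _ "e / (M + 1)"] conjI allI impI)
      show "0 < e / (M + 1)" using e M0 by simp
      fix \<eta> assume "norm (\<eta> - \<xi>) < e / (M + 1)"
      then have "(M + 1) * norm (\<eta> - \<xi>) < e"
        using M0 by (simp add: field_simps)
      then have "M * norm (\<eta> - \<xi>) \<le> e"
        by (simp add: distrib_right) (smt (verit) norm_ge_zero)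
      then have "M * norm (\<eta> - \<xi>) * norm (\<eta> - \<xi>) \<le> e * norm (\<eta> - \<xi>)"
        by (intro mult_right_mono) auto
      with M[of \<eta>] show "norm (fourier f \<eta> - fourier f \<xi> - ?D (\<eta> - \<xi>)) \<le> e * norm (\<eta> - \<xi>)"
        by (simp add: power2_eq_square)
    qed
  qed
qed

lemma partial_deriv_fourier:
  fixes f :: "'n::finite fn"
  assumes "f \<in> schwartz"
  shows "partial_deriv j (fourier f) \<xi> = - \<i> * fourier (\<lambda>x. of_real (x $ j) * f x) \<xi>"
  by (subst partial_deriv_eq[OF fourier_has_derivative[OF assms]])
    (simp add: axis_def if_distrib[of of_real] if_distrib[of "\<lambda>x. x * _"] sum_negf cong: if_cong)

text \<open>The largest among 1 and the squares of the coordinates controls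
  \<open>1 + (norm x)^2\<close>, so its powers are controlled by powers of single coordinates,
  without mixed monomials. As a result \<open>fourier_decay\<close> involves derivatives in only one
  direction at a time.\<close>

lemma one_plus_norm_power2_power_le:
  fixes x :: "real ^ 'n::finite"
  shows "(1 + (norm x)\<^sup>2) ^ N \<le> (1 + CARD('n)) ^ N * (1 + (\<Sum>j\<in>UNIV. \<bar>x $ j\<bar> ^ (2 * N)))"
proof -
  define A where "A = insert 1 (range (\<lambda>j. (x $ j)\<^sup>2))"
  have A: "finite A" "A \<noteq> {}" by (auto simp: A_def)
  have le: "(x $ j)\<^sup>2 \<le> Max A" "1 \<le> Max A" for j
    by (auto intro!: Max_ge A(1)) (auto simp: A_def)
  have "(norm x)\<^sup>2 = (\<Sum>j\<in>UNIV. (x $ j)\<^sup>2)"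
    unfolding power2_norm_eq_inner inner_vec_def by (simp add: power2_eq_square)
  also have "\<dots> \<le> (\<Sum>j\<in>(UNIV :: 'n set). Max A)"
    by (intro sum_mono le)
  finally have "1 + (norm x)\<^sup>2 \<le> (1 + CARD('n)) * Max A"
    using le by (simp add: distrib_right)
  then have "(1 + (norm x)\<^sup>2) ^ N \<le> ((1 + CARD('n)) * Max A) ^ N"
    by (intro power_mono) auto
  also have "\<dots> = (1 + CARD('n)) ^ N * Max A ^ N"
    by (simp only: power_mult_distrib of_nat_power)
  also have "Max A ^ N \<le> 1 + (\<Sum>j\<in>UNIV. \<bar>x $ j\<bar> ^ (2 * N))"
  proof -
    have "Max A \<in> A" by (rule Max_in[OF A])
    then consider "Max A = 1" | j where "Max A = (x $ j)\<^sup>2" by (auto simp: A_def)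
    then show ?thesis
    proof cases
      case 1
      then show ?thesis by (simp add: sum_nonneg)
    next
      case 2
      have "\<bar>x $ j\<bar> ^ (2 * N) \<le> (\<Sum>j\<in>UNIV. \<bar>x $ j\<bar> ^ (2 * N))"
        by (rule member_le_sum) auto
      then show ?thesis using 2 by (simp add: power_mult)
    qed
  qed
  finally show ?thesis by (simp add: mult_left_mono)
qed

text \<open>Up to sign, multiplication by the power \<open>2 * N\<close> of a coordinate corresponds
  to \<open>2 * N\<close> derivatives in that direction, and a transform is bounded by a multiple of
  the L1 norm. That \<open>C\<close> is the same for all \<open>f\<close> is what continuity of
  functionals requires.\<close>

lemma fourier_decay:
  "\<exists>C\<ge>0. \<forall>f\<in>(schwartz :: 'n::finite fn set). \<forall>\<xi>. (1 + (norm \<xi>)\<^sup>2) ^ N * norm (fourier f \<xi>) \<le>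
    C * (\<Sum>is\<in>insert [] (range (\<lambda>j. replicate (2 * N) j)). schwartz_seminorm (2 * CARD('n), is) f)"
proof -
  let ?I = "insert [] (range (\<lambda>j::'n. replicate (2 * N) j))"
  define c where "c = (2 * pi) powr (- real CARD('n) / 2) * integral\<^sup>L lborel (decay :: real ^ 'n \<Rightarrow> real)"
  have c: "0 \<le> c"
    unfolding c_def by (intro mult_nonneg_nonneg Bochner_Integration.integral_nonneg) (auto intro: less_imp_le decay_pos)
  have nf: "norm (fourier (partial_derivs is f) \<xi>) \<le> c * schwartz_seminorm (2 * CARD('n), is) f"
    if f: "f \<in> schwartz" for f :: "'n fn" and "is" \<xi>
  proof -
    have f': "partial_derivs is f \<in> schwartz" by (rule schwartz_partial_derivs[OF f])
    have "schwartz_seminorm (2 * CARD('n), []) (partial_derivs is f) = schwartz_seminorm (2 * CARD('n), is) f"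
      by (simp add: schwartz_seminorm_def)
    then have "(\<integral>x. norm (partial_derivs is f x) \<partial>lborel) \<le> integral\<^sup>L lborel (decay :: real ^ 'n \<Rightarrow> real) * schwartz_seminorm (2 * CARD('n), is) f"
      using schwartz_integral_norm_le[OF f'] by simp
    then show ?thesis
      using norm_fourier_le[OF schwartz_integrable[OF f'], of \<xi>]
      unfolding c_def mult.assoc by (meson mult_left_mono order_trans powr_ge_zero)
  qed
  show ?thesis
  proof (intro exI[of _ "(1 + CARD('n)) ^ N * ((1 + CARD('n)) * c)"] conjI ballI allI)
    show "0 \<le> (1 + CARD('n)) ^ N * ((1 + CARD('n)) * c)" using c by simp
    fix f :: "'n fn" and \<xi> assume f: "f \<in> schwartz"
    define S where "S = (\<Sum>is\<in>?I. schwartz_seminorm (2 * CARD('n), is) f)"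
    have S: "schwartz_seminorm (2 * CARD('n), is) f \<le> S" if "is \<in> ?I" for "is"
      unfolding S_def using that by (intro member_le_sum) (auto intro: schwartz_seminorm_nonneg[OF f])
    have nfS: "norm (fourier (partial_derivs is f) \<xi>) \<le> c * S" if "is \<in> ?I" for "is"
      using nf[OF f, of "is" \<xi>] mult_left_mono[OF S[OF that] c] by simp
    have "(1 + (norm \<xi>)\<^sup>2) ^ N * norm (fourier f \<xi>) \<le>
        (1 + CARD('n)) ^ N * (1 + (\<Sum>j\<in>UNIV. \<bar>\<xi> $ j\<bar> ^ (2 * N))) * norm (fourier f \<xi>)"
      by (intro mult_right_mono one_plus_norm_power2_power_le) simp
    also have "\<dots> = (1 + CARD('n)) ^ N * (norm (fourier (partial_derivs [] f) \<xi>) +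
        (\<Sum>j\<in>UNIV. norm (fourier (partial_derivs (replicate (2 * N) j) f) \<xi>)))"
      by (simp add: fourier_partial_derivs_replicate[OF f] norm_mult norm_power sum_distrib_right distrib_right)
    also have "\<dots> \<le> (1 + CARD('n)) ^ N * (c * S + (\<Sum>j\<in>(UNIV :: 'n set). c * S))"
      by (intro mult_left_mono add_mono sum_mono nfS) auto
    also have "\<dots> = (1 + CARD('n)) ^ N * ((1 + CARD('n)) * c) * S"
      by (simp add: algebra_simps)
    finally show "(1 + (norm \<xi>)\<^sup>2) ^ N * norm (fourier f \<xi>) \<le>
        real ((1 + CARD('n)) ^ N) * ((1 + CARD('n)) * c) * (\<Sum>is\<in>?I. schwartz_seminorm (2 * CARD('n), is) f)"
      by (simp add: S_def)
  qed
qed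

lemma schwartz_fourier:
  fixes f :: "'n::finite fn"
  assumes "f \<in> schwartz"
  shows "fourier f \<in> schwartz"
proof (rule schwartz_coinduct[where S = "{\<lambda>\<xi>. c * fourier f \<xi> |c f. f \<in> schwartz}"], goal_cases)
  case 1
  then show ?case using assms by (auto intro!: exI[of _ 1] exI[of _ f])
next
  case (2 h \<xi>)
  then obtain c f where h: "h = (\<lambda>\<xi>. c * fourier f \<xi>)" "f \<in> schwartz" by auto
  show ?case
    unfolding h(1) by (rule differentiableI[OF has_derivative_mult_right[OF fourier_has_derivative[OF h(2)]]])
next
  case (3 h k)
  then obtain c f where h: "h = (\<lambda>\<xi>. c * fourier f \<xi>)" "f \<in> schwartz" by auto
  obtain C where C: "\<And>\<xi>. (1 + (norm \<xi>)\<^sup>2) ^ k * norm (fourier f \<xi>) \<le> C"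
    using fourier_decay[where 'n = 'n, of k] h(2) by blast
  have "(1 + norm \<xi>) ^ k * norm (h \<xi>) \<le> 2 ^ k * (norm c * C)" for \<xi>
  proof -
    have "2 * norm \<xi> \<le> (norm \<xi>)\<^sup>2 + 1"
      using zero_le_power2[of "norm \<xi> - 1"] by (simp add: power2_diff)
    also have "\<dots> \<le> 2 * (1 + 2 * (norm \<xi>)\<^sup>2)" by simp
    finally have "1 + norm \<xi> \<le> 2 * (1 + (norm \<xi>)\<^sup>2)" by simp
    then have "(1 + norm \<xi>) ^ k * norm (h \<xi>) \<le> (2 * (1 + (norm \<xi>)\<^sup>2)) ^ k * norm (h \<xi>)"
      by (intro mult_right_mono power_mono) auto
    also have "\<dots> = 2 ^ k * (norm c * ((1 + (norm \<xi>)\<^sup>2) ^ k * norm (fourier f \<xi>)))"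
      unfolding power_mult_distrib by (simp add: h norm_mult)
    also have "\<dots> \<le> 2 ^ k * (norm c * C)"
      by (intro mult_left_mono C) auto
    finally show ?thesis .
  qed
  then show ?case by blast
next
  case (4 h i)
  then obtain c f where h: "h = (\<lambda>\<xi>. c * fourier f \<xi>)" "f \<in> schwartz" by auto
  have "partial_deriv i h = (\<lambda>\<xi>. (c * - \<i>) * fourier (\<lambda>x. of_real (x $ i) * f x) \<xi>)"
    unfolding h(1)
    using partial_deriv_cmult[OF differentiableI[OF fourier_has_derivative[OF h(2)]]] partial_deriv_fourier[OF h(2)]
    by (auto simp: fun_eq_iff)
  then show ?case using schwartz_coord_mult[OF h(2)] by blast
qed

section \<open>Fourier inversion\<close>

definition gauss :: "'n::finite fn" where
  "gauss x = of_real (exp (- (norm x)\<^sup>2 / 2))"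

lemma gauss_has_derivative:
  fixes x :: "real ^ 'n::finite"
  shows "(gauss has_derivative (\<lambda>h. of_real (exp (- (norm x)\<^sup>2 / 2) * (- (x \<bullet> h))))) (at x)"
proof -
  have "(gauss :: 'n fn) = (\<lambda>x. of_real (exp (- (x \<bullet> x) / 2)))"
    by (simp add: gauss_def fun_eq_iff power2_norm_eq_inner)
  moreover have "((\<lambda>x. of_real (exp (- (x \<bullet> x) / 2))) has_derivative
      (\<lambda>h. of_real (exp (- (x \<bullet> x) / 2) * (- (x \<bullet> h))) :: complex)) (at x)"
    by (rule has_derivative_of_real) (auto intro!: derivative_eq_intros simp: inner_commute)
  ultimately show ?thesis by (simp add: power2_norm_eq_inner)
qed

text \<open>For positive \<open>k\<close>, \<open>(1 + r)^k \<le> (1 + k)^k * (1 + r / k)^k \<le> (1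
  + k)^k * exp r\<close>. Against the Gaussian this leaves the exponent \<open>r - r^2 / 2\<close>,
  which is at most 1/2.\<close>

lemma gauss_bounded: "\<exists>C. \<forall>x::real ^ 'n::finite. (1 + norm x) ^ k * norm (gauss x) \<le> C"
proof (intro exI allI)
  fix x :: "real ^ 'n"
  let ?r = "norm x"
  have "(1 + ?r) ^ k \<le> (1 + real k) ^ k * exp ?r"
  proof (cases "k = 0")
    case False
    have "1 + ?r \<le> (1 + real k) * (1 + ?r / real k)"
      using False by (simp add: field_simps)
    then have "(1 + ?r) ^ k \<le> ((1 + real k) * (1 + ?r / real k)) ^ k"
      by (intro power_mono) auto
    also have "\<dots> = (1 + real k) ^ k * (1 + ?r / real k) ^ k"
      by (rule power_mult_distrib)
    also have "(1 + ?r / real k) ^ k \<le> exp ?r"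
      using False by (intro exp_ge_one_plus_x_over_n_power_n) (auto simp: order_trans[of "- real k" 0])
    finally show ?thesis by (simp add: mult_left_mono)
  qed simp
  then have "(1 + ?r) ^ k * norm (gauss x) \<le> ((1 + real k) ^ k * exp ?r) * exp (- ?r\<^sup>2 / 2)"
    by (simp add: gauss_def mult_right_mono)
  also have "\<dots> = (1 + real k) ^ k * exp (?r - ?r\<^sup>2 / 2)"
    by (simp add: exp_add[symmetric])
  also have "?r - ?r\<^sup>2 / 2 \<le> 1 / 2"
    using zero_le_power2[of "?r - 1"] by (simp add: power2_diff)
  finally show "(1 + ?r) ^ k * norm (gauss x) \<le> (1 + real k) ^ k * exp (1 / 2)"
    by (simp add: mult_left_mono)
qed

text \<open>The derivative of \<open>gauss\<close> is \<open>- x_i * gauss\<close>, so the module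
  generated by \<open>gauss\<close> alone over the coordinates is closed under differentiation, and
  the only decay to be supplied is that of \<open>gauss\<close> itself.\<close>

lemma schwartz_gauss: "(gauss :: 'n::finite fn) \<in> schwartz"
proof -
  let ?M = "range (\<lambda>j (x::real ^ 'n). complex_of_real (x $ j))"
  have "mult_closure {gauss} ?M \<subseteq> schwartz"
  proof (rule mult_closure_subset_schwartz, goal_cases)
    case (1 f x)
    then show ?case using differentiableI[OF gauss_has_derivative] by simp
  next
    case (2 f k)
    then show ?case using gauss_bounded by simp
  next
    case (3 f i)
    have "partial_deriv i (gauss :: 'n fn) = (\<lambda>x. -1 * (of_real (x $ i) * gauss x))"
      by (auto simp: fun_eq_iff partial_deriv_eq[OF gauss_has_derivative] gauss_def inner_axis)
    moreover have "(\<lambda>x. -1 * (of_real (x $ i) * gauss x)) \<in> mult_closure {gauss} ?M"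
      by (rule mult_closure.cmult[OF mult_closure.mult[where m = "\<lambda>x. of_real (x $ i)"]])
        (auto intro: mult_closure.base)
    ultimately show ?case using 3 by simp
  next
    case (4 m x)
    then show ?case using differentiableI[OF has_derivative_coord] by auto
  next
    case (5 m)
    then show ?case using norm_coord_le by blast
  next
    case (6 m f i)
    then obtain j where "m = (\<lambda>x. of_real (x $ j))" by auto
    then show ?case
      using mult_closure.cmult[OF 6(2), of "if i = j then 1 else 0"]
      by (simp add: partial_deriv_coord)
  qed
  then show ?thesis
    using mult_closure.base[of gauss "{gauss}" ?M] by blast
qed

text \<open>With the Fourier constant included, the Gaussian factors into standard normal densities;
  its integral and its transform then reduce to the one-dimensional normal distribution.\<close>

lemma gauss_eq_prod:
  fixes x :: "real ^ 'n::finite"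
  shows "of_real ((2 * pi) powr (- real CARD('n) / 2)) * gauss x = (\<Prod>j\<in>UNIV. complex_of_real (std_normal_density (x $ j)))"
proof -
  have "(\<Prod>j\<in>UNIV. std_normal_density (x $ j)) = (\<Prod>j\<in>(UNIV :: 'n set). 1 / sqrt (2 * pi)) * (\<Prod>j\<in>UNIV. exp (- (x $ j)\<^sup>2 / 2))"
    unfolding std_normal_density_def by (simp only: prod.distrib)
  also have "(\<Prod>j\<in>UNIV. exp (- (x $ j)\<^sup>2 / 2)) = exp (- (norm x)\<^sup>2 / 2)"
    unfolding exp_sum[OF finite, symmetric] power2_norm_eq_inner inner_vec_def
    by (simp add: sum_negf sum_divide_distrib power2_eq_square)
  also have "(\<Prod>j\<in>(UNIV :: 'n set). 1 / sqrt (2 * pi)) = (2 * pi) powr (- real CARD('n) / 2)"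
  proof -
    have "1 / sqrt (2 * pi) = (2 * pi) powr (- (1 / 2))"
      by (simp add: powr_minus powr_half_sqrt inverse_eq_divide)
    then have "(\<Prod>j\<in>(UNIV :: 'n set). 1 / sqrt (2 * pi)) = ((2 * pi) powr (- (1 / 2))) ^ CARD('n)"
      by (simp only: prod_constant)
    also have "\<dots> = (2 * pi) powr (- (1 / 2) * real CARD('n))"
      by (subst powr_realpow[symmetric]) (simp_all only: powr_powr, simp)
    finally show ?thesis by simp
  qed
  finally show ?thesis
    by (simp add: gauss_def flip: of_real_mult of_real_prod)
qed

lemma integrable_std_normal_density: "integrable lborel (\<lambda>t. complex_of_real (std_normal_density t))"
  using integrable_std_normal_moment[of 0] by simp

lemma integral_std_normal_density: "(\<integral>t. complex_of_real (std_normal_density t) \<partial>lborel) = 1"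
  using integral_std_normal_moment_even[of 0] by simp

lemma integral_gauss:
  "of_real ((2 * pi) powr (- real CARD('n) / 2)) * (\<integral>x. gauss (x :: real ^ 'n::finite) \<partial>lborel) = 1"
  using integral_lborel_prod[of "\<lambda>(_::'n) t. complex_of_real (std_normal_density t)", OF integrable_std_normal_density]
  by (simp add: gauss_eq_prod[symmetric] integral_std_normal_density)

lemma fourier_gauss: "fourier gauss \<xi> = gauss (\<xi> :: real ^ 'n::finite)"
proof -
  let ?\<kappa> = "complex_of_real ((2 * pi) powr (- real CARD('n) / 2))"
  let ?n = "\<lambda>t. complex_of_real (std_normal_density t)"
  \<comment> \<open>A characteristic function has the opposite sign in its exponent, so the
    transform at \<open>s\<close> is its value at \<open>- s\<close>.\<close>
  have one: "(\<integral>t. exp (- \<i> * of_real (s * t)) * ?n t \<partial>lborel) = of_real (exp (- s\<^sup>2 / 2))" for s :: real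
  proof -
    have "of_real (exp (- (- s)\<^sup>2 / 2)) = char std_normal_distribution (- s)"
      by (simp only: char_std_normal_distribution)
    also have "\<dots> = (\<integral>t. std_normal_density t *\<^sub>R iexp (- s * t) \<partial>lborel)"
      unfolding char_def by (rule integral_density) (auto simp: normal_density_nonneg)
    finally show ?thesis
      by (simp add: scaleR_conv_of_real mult.commute)
  qed
  have int1: "integrable lborel (\<lambda>t. exp (- \<i> * of_real (s * t)) * ?n t)" for s :: real
    using integrable_phase[OF integrable_std_normal_density, of s] by simp
  have "?\<kappa> * (\<integral>x. exp (- \<i> * of_real (\<xi> \<bullet> x)) * gauss x \<partial>lborel) =
      (\<integral>x. exp (- \<i> * of_real (\<xi> \<bullet> x)) * (?\<kappa> * gauss x) \<partial>lborel)"
    by (subst integral_mult_right_zero[symmetric]) (simp only: mult.left_commute)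
  also have "\<dots> = (\<integral>x. (\<Prod>j\<in>UNIV. exp (- \<i> * of_real (\<xi> $ j * x $ j)) * ?n (x $ j)) \<partial>lborel)"
    unfolding gauss_eq_prod prod.distrib exp_sum[OF finite, symmetric]
    by (simp add: inner_vec_def sum_distrib_left sum_negf)
  also have "\<dots> = (\<Prod>j\<in>UNIV. complex_of_real (exp (- (\<xi> $ j)\<^sup>2 / 2)))"
    unfolding integral_lborel_prod[OF int1] one ..
  also have "\<dots> = gauss \<xi>"
    unfolding of_real_prod[symmetric] exp_sum[OF finite, symmetric] gauss_def power2_norm_eq_inner inner_vec_def
    by (simp add: sum_negf sum_divide_distrib power2_eq_square)
  finally show ?thesis by (simp add: fourier_def)
qed

text \<open>Testing duality against the Gaussian at scale \<open>r\<close> gives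
  \<open>\<integral> fourier f(\<eta>) gauss(r \<eta>) d\<eta> = \<integral> f(r y) gauss(y) dy\<close>; the limit \<open>r \<rightarrow> 0\<close> is inversion at the origin.\<close>

lemma fourier_inversion_zero:
  fixes f :: "'n::finite fn"
  assumes f: "f \<in> schwartz"
  shows "fourier (fourier f) 0 = f 0"
proof -
  let ?\<kappa> = "complex_of_real ((2 * pi) powr (- real CARD('n) / 2))"
  define t :: "nat \<Rightarrow> real" where "t m = inverse (real (Suc m))" for m
  have t: "t \<longlonglongrightarrow> 0" "\<And>m. 0 < t m"
    unfolding t_def by (rule LIMSEQ_inverse_real_of_nat) auto
  have tx: "(\<lambda>m. t m *\<^sub>R x) \<longlonglongrightarrow> 0" for x :: "real ^ 'n"
    using tendsto_scaleR[OF t(1) tendsto_const[of x]] by simp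
  have Ff: "fourier f \<in> schwartz" by (rule schwartz_fourier[OF f])
  note [measurable] = schwartz_measurable[OF f] schwartz_measurable[OF Ff] schwartz_measurable[OF schwartz_gauss]
  have ng: "norm (gauss x) \<le> 1" for x :: "real ^ 'n"
    by (simp add: gauss_def)
  have lim0: "(\<lambda>m. h (t m *\<^sub>R x)) \<longlonglongrightarrow> h 0" if "h \<in> schwartz" for h :: "'n fn" and x
    using schwartz_continuous[OF that, of UNIV] tx[of x]
    by (auto simp: continuous_on_eq_continuous_at continuous_at_sequentially o_def)
  obtain C where C: "\<And>x. norm (f x) \<le> C"
    using schwartz_bounded[OF f, of 0] by auto
  have intg: "integrable lborel (gauss :: 'n fn)"
    by (rule schwartz_integrable[OF schwartz_gauss])
  have eq: "(\<integral>\<eta>. fourier f \<eta> * gauss (t m *\<^sub>R \<eta>) \<partial>lborel) = (\<integral>y. f (t m *\<^sub>R y) * gauss y \<partial>lborel)" for m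
  proof -
    have r: "t m \<noteq> 0" "t m > 0" using t(2)[of m] by auto
    have g: "(\<lambda>x. gauss (t m *\<^sub>R x)) \<in> (schwartz :: 'n fn set)"
      using schwartz_affine[OF schwartz_gauss r(1), of 0] by simp
    have i: "integrable lborel (\<lambda>x. f x * gauss ((1 / t m) *\<^sub>R x))"
    proof (rule Bochner_Integration.integrable_bound[OF schwartz_integrable[OF f]])
      show "AE x in lborel. norm (f x * gauss ((1 / t m) *\<^sub>R x)) \<le> norm (f x)"
        using ng by (intro AE_I2) (simp add: norm_mult mult_left_le)
    qed simp
    have "(\<integral>\<eta>. fourier f \<eta> * gauss (t m *\<^sub>R \<eta>) \<partial>lborel) = (\<integral>x. f x * fourier (\<lambda>x. gauss (t m *\<^sub>R x)) x \<partial>lborel)"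
      (is "_ = ?R")
      by (rule fourier_duality[OF schwartz_integrable[OF f] schwartz_integrable[OF g]])
    \<comment> \<open>The factor \<open>t^n\<close> is the Jacobian of the dilation by
      \<open>t\<close>: it turns the transform of the dilated Gaussian into
      \<open>gauss (x / t)\<close>, and the substitution produces it once more on the other side, so
      it cancels.\<close>
    then have "of_real (t m ^ CARD('n)) * (\<integral>\<eta>. fourier f \<eta> * gauss (t m *\<^sub>R \<eta>) \<partial>lborel) = of_real (t m ^ CARD('n)) * ?R"
      by (rule arg_cong)
    also have "\<dots> = (\<integral>x. f x * (of_real (t m ^ CARD('n)) * fourier (\<lambda>x. gauss (t m *\<^sub>R x)) x) \<partial>lborel)"
      by (subst integral_mult_right_zero[symmetric]) (simp only: mult.left_commute)
    also have "\<dots> = (\<integral>x. f x * gauss ((1 / t m) *\<^sub>R x) \<partial>lborel)"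
      by (simp only: fourier_scale[OF intg r(2), symmetric] fourier_gauss)
    also have "\<dots> = of_real (t m ^ CARD('n)) * (\<integral>y. f (t m *\<^sub>R y) * gauss y \<partial>lborel)"
      using r by (subst integral_lborel_affine[OF i r(1), of 0]) (simp add: scaleR_conv_of_real[where 'a = complex])
    finally show ?thesis using r by simp
  qed
  have "(\<lambda>m. \<integral>\<eta>. fourier f \<eta> * gauss (t m *\<^sub>R \<eta>) \<partial>lborel) \<longlonglongrightarrow> (\<integral>\<eta>. fourier f \<eta> * gauss (0 :: real ^ 'n) \<partial>lborel)"
  proof (rule integral_dominated_convergence)
    show "integrable lborel (\<lambda>x. norm (fourier f x))"
      by (intro integrable_norm schwartz_integrable Ff)
    show "AE x in lborel. (\<lambda>m. fourier f x * gauss (t m *\<^sub>R x)) \<longlonglongrightarrow> fourier f x * gauss (0 :: real ^ 'n)"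
      by (rule AE_I2, rule tendsto_mult[OF tendsto_const], rule lim0[OF schwartz_gauss])
    show "AE x in lborel. norm (fourier f x * gauss (t m *\<^sub>R x)) \<le> norm (fourier f x)" for m
      using ng by (intro AE_I2) (simp add: norm_mult mult_left_le)
  qed simp_all
  moreover have "(\<lambda>m. \<integral>y. f (t m *\<^sub>R y) * gauss y \<partial>lborel) \<longlonglongrightarrow> (\<integral>y. f 0 * gauss (y :: real ^ 'n) \<partial>lborel)"
  proof (rule integral_dominated_convergence)
    show "integrable lborel (\<lambda>y. C * norm (gauss (y :: real ^ 'n)))"
      by (intro integrable_mult_right integrable_norm intg)
    show "AE y in lborel. (\<lambda>m. f (t m *\<^sub>R y) * gauss y) \<longlonglongrightarrow> f 0 * gauss y"
      by (rule AE_I2, rule tendsto_mult[OF _ tendsto_const], rule lim0[OF f])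
    show "AE y in lborel. norm (f (t m *\<^sub>R y) * gauss y) \<le> C * norm (gauss y)" for m
      using C by (intro AE_I2) (simp add: norm_mult mult_right_mono)
  qed simp_all
  ultimately have "(\<integral>\<eta>. fourier f \<eta> * gauss (0 :: real ^ 'n) \<partial>lborel) = (\<integral>y. f 0 * gauss (y :: real ^ 'n) \<partial>lborel)"
    unfolding eq by (rule LIMSEQ_unique)
  then have "fourier (fourier f) 0 = f 0 * (?\<kappa> * (\<integral>y. gauss (y :: real ^ 'n) \<partial>lborel))"
    by (simp add: fourier_def[of "fourier f"] gauss_def[of 0] mult.left_commute)
  then show ?thesis by (simp only: integral_gauss mult_1_right)
qed

text \<open>Translating \<open>f\<close> by \<open>x\<close> reduces the claim to the origin: the
  translation becomes a phase on the transform, and integrating with that phase evaluates the second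
  transform at \<open>- x\<close>.\<close>

theorem fourier_inversion:
  assumes f: "f \<in> schwartz"
  shows "fourier (fourier f) (- x) = f x"
proof -
  let ?g = "\<lambda>y. f (y + x)"
  have "fourier ?g = (\<lambda>\<xi>. exp (\<i> * of_real (\<xi> \<bullet> x)) * fourier f \<xi>)"
    by (intro ext fourier_translate schwartz_integrable f)
  then have "fourier (fourier ?g) 0 = fourier (fourier f) (- x)"
    by (simp only: fourier_def[of "\<lambda>\<xi>. exp (\<i> * of_real (\<xi> \<bullet> x)) * fourier f \<xi>"] fourier_def[of "fourier f"])
      (simp add: inner_commute)
  with fourier_inversion_zero[OF schwartz_translate[OF f], of x] show ?thesis by simp
qed

lemma fourier_inverse_right:
  assumes "f \<in> schwartz"
  shows "fourier (\<lambda>\<xi>. fourier f (- \<xi>)) x = f x"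
  using fourier_uminus_arg[OF schwartz_integrable[OF schwartz_fourier[OF assms]]] fourier_inversion[OF assms]
  by simp

text \<open>Conjugation turns \<open>fourier f\<close> into the reflected transform of the conjugate
  of \<open>f\<close>; duality moves the transform of \<open>\<phi>\<close> onto it, where inversion
  applies.\<close>

lemma fourier_parseval:
  assumes \<phi>: "\<phi> \<in> schwartz" and f: "f \<in> schwartz"
  shows "(\<integral>\<xi>. fourier \<phi> \<xi> * cnj (fourier f \<xi>) \<partial>lborel) = (\<integral>x. \<phi> x * cnj (f x) \<partial>lborel)"
  unfolding fourier_cnj
  using fourier_duality[OF schwartz_integrable[OF \<phi>]
      schwartz_integrable[OF schwartz_uminus_arg[OF schwartz_fourier[OF schwartz_cnj[OF f]]]]]
  by (simp add: fourier_inverse_right[OF schwartz_cnj[OF f]])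

section \<open>Schwartz functions determine a measurable function\<close>

text \<open>Products of shifted and dilated copies in the coordinates approximate indicators of the
  sets \<open>{..a}\<close>. The derivative of \<open>logistic\<close> is a polynomial in
  \<open>logistic\<close>, so these functions are multipliers for \<open>mult_closure\<close>, with
  boundedness as the only estimate.\<close>

definition logistic :: "real \<Rightarrow> real" where
  "logistic t = 1 / (1 + exp t)"

lemma logistic_bounds: "0 \<le> logistic t" "logistic t \<le> 1"
  by (simp_all add: logistic_def add_nonneg_nonneg divide_le_eq add_pos_pos)

lemma logistic_has_derivative:
  fixes x :: "real ^ 'n::finite"
  shows "((\<lambda>x. complex_of_real (logistic (c * x $ j + b))) has_derivative
    (\<lambda>h. of_real (- (c * (logistic (c * x $ j + b) - (logistic (c * x $ j + b))\<^sup>2)) * h $ j))) (at x)"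
proof -
  have d: "(logistic has_real_derivative - (logistic t - (logistic t)\<^sup>2)) (at t)" for t
  proof -
    have p: "1 + exp t \<noteq> 0" using exp_gt_zero[of t] by linarith
    have "((\<lambda>t. 1 / (1 + exp t)) has_real_derivative - (exp t / (1 + exp t)\<^sup>2)) (at t)"
      using p by (auto intro!: derivative_eq_intros simp: power2_eq_square)
    moreover have "exp t / (1 + exp t)\<^sup>2 = logistic t - (logistic t)\<^sup>2"
      using p by (simp add: logistic_def power2_eq_square divide_simps)
    ultimately show ?thesis by (simp add: logistic_def[abs_def])
  qed
  have "((\<lambda>x :: real ^ 'n. c * x $ j + b) has_derivative (\<lambda>h. c * h $ j)) (at x)"
    by (auto intro!: derivative_eq_intros bounded_linear_imp_has_derivative[OF bounded_linear_vec_nth])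
  from has_derivative_compose[OF this d[unfolded has_field_derivative_def]]
  have "((\<lambda>x. logistic (c * x $ j + b)) has_derivative
      (\<lambda>h. - (logistic (c * x $ j + b) - (logistic (c * x $ j + b))\<^sup>2) * (c * h $ j))) (at x)" .
  then show ?thesis
    by (intro has_derivative_of_real) (simp add: algebra_simps)
qed

lemma schwartz_logistic_mult:
  fixes f :: "'n::finite fn"
  assumes "f \<in> schwartz"
  shows "(\<lambda>x. of_real (logistic (c * x $ j + b)) * f x) \<in> schwartz"
proof -
  let ?L = "\<lambda>x::real ^ 'n. complex_of_real (logistic (c * x $ j + b))"
  have "mult_closure schwartz {?L} \<subseteq> schwartz"
  proof (rule schwartz_mult_closure)
    show "m differentiable (at x)" if "m \<in> {?L}" for m x
      using that differentiableI[OF logistic_has_derivative] by simp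
    show "\<exists>l. \<forall>x. norm (m x) \<le> (1 + norm x) ^ l" if "m \<in> {?L}" for m
      using that logistic_bounds by (intro exI[of _ 0]) simp
    show "(\<lambda>x. partial_deriv i m x * f x) \<in> mult_closure schwartz {?L}"
      if "m \<in> {?L}" "f \<in> mult_closure schwartz {?L}" for m f i
    proof -
      let ?d = "of_real (- (c * axis i 1 $ j))"
      have "partial_deriv i ?L x = ?d * (?L x + -1 * (?L x * ?L x))" for x
        by (subst partial_deriv_eq[OF logistic_has_derivative]) (simp add: algebra_simps power2_eq_square)
      then have "partial_deriv i m x * f x = ?d * (?L x * f x + -1 * (?L x * (?L x * f x)))" for x
        using that(1) by (simp only: singleton_iff) (simp only: ring_distribs mult.assoc)
      then have "(\<lambda>x. partial_deriv i m x * f x) = (\<lambda>x. ?d * (?L x * f x + -1 * (?L x * (?L x * f x))))"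
        by (rule ext)
      also have "\<dots> \<in> mult_closure schwartz {?L}"
        using that(2) by (intro mult_closure.cmult mult_closure.add mult_closure.mult) auto
      finally show ?thesis .
    qed
  qed
  then show ?thesis
    using mult_closure.mult[OF _ mult_closure.base[OF assms], of ?L "{?L}"] by blast
qed

lemma schwartz_logistic_prod_mult:
  fixes f :: "'n::finite fn"
  assumes f: "f \<in> schwartz" and J: "finite J"
  shows "(\<lambda>x. of_real (\<Prod>j\<in>J. logistic (c * x $ j + b j)) * f x) \<in> schwartz"
  using J
proof induction
  case (insert j J)
  have "(\<lambda>x. of_real (\<Prod>j\<in>insert j J. logistic (c * x $ j + b j)) * f x) =
    (\<lambda>x. of_real (logistic (c * x $ j + b j)) * (of_real (\<Prod>j\<in>J. logistic (c * x $ j + b j)) * f x))"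
    using insert.hyps by (simp add: mult.assoc)
  also have "\<dots> \<in> schwartz"
    by (rule schwartz_logistic_mult[OF insert.IH])
  finally show ?case .
qed (simp add: f)

text \<open>The quadratic scale lets \<open>m^2 * t\<close> win over \<open>m\<close> when
  \<open>t\<close> is nonzero. The shift by \<open>- m\<close> forces the limit 1 instead of 1/2 at
  \<open>t = 0\<close>, matching the closed set \<open>{..a}\<close>.\<close>

lemma logistic_tendsto_step:
  "(\<lambda>m. logistic ((real m)\<^sup>2 * t - real m)) \<longlonglongrightarrow> (if t \<le> 0 then 1 else 0)"
proof -
  consider "t < 0" | "t = 0" | "t > 0" by linarith
  then show ?thesis
  proof cases
    case 1
    then show ?thesis unfolding logistic_def by simp real_asymp
  next
    case 2
    then show ?thesis unfolding logistic_def by simp real_asymp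
  next
    case 3
    then show ?thesis unfolding logistic_def by simp real_asymp
  qed
qed

text \<open>The sets \<open>{..a}\<close> are stable under intersection and generate the Borel sets,
  so a Dynkin argument extends the vanishing of the integral to every Borel set. The total integral
  enters through complements.\<close>

lemma AE_zero_of_integral_atMost:
  fixes H :: "'n::finite fn"
  assumes H: "integrable lborel H" and 0: "integral\<^sup>L lborel H = 0"
    and atMost: "\<And>a. (\<integral>x. indicator {..a} x *\<^sub>R H x \<partial>lborel) = 0"
  shows "AE x in lborel. H x = 0"
proof (rule sigma_finite_measure.density_zero[OF sigma_finite_lborel H])
  have set_int: "set_integrable lborel A H" if "A \<in> sets borel" for A
    unfolding set_integrable_def using that by (intro integrable_mult_indicator H) simp
  fix A :: "(real ^ 'n) set" assume "A \<in> sets lborel"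
  then have A: "A \<in> sigma_sets UNIV (range (\<lambda>a::real ^ 'n. {..a}))"
    by (simp add: borel_eq_atMost)
  have stable: "Int_stable (range (\<lambda>a::real ^ 'n. {..a}))"
    unfolding Int_stable_def
  proof safe
    fix a b :: "real ^ 'n"
    have "{..a} \<inter> {..b} = {..inf a b}" by auto
    then show "{..a} \<inter> {..b} \<in> range atMost" by blast
  qed
  have "range (\<lambda>a::real ^ 'n. {..a}) \<subseteq> Pow UNIV" by simp
  from stable this A show "set_lebesgue_integral lborel A H = 0"
  proof (induction rule: sigma_sets_induct_disjoint)
    case (basic A)
    then show ?case using atMost by (auto simp: set_lebesgue_integral_def)
  next
    case empty
    then show ?case by (simp add: set_lebesgue_integral_def)
  next
    case (compl A)
    then have A: "A \<in> sets borel" by (simp add: borel_eq_atMost)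
    have "set_lebesgue_integral lborel (UNIV - A) H = (\<integral>x. H x - indicator A x *\<^sub>R H x \<partial>lborel)"
      unfolding set_lebesgue_integral_def by (intro Bochner_Integration.integral_cong) (auto simp: indicator_def)
    also have "\<dots> = 0"
      using set_int[OF A] compl.IH 0 H unfolding set_integrable_def set_lebesgue_integral_def
      by (subst Bochner_Integration.integral_diff) auto
    finally show ?case .
  next
    case (union A)
    then have A: "A i \<in> sets borel" for i by (auto simp: borel_eq_atMost)
    have "set_lebesgue_integral lborel (\<Union>i. A i) H = (\<Sum>i. set_lebesgue_integral lborel (A i) H)"
      using union.hyps(1) A by (intro lebesgue_integral_countable_add set_int) (auto simp: disjoint_family_on_def)
    with union.IH show ?case by simp
  qed
qed

text \<open>Since \<open>h\<close> may fail to be integrable, the argument is carried out for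
  \<open>h * gauss\<close>, and \<open>gauss\<close> has no zeros. The functions
  \<open>p m * gauss\<close> are Schwartz, and their limit as \<open>m\<close> grows cuts
  \<open>gauss\<close> down to \<open>{..a}\<close>.\<close>

lemma AE_zero_of_schwartz_orthogonal:
  fixes h :: "'n::finite fn"
  assumes h[measurable]: "h \<in> borel_measurable borel"
    and int: "integrable lborel (\<lambda>x. h x * gauss x)"
    and 0: "\<And>f. f \<in> schwartz \<Longrightarrow> (\<integral>x. h x * cnj (f x) \<partial>lborel) = 0"
  shows "AE x in lborel. h x = 0"
proof -
  note [measurable] = schwartz_measurable[OF schwartz_gauss]
  have cg: "cnj (gauss x) = gauss x" for x :: "real ^ 'n" by (simp add: gauss_def)
  have "AE x in lborel. h x * gauss x = 0"
  proof (rule AE_zero_of_integral_atMost[OF int])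
    show "(\<integral>x. h x * gauss x \<partial>lborel) = 0"
      using 0[OF schwartz_gauss] by (simp add: cg)
    fix a :: "real ^ 'n"
    define p where "p m x = (\<Prod>j\<in>UNIV. logistic ((real m)\<^sup>2 * x $ j + (- (real m)\<^sup>2 * a $ j - real m)))" for m and x :: "real ^ 'n"
    have [measurable]: "p m \<in> borel_measurable borel" for m
      unfolding p_def logistic_def by measurable
    have p01: "0 \<le> p m x" "p m x \<le> 1" for m x
      unfolding p_def using logistic_bounds by (auto intro!: prod_nonneg prod_le_1)
    have p_lim: "(\<lambda>m. p m x) \<longlonglongrightarrow> indicator {..a} x" for x
    proof -
      have "(\<lambda>m. p m x) \<longlonglongrightarrow> (\<Prod>j\<in>UNIV. if x $ j - a $ j \<le> 0 then 1 else 0)"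
        unfolding p_def using logistic_tendsto_step[of "x $ j - a $ j" for j]
        by (intro tendsto_prod) (simp add: algebra_simps)
      also have "(\<Prod>j\<in>UNIV. if x $ j - a $ j \<le> 0 then 1 else 0 :: real) = indicator {..a} x"
        by (auto simp: indicator_def less_eq_vec_def intro!: prod.neutral)
      finally show ?thesis .
    qed
    have "(\<lambda>m. \<integral>x. p m x *\<^sub>R (h x * gauss x) \<partial>lborel) \<longlonglongrightarrow> (\<integral>x. indicator {..a} x *\<^sub>R (h x * gauss x) \<partial>lborel)"
    proof (rule integral_dominated_convergence)
      show "integrable lborel (\<lambda>x. norm (h x * gauss x))"
        using int by (rule integrable_norm)
      show "AE x in lborel. (\<lambda>m. p m x *\<^sub>R (h x * gauss x)) \<longlonglongrightarrow> indicator {..a} x *\<^sub>R (h x * gauss x)"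
        by (intro AE_I2 tendsto_intros p_lim)
      show "AE x in lborel. norm (p m x *\<^sub>R (h x * gauss x)) \<le> norm (h x * gauss x)" for m
        using p01 by (intro AE_I2) (simp add: mult_le_cancel_right1 mult_left_le_one_le)
    qed simp_all
    moreover have "(\<integral>x. p m x *\<^sub>R (h x * gauss x) \<partial>lborel) = 0" for m
    proof -
      have "(\<lambda>x. of_real (p m x) * gauss x) \<in> schwartz"
        unfolding p_def by (intro schwartz_logistic_prod_mult schwartz_gauss finite)
      from 0[OF this] show ?thesis
        by (simp add: cg scaleR_conv_of_real mult.left_commute)
    qed
    ultimately show "(\<integral>x. indicator {..a} x *\<^sub>R (h x * gauss x) \<partial>lborel) = 0"
      by (simp only: LIMSEQ_const_iff)
  qed
  then show ?thesis
    by eventually_elim (simp add: gauss_def)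
qed

section \<open>The real Hilbert space of square-integrable complex functions\<close>

lemma cnj_measurable [measurable]: "cnj \<in> borel_measurable borel"
  by (intro borel_measurable_continuous_onI continuous_on_cnj continuous_on_id)

lemma Re_integral_mult_cnj_self: "Re (\<integral>x. f x * cnj (f x) \<partial>M) = (\<integral>x. (norm (f x))\<^sup>2 \<partial>M)"
  by (simp only: complex_norm_square[symmetric] integral_complex_of_real Re_complex_of_real)

definition square_integrable :: "'n::finite fn \<Rightarrow> bool" where
  "square_integrable f \<longleftrightarrow> f \<in> borel_measurable borel \<and> integrable lborel (\<lambda>x. (norm (f x))\<^sup>2)"

lemma square_integrable_measurable [measurable_dest]: "square_integrable f \<Longrightarrow> f \<in> borel_measurable borel"
  by (simp add: square_integrable_def)

lemma square_integrable_bound: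
  assumes "square_integrable f" "square_integrable g" and [measurable]: "h \<in> borel_measurable borel"
    and "\<And>x. (norm (h x))\<^sup>2 \<le> a * (norm (f x))\<^sup>2 + b * (norm (g x))\<^sup>2"
  shows "square_integrable h"
  unfolding square_integrable_def
proof
  show "integrable lborel (\<lambda>x. (norm (h x))\<^sup>2)"
  proof (rule Bochner_Integration.integrable_bound)
    show "integrable lborel (\<lambda>x. a * (norm (f x))\<^sup>2 + b * (norm (g x))\<^sup>2)"
      using assms(1,2) unfolding square_integrable_def by auto
    show "AE x in lborel. norm ((norm (h x))\<^sup>2) \<le> norm (a * (norm (f x))\<^sup>2 + b * (norm (g x))\<^sup>2)"
      using assms(4) by (intro AE_I2) (simp add: order_trans[OF _ abs_ge_self])
  qed simp
qed simp

lemma norm_add_power2_le: "(norm (a + b))\<^sup>2 \<le> 2 * (norm a)\<^sup>2 + 2 * (norm b)\<^sup>2"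
  for a b :: "'a::real_normed_vector"
proof -
  have "(norm (a + b))\<^sup>2 \<le> (norm a + norm b)\<^sup>2"
    by (intro power_mono norm_triangle_ineq) simp
  also have "\<dots> \<le> 2 * (norm a)\<^sup>2 + 2 * (norm b)\<^sup>2"
    using zero_le_power2[of "norm a - norm b"] by (simp add: power2_diff power2_sum)
  finally show ?thesis .
qed

lemma square_integrable_zero: "square_integrable (\<lambda>_. 0)"
  by (simp add: square_integrable_def)

lemma square_integrable_add:
  assumes "square_integrable f" "square_integrable g"
  shows "square_integrable (\<lambda>x. f x + g x)"
proof (rule square_integrable_bound[OF assms])
  note [measurable] = assms[THEN square_integrable_measurable]
  show "(\<lambda>x. f x + g x) \<in> borel_measurable borel" by measurable
qed (rule norm_add_power2_le)

lemma square_integrable_cmult: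
  assumes "square_integrable f"
  shows "square_integrable (\<lambda>x. c * f x)"
proof (rule square_integrable_bound[OF assms assms])
  note [measurable] = assms[THEN square_integrable_measurable]
  show "(\<lambda>x. c * f x) \<in> borel_measurable borel" by measurable
  show "(norm (c * f x))\<^sup>2 \<le> (norm c)\<^sup>2 * (norm (f x))\<^sup>2 + 0 * (norm (f x))\<^sup>2" for x
    by (simp add: norm_mult power_mult_distrib)
qed

lemma square_integrable_diff:
  "square_integrable f \<Longrightarrow> square_integrable g \<Longrightarrow> square_integrable (\<lambda>x. f x - g x)"
  using square_integrable_add[OF _ square_integrable_cmult, of f g "-1"] by simp

lemma square_integrable_mult_integrable:
  assumes "square_integrable f" "square_integrable g"
  shows "integrable lborel (\<lambda>x. f x * g x)"
proof (rule Bochner_Integration.integrable_bound)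
  note [measurable] = assms[THEN square_integrable_measurable]
  show "integrable lborel (\<lambda>x. (norm (f x))\<^sup>2 + (norm (g x))\<^sup>2)"
    using assms unfolding square_integrable_def by auto
  show "(\<lambda>x. f x * g x) \<in> borel_measurable lborel" by simp
  have "norm (f x * g x) \<le> (norm (f x))\<^sup>2 + (norm (g x))\<^sup>2" for x
  proof -
    have "norm (f x) * norm (g x) \<le> 2 * norm (f x) * norm (g x)" by simp
    also have "\<dots> \<le> (norm (f x))\<^sup>2 + (norm (g x))\<^sup>2" by (rule sum_squares_bound)
    finally show ?thesis by (simp add: norm_mult)
  qed
  then show "AE x in lborel. norm (f x * g x) \<le> norm ((norm (f x))\<^sup>2 + (norm (g x))\<^sup>2)"
    by (intro AE_I2) (simp add: order_trans[OF _ abs_ge_self])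
qed

lemma square_integrable_cnj:
  assumes "square_integrable f"
  shows "square_integrable (\<lambda>x. cnj (f x))"
proof -
  note [measurable] = square_integrable_measurable[OF assms]
  show ?thesis
    using assms unfolding square_integrable_def by simp
qed

lemma square_integrable_mult_cnj_integrable:
  "square_integrable f \<Longrightarrow> square_integrable g \<Longrightarrow> integrable lborel (\<lambda>x. f x * cnj (g x))"
  by (intro square_integrable_mult_integrable square_integrable_cnj)

\<comment> \<open>The relation is partial so that only square-integrable functions represent a
  class; \<open>abs_L2\<close> is therefore always accompanied by a proof of
  \<open>square_integrable\<close>.\<close>
quotient_type 'n L2 = "real ^ 'n::finite \<Rightarrow> complex" / partial:
  "\<lambda>f g. square_integrable f \<and> square_integrable g \<and> (AE x in lborel. f x = g x)"
proof (rule part_equivpI)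
  show "\<exists>f :: 'n fn. square_integrable f \<and> square_integrable f \<and> (AE x in lborel. f x = f x)"
    using square_integrable_zero by auto
qed (auto simp: symp_def transp_def elim: AE_mp)

instantiation L2 :: (finite) real_vector
begin

lift_definition zero_L2 :: "'a L2" is "\<lambda>_. 0"
  by (simp add: square_integrable_zero)

lift_definition plus_L2 :: "'a L2 \<Rightarrow> 'a L2 \<Rightarrow> 'a L2" is "\<lambda>f g x. f x + g x"
  by (auto intro: square_integrable_add elim: AE_mp)

lift_definition scaleR_L2 :: "real \<Rightarrow> 'a L2 \<Rightarrow> 'a L2" is "\<lambda>r f x. of_real r * f x"
  by (auto intro: square_integrable_cmult elim: AE_mp)

lift_definition uminus_L2 :: "'a L2 \<Rightarrow> 'a L2" is "\<lambda>f x. - f x"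
  by (auto dest: square_integrable_cmult[where c = "-1"] elim: AE_mp)

lift_definition minus_L2 :: "'a L2 \<Rightarrow> 'a L2 \<Rightarrow> 'a L2" is "\<lambda>f g x. f x - g x"
  by (auto intro: square_integrable_diff elim: AE_mp)

instance
proof
  fix f g h :: "'a L2" and r s :: real
  show "f + g + h = f + (g + h)" "f + g = g + f" "0 + f = f"
    by (transfer, auto intro!: square_integrable_add simp: ac_simps)+
  show "- f + f = 0"
    by transfer (simp add: square_integrable_zero)
  show "f - g = f + - g"
    by transfer (simp add: square_integrable_diff)
  show "r *\<^sub>R (f + g) = r *\<^sub>R f + r *\<^sub>R g"
    by transfer (simp add: distrib_left square_integrable_add square_integrable_cmult)
  show "(r + s) *\<^sub>R f = r *\<^sub>R f + s *\<^sub>R f"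
    by transfer (simp add: distrib_right square_integrable_add square_integrable_cmult)
  show "r *\<^sub>R s *\<^sub>R f = (r * s) *\<^sub>R f"
    by transfer (simp add: mult.assoc square_integrable_cmult)
  show "1 *\<^sub>R f = f"
    by transfer simp
qed

end

section \<open>Inner product and completeness\<close>

instantiation L2 :: (finite) real_inner
begin

lift_definition inner_L2 :: "'a L2 \<Rightarrow> 'a L2 \<Rightarrow> real" is "\<lambda>f g. Re (\<integral>x. f x * cnj (g x) \<partial>lborel)"
proof (elim conjE)
  fix f f' g g' :: "'a fn"
  assume "square_integrable f" "square_integrable f'" "square_integrable g" "square_integrable g'"
    and ae: "AE x in lborel. f x = f' x" "AE x in lborel. g x = g' x"
  then have [measurable]: "f \<in> borel_measurable borel" "f' \<in> borel_measurable borel"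
    "g \<in> borel_measurable borel" "g' \<in> borel_measurable borel"
    by (auto dest: square_integrable_measurable)
  have "AE x in lborel. f x * cnj (g x) = f' x * cnj (g' x)"
    using ae by eventually_elim simp
  then show "Re (\<integral>x. f x * cnj (g x) \<partial>lborel) = Re (\<integral>x. f' x * cnj (g' x) \<partial>lborel)"
    by (intro arg_cong[where f = Re] integral_cong_AE) simp_all
qed

definition norm_L2 :: "'a L2 \<Rightarrow> real" where "norm_L2 f = sqrt (inner f f)"

definition dist_L2 :: "'a L2 \<Rightarrow> 'a L2 \<Rightarrow> real" where "dist_L2 f g = norm (f - g)"

definition sgn_L2 :: "'a L2 \<Rightarrow> 'a L2" where "sgn_L2 f = f /\<^sub>R norm f"

definition uniformity_L2 :: "('a L2 \<times> 'a L2) filter" where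
  "uniformity_L2 = (INF e\<in>{0 <..}. principal {(f, g). dist f g < e})"

definition open_L2 :: "'a L2 set \<Rightarrow> bool" where
  "open_L2 U \<longleftrightarrow> (\<forall>x\<in>U. eventually (\<lambda>(x', y). x' = x \<longrightarrow> y \<in> U) uniformity)"

instance
proof
  fix f g h :: "'a L2" and r :: real
  show "dist f g = norm (f - g)" by (rule dist_L2_def)
  show "sgn f = f /\<^sub>R norm f" by (rule sgn_L2_def)
  show "uniformity = (INF e\<in>{0 <..}. principal {(f :: 'a L2, g). dist f g < e})" by (rule uniformity_L2_def)
  show "open U \<longleftrightarrow> (\<forall>x\<in>U. \<forall>\<^sub>F (x', y) in uniformity. x' = x \<longrightarrow> y \<in> U)" for U :: "'a L2 set" by (rule open_L2_def)
  show "norm f = sqrt (inner f f)" by (rule norm_L2_def)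
  show "inner f g = inner g f"
  proof transfer
    fix f g :: "'a fn"
    have "cnj (\<integral>x. f x * cnj (g x) \<partial>lborel) = (\<integral>x. g x * cnj (f x) \<partial>lborel)"
      unfolding Bochner_Integration.integral_cnj[symmetric] by (simp add: mult.commute)
    then show "Re (\<integral>x. f x * cnj (g x) \<partial>lborel) = Re (\<integral>x. g x * cnj (f x) \<partial>lborel)"
      by (metis complex_cnj(1) cnj.sel(1))
  qed
  show "inner (f + g) h = inner f h + inner g h"
    by transfer (simp add: distrib_right square_integrable_mult_cnj_integrable)
  show "inner (r *\<^sub>R f) g = r * inner f g"
    by transfer (simp add: mult.assoc)
  show "0 \<le> inner f f"
    by transfer (simp add: Re_integral_mult_cnj_self)
  show "inner f f = 0 \<longleftrightarrow> f = 0"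
  proof transfer
    fix f :: "'a fn"
    assume f: "square_integrable f \<and> square_integrable f \<and> (AE x in lborel. f x = f x)"
    have "(\<integral>x. (norm (f x))\<^sup>2 \<partial>lborel) = 0 \<longleftrightarrow> (AE x in lborel. (norm (f x))\<^sup>2 = 0)"
      using f by (intro integral_nonneg_eq_0_iff_AE) (auto simp: square_integrable_def)
    then show "Re (\<integral>x. f x * cnj (f x) \<partial>lborel) = 0 \<longleftrightarrow>
        square_integrable f \<and> square_integrable (\<lambda>_. 0 :: complex) \<and> (AE x in lborel. f x = 0)"
      using f by (simp add: Re_integral_mult_cnj_self square_integrable_zero)
  qed
qed

end

lemma abs_L2_eq_iff:
  "square_integrable f \<Longrightarrow> square_integrable g \<Longrightarrow> abs_L2 f = abs_L2 g \<longleftrightarrow> (AE x in lborel. f x = g x)"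
  using Quotient_rel_abs[OF Quotient_L2] Quotient_abs_rep[OF Quotient_L2] Quotient_L2
  by (metis (mono_tags, lifting) AE_I2 Quotient_rel)

lemma L2_cases:
  obtains f where "square_integrable f" "x = abs_L2 f"
  using Quotient_rep_reflp[OF Quotient_L2, of x] Quotient_abs_rep[OF Quotient_L2, of x] by metis

lemma abs_L2_add:
  "square_integrable f \<Longrightarrow> square_integrable g \<Longrightarrow> abs_L2 f + abs_L2 g = abs_L2 (\<lambda>x. f x + g x)"
  by (simp add: plus_L2.abs_eq)

lemma abs_L2_scaleR: "square_integrable f \<Longrightarrow> r *\<^sub>R abs_L2 f = abs_L2 (\<lambda>x. of_real r * f x)"
  by (simp add: scaleR_L2.abs_eq)

lemma abs_L2_diff:
  "square_integrable f \<Longrightarrow> square_integrable g \<Longrightarrow> abs_L2 f - abs_L2 g = abs_L2 (\<lambda>x. f x - g x)"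
  by (simp add: minus_L2.abs_eq)

lemma inner_abs_L2:
  "square_integrable f \<Longrightarrow> square_integrable g \<Longrightarrow> inner (abs_L2 f) (abs_L2 g) = Re (\<integral>x. f x * cnj (g x) \<partial>lborel)"
  by (simp add: inner_L2.abs_eq)

lemma norm_abs_L2:
  assumes "square_integrable f"
  shows "norm (abs_L2 f) = sqrt (\<integral>x. (norm (f x))\<^sup>2 \<partial>lborel)"
  unfolding norm_eq_sqrt_inner[of "abs_L2 f"] inner_abs_L2[OF assms assms]
  by (simp add: Re_integral_mult_cnj_self)

text \<open>Riesz-Fischer: a rapidly converging subsequence converges almost everywhere, Fatou's
  lemma upgrades the pointwise limit to a limit in norm, and a Cauchy sequence follows its
  subsequence.\<close>

instance L2 :: (finite) complete_space
proof
  fix X :: "nat \<Rightarrow> 'a L2"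
  assume X: "Cauchy X"
  have "\<exists>N. \<forall>m\<ge>N. \<forall>n\<ge>N. dist (X m) (X n) < (1 / 8) ^ k" for k
    using X unfolding Cauchy_def by simp
  then obtain N where N: "\<And>k m n. m \<ge> N k \<Longrightarrow> n \<ge> N k \<Longrightarrow> dist (X m) (X n) < (1 / 8) ^ k"
    by metis
  \<comment> \<open>The partial sums place \<open>r k\<close> beyond every \<open>N i\<close> with
    \<open>i \<le> k\<close>, and the summand \<open>k\<close> makes \<open>r\<close> strictly
    increasing.\<close>
  define r where "r k = k + (\<Sum>i\<le>k. N i)" for k
  have rN: "N i \<le> r k" if "i \<le> k" for i k
    using member_le_sum[of i "{..k}" N] that by (simp add: r_def)
  have rX: "dist (X (r k)) (X n) < (1 / 8) ^ i" if "i \<le> k" "r i \<le> n" for i k n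
    using N[of i "r k" n] rN[OF that(1)] rN[of i i] that(2) by simp
  have r_mono: "r i \<le> r k" if "i \<le> k" for i k
    using that sum_mono2[of "{..k}" "{..i}" N] by (auto simp: r_def intro!: add_mono)
  have "\<exists>f. square_integrable f \<and> X (r k) = abs_L2 f" for k
    by (metis L2_cases)
  then obtain f where f: "\<And>k. square_integrable (f k)" "\<And>k. X (r k) = abs_L2 (f k)"
    by metis
  note [measurable] = f(1)[THEN square_integrable_measurable]
  have sub: "square_integrable (\<lambda>x. f i x - f k x)" for i k
    using square_integrable_add[OF f(1) square_integrable_cmult[OF f(1)], of i "-1" k] by simp
  have dist_f: "(\<integral>\<^sup>+x. (norm (f i x - f k x))\<^sup>2 \<partial>lborel) = (dist (X (r i)) (X (r k)))\<^sup>2" for i k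
  proof -
    have "(\<integral>\<^sup>+x. (norm (f i x - f k x))\<^sup>2 \<partial>lborel) = ennreal (\<integral>x. (norm (f i x - f k x))\<^sup>2 \<partial>lborel)"
      using sub[of i k] by (intro nn_integral_eq_integral) (auto simp: square_integrable_def)
    then show ?thesis
      by (simp add: dist_norm f(2) abs_L2_diff[OF f(1) f(1)] norm_abs_L2[OF sub])
  qed
  \<comment> \<open>The weight \<open>4 ^ k\<close> is small enough for the integrals to stay below
    a geometric series, as \<open>4 ^ k * (1 / 64) ^ k \<le> (1 / 2) ^ k\<close>, and large enough
    that terms tending to 0 force increments below \<open>(1 / 2) ^ k\<close>. Working with squares
    throughout avoids the triangle inequality for infinite sums in \<open>L2\<close>.\<close>
  have "(\<integral>\<^sup>+x. (\<Sum>k. ennreal (4 ^ k * (norm (f (Suc k) x - f k x))\<^sup>2)) \<partial>lborel) =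
      (\<Sum>k. \<integral>\<^sup>+x. ennreal (4 ^ k * (norm (f (Suc k) x - f k x))\<^sup>2) \<partial>lborel)"
    by (intro nn_integral_suminf) simp
  also have "\<dots> \<le> (\<Sum>k. ennreal ((1 / 2) ^ k))"
  proof (intro suminf_le summableI)
    fix k
    have "(\<integral>\<^sup>+x. ennreal (4 ^ k * (norm (f (Suc k) x - f k x))\<^sup>2) \<partial>lborel) =
        ennreal (4 ^ k) * (dist (X (r (Suc k))) (X (r k)))\<^sup>2"
      by (simp add: ennreal_mult' nn_integral_cmult dist_f)
    also have "\<dots> = ennreal (4 ^ k * (dist (X (r (Suc k))) (X (r k)))\<^sup>2)"
      by (simp add: ennreal_mult')
    also have "4 ^ k * (dist (X (r (Suc k))) (X (r k)))\<^sup>2 \<le> 4 ^ k * ((1 / 8) ^ k)\<^sup>2"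
      using rX[of k "Suc k" "r k"] by (intro mult_left_mono power_mono) auto
    also have "\<dots> = (1 / 16) ^ k"
      by (simp add: power_mult[symmetric] mult.commute[of k] power_mult[of _ 2] power_mult_distrib[symmetric] power2_eq_square)
    also have "\<dots> \<le> (1 / 2) ^ k"
      by (intro power_mono) auto
    finally show "(\<integral>\<^sup>+x. ennreal (4 ^ k * (norm (f (Suc k) x - f k x))\<^sup>2) \<partial>lborel) \<le> ennreal ((1 / 2) ^ k)"
      by (simp add: ennreal_leI)
  qed
  also have "\<dots> < \<infinity>"
    by (simp add: suminf_ennreal2 summable_geometric_iff ennreal_less_top)
  finally have "AE x in lborel. (\<Sum>k. ennreal (4 ^ k * (norm (f (Suc k) x - f k x))\<^sup>2)) \<noteq> \<infinity>"
    by (intro nn_integral_PInf_AE) auto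
  then have conv: "AE x in lborel. convergent (\<lambda>k. f k x)"
  proof eventually_elim
    case (elim x)
    let ?d = "\<lambda>k. f (Suc k) x - f k x"
    have "summable (\<lambda>k. 4 ^ k * (norm (?d k))\<^sup>2)"
      using elim by (intro summable_suminf_not_top) auto
    then have "(\<lambda>k. 4 ^ k * (norm (?d k))\<^sup>2) \<longlonglongrightarrow> 0"
      by (rule summable_LIMSEQ_zero)
    then have "eventually (\<lambda>k. 4 ^ k * (norm (?d k))\<^sup>2 < 1) sequentially"
      by (rule order_tendstoD) simp
    then have "eventually (\<lambda>k. norm (?d k) \<le> (1 / 2) ^ k) sequentially"
    proof eventually_elim
      case (elim k)
      have "(2 ^ k * norm (?d k))\<^sup>2 < 1\<^sup>2"
        using elim by (simp add: power_mult_distrib power_mult[symmetric] mult.commute[of k] power_mult[of _ 2])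
      then have "2 ^ k * norm (?d k) < 1"
        by (rule power2_less_imp_less) simp
      then show ?case by (simp add: power_one_over field_simps)
    qed
    then have "summable ?d"
      by (rule summable_comparison_test_ev) (simp add: summable_geometric)
    then have "convergent (\<lambda>n. f n x - f 0 x)"
      unfolding summable_iff_convergent sum_lessThan_telescope[of "\<lambda>k. f k x"] .
    then show ?case
      using convergent_add[OF _ convergent_const[of "f 0 x"]] by fastforce
  qed
  define g where "g x = lim (\<lambda>k. f k x)" for x
  have [measurable]: "g \<in> borel_measurable borel"
    unfolding g_def by measurable
  have g: "AE x in lborel. (\<lambda>k. f k x) \<longlonglongrightarrow> g x"
    using conv by eventually_elim (simp add: g_def convergent_LIMSEQ_iff)
  have fatou: "(\<integral>\<^sup>+x. (norm (f i x - g x))\<^sup>2 \<partial>lborel) \<le> ennreal (((1 / 8) ^ i)\<^sup>2)" for i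
  proof -
    have "(\<integral>\<^sup>+x. (norm (f i x - g x))\<^sup>2 \<partial>lborel) \<le> (\<integral>\<^sup>+x. liminf (\<lambda>k. ennreal ((norm (f i x - f k x))\<^sup>2)) \<partial>lborel)"
    proof (rule nn_integral_mono_AE)
      show "AE x in lborel. ennreal ((norm (f i x - g x))\<^sup>2) \<le> liminf (\<lambda>k. ennreal ((norm (f i x - f k x))\<^sup>2))"
        using g
      proof eventually_elim
        case (elim x)
        then have "(\<lambda>k. ennreal ((norm (f i x - f k x))\<^sup>2)) \<longlonglongrightarrow> ennreal ((norm (f i x - g x))\<^sup>2)"
          by (intro tendsto_ennrealI tendsto_intros)
        from lim_imp_Liminf[OF sequentially_bot this] show ?case by simp
      qed
    qed
    also have "\<dots> \<le> liminf (\<lambda>k. \<integral>\<^sup>+x. (norm (f i x - f k x))\<^sup>2 \<partial>lborel)"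
      by (rule nn_integral_liminf) simp
    also have "\<dots> \<le> liminf (\<lambda>k. ennreal (((1 / 8) ^ i)\<^sup>2))"
    proof (rule Liminf_mono)
      show "\<forall>\<^sub>F k in sequentially. (\<integral>\<^sup>+x. (norm (f i x - f k x))\<^sup>2 \<partial>lborel) \<le> ennreal (((1 / 8) ^ i)\<^sup>2)"
        using eventually_ge_at_top[of i]
      proof eventually_elim
        case (elim k)
        have "(dist (X (r i)) (X (r k)))\<^sup>2 \<le> ((1 / 8) ^ i)\<^sup>2"
          using rX[of i i "r k"] r_mono[OF elim] by (intro power_mono) auto
        then show ?case by (simp add: dist_f ennreal_leI)
      qed
    qed
    finally show ?thesis by (simp add: Liminf_const)
  qed
  have diff: "square_integrable (\<lambda>x. f i x - g x)" for i
    unfolding square_integrable_def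
  proof
    show "integrable lborel (\<lambda>x. (norm (f i x - g x))\<^sup>2)"
      unfolding integrable_iff_bounded
      using fatou[of i] by (simp add: le_less_trans[OF _ ennreal_less_top])
  qed simp
  have gL: "square_integrable g"
    using square_integrable_add[OF f(1) square_integrable_cmult[OF diff], of 0 "-1" 0] by simp
  have dist_g: "dist (X (r i)) (abs_L2 g) \<le> (1 / 8) ^ i" for i
  proof -
    have "ennreal (\<integral>x. (norm (f i x - g x))\<^sup>2 \<partial>lborel) \<le> ennreal (((1 / 8) ^ i)\<^sup>2)"
      using fatou[of i] diff[of i] by (subst nn_integral_eq_integral[symmetric]) (auto simp: square_integrable_def)
    then have "(\<integral>x. (norm (f i x - g x))\<^sup>2 \<partial>lborel) \<le> ((1 / 8) ^ i)\<^sup>2"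
      by (subst (asm) ennreal_le_iff) auto
    then show ?thesis
      unfolding dist_norm f(2) abs_L2_diff[OF f(1) gL] norm_abs_L2[OF diff]
      by (rule real_le_lsqrt[rotated 1]) simp_all
  qed
  have "(\<lambda>i. X (r i)) \<longlonglongrightarrow> abs_L2 g"
  proof (rule metric_LIMSEQ_I)
    fix e :: real assume "e > 0"
    then obtain i where i: "(1 / 8) ^ i < e"
      using real_arch_pow_inv[of e "1 / 8"] by auto
    have "dist (X (r k)) (abs_L2 g) < e" if "k \<ge> i" for k
    proof -
      have "(1 / 8 :: real) ^ k \<le> (1 / 8) ^ i"
        using that by (intro power_decreasing) auto
      with dist_g[of k] i show ?thesis by linarith
    qed
    then show "\<exists>i. \<forall>k\<ge>i. dist (X (r k)) (abs_L2 g) < e" by blast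
  qed
  moreover have "strict_mono r"
    by (rule strict_monoI_Suc) (simp add: r_def)
  ultimately have "X \<longlonglongrightarrow> abs_L2 g"
    using Cauchy_converges_subseq[OF X, of r] by (simp add: o_def)
  then show "convergent X" by (rule convergentI)
qed

section \<open>Closed subspaces of a real Hilbert space\<close>

lemma subspace_closure:
  fixes S :: "'a::real_normed_vector set"
  assumes "subspace S"
  shows "subspace (closure S)"
  unfolding subspace_def
proof (intro conjI ballI allI)
  show "0 \<in> closure S"
    using subspace_0[OF assms] closure_subset by blast
  show "x + y \<in> closure S" if "x \<in> closure S" "y \<in> closure S" for x y
    using that unfolding closure_sequential
    by (metis (no_types, lifting) assms subspace_add tendsto_add)
  show "c *\<^sub>R x \<in> closure S" if "x \<in> closure S" for c x
    using that unfolding closure_sequential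
    by (metis (no_types, lifting) assms subspace_scale tendsto_scaleR tendsto_const)
qed

lemma mem_orthogonal_comp: "x \<in> S\<^sup>\<bottom> \<longleftrightarrow> (\<forall>y\<in>S. inner y x = 0)"
  by (simp add: orthogonal_comp_def orthogonal_def)

lemma orthogonal_comp_closure: "(closure S)\<^sup>\<bottom> = S\<^sup>\<bottom>"
proof (intro equalityI subsetI)
  fix x assume "x \<in> S\<^sup>\<bottom>"
  then have "S \<subseteq> {y. inner y x = 0}"
    by (auto simp: mem_orthogonal_comp)
  moreover have "closed {y. inner y x = 0}"
    by (intro closed_Collect_eq continuous_intros)
  ultimately have "closure S \<subseteq> {y. inner y x = 0}"
    by (rule closure_minimal)
  then show "x \<in> (closure S)\<^sup>\<bottom>"
    by (auto simp: mem_orthogonal_comp)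
qed (use closure_subset in \<open>auto simp: mem_orthogonal_comp\<close>)

text \<open>A minimising sequence for the distance to \<open>S\<close> is Cauchy by the
  parallelogram identity; the residual at its limit is orthogonal to \<open>S\<close> by
  minimality.\<close>

lemma orthogonal_projection_exists:
  fixes S :: "'a::{real_inner, complete_space} set"
  assumes S: "subspace S" "closed S"
  obtains a where "a \<in> S" "x - a \<in> S\<^sup>\<bottom>"
proof -
  define \<delta> where "\<delta> = (INF a\<in>S. (norm (x - a))\<^sup>2)"
  have bdd: "bdd_below ((\<lambda>a. (norm (x - a))\<^sup>2) ` S)"
    by (intro bdd_belowI[of _ 0]) auto
  have ne: "S \<noteq> {}" using subspace_0[OF S(1)] by auto
  have le: "\<delta> \<le> (norm (x - a))\<^sup>2" if "a \<in> S" for a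
    unfolding \<delta>_def using that by (intro cINF_lower bdd)
  have "\<exists>a\<in>S. (norm (x - a))\<^sup>2 < \<delta> + inverse (real (Suc n))" for n
    using cINF_less_iff[OF ne bdd, of "\<delta> + inverse (real (Suc n))"] unfolding \<delta>_def by auto
  then obtain a where a: "\<And>n. a n \<in> S" "\<And>n. (norm (x - a n))\<^sup>2 < \<delta> + inverse (real (Suc n))"
    by metis
  have par: "(norm (a m - a n))\<^sup>2 \<le> 2 * (inverse (real (Suc m)) + inverse (real (Suc n)))" for m n
  proof -
    have "(1 / 2) *\<^sub>R (a m + a n) \<in> S"
      using a(1) S(1) by (simp add: subspace_add subspace_scale)
    from le[OF this] have "4 * \<delta> \<le> 4 * (norm (x - (1 / 2) *\<^sub>R (a m + a n)))\<^sup>2" by simp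
    moreover have "(norm (a m - a n))\<^sup>2 + 4 * (norm (x - (1 / 2) *\<^sub>R (a m + a n)))\<^sup>2 =
        2 * (norm (x - a m))\<^sup>2 + 2 * (norm (x - a n))\<^sup>2"
      by (simp add: power2_norm_eq_inner inner_simps inner_commute algebra_simps)
    ultimately show ?thesis using a(2)[of m] a(2)[of n] by (simp add: distrib_left)
  qed
  have "Cauchy a"
  proof (rule metric_CauchyI)
    fix e :: real assume e: "e > 0"
    have "e\<^sup>2 / 4 > 0" using e by simp
    from reals_Archimedean[OF this] obtain N where N: "inverse (real (Suc N)) < e\<^sup>2 / 4" by auto
    have "dist (a m) (a n) < e" if mn: "m \<ge> N" "n \<ge> N" for m n
    proof -
      have "inverse (real (Suc k)) < e\<^sup>2 / 4" if "k \<ge> N" for k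
        using that by (intro le_less_trans[OF le_imp_inverse_le N]) auto
      from this[OF mn(1)] this[OF mn(2)] par[of m n] have "(norm (a m - a n))\<^sup>2 < e\<^sup>2" by simp
      then show ?thesis
        using e power2_less_imp_less[of "norm (a m - a n)" e] by (simp add: dist_norm)
    qed
    then show "\<exists>M. \<forall>m\<ge>M. \<forall>n\<ge>M. dist (a m) (a n) < e" by blast
  qed
  then obtain l where l: "a \<longlonglongrightarrow> l"
    using Cauchy_convergent convergent_def by blast
  have lS: "l \<in> S"
    using closed_sequentially[OF S(2) _ l] a(1) by blast
  have min: "(norm (x - l))\<^sup>2 \<le> \<delta>"
  proof (rule LIMSEQ_le)
    show "(\<lambda>n. (norm (x - a n))\<^sup>2) \<longlonglongrightarrow> (norm (x - l))\<^sup>2"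
      by (intro tendsto_intros l)
    show "(\<lambda>n. \<delta> + inverse (real (Suc n))) \<longlonglongrightarrow> \<delta>"
      using tendsto_add[OF tendsto_const LIMSEQ_inverse_real_of_nat, of \<delta>] by simp
    show "\<exists>N. \<forall>n\<ge>N. (norm (x - a n))\<^sup>2 \<le> \<delta> + inverse (real (Suc n))"
      using a(2) less_imp_le by blast
  qed
  have "inner y (x - l) = 0" if y: "y \<in> S" for y
  proof (rule ccontr)
    assume ne0: "inner y (x - l) \<noteq> 0"
    then have yy: "inner y y > 0" by (auto simp: inner_gt_zero_iff)
    \<comment> \<open>This \<open>t\<close> minimises the squared norm of
      \<open>x - l - t y\<close>, whose value would fall strictly below the minimum.\<close>
    define t where "t = inner y (x - l) / inner y y"
    have "l + t *\<^sub>R y \<in> S" using lS y S(1) by (simp add: subspace_add subspace_scale)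
    with le min have "(norm (x - l))\<^sup>2 \<le> (norm (x - (l + t *\<^sub>R y)))\<^sup>2" by (meson order_trans)
    also have "x - (l + t *\<^sub>R y) = (x - l) - t *\<^sub>R y" by simp
    also have "(norm ((x - l) - t *\<^sub>R y))\<^sup>2 = (norm (x - l))\<^sup>2 - 2 * t * inner y (x - l) + t\<^sup>2 * inner y y"
      unfolding power2_norm_eq_inner
      by (simp add: inner_diff_left[of "x - l"] inner_diff_right[of _ "x - l"] inner_commute[of "x - l" y] power2_eq_square right_diff_distrib mult.assoc)
    also have "\<dots> = (norm (x - l))\<^sup>2 - (inner y (x - l))\<^sup>2 / inner y y"
      using yy by (simp add: t_def power2_eq_square field_simps)
    finally show False
      using ne0 yy by (simp add: divide_le_0_iff)
  qed
  then show ?thesis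
    using that[OF lS] by (simp add: mem_orthogonal_comp)
qed

lemma orthogonal_comp_Int: "x \<in> S \<Longrightarrow> x \<in> S\<^sup>\<bottom> \<Longrightarrow> x = 0"
  by (auto simp: mem_orthogonal_comp)

text \<open>The residual of the projection onto \<open>closure S\<close> lies in the complement of
  \<open>S\<close> and in the double complement at once, hence vanishes.\<close>

lemma double_orthogonal_comp:
  fixes S :: "'a::{real_inner, complete_space} set"
  assumes "subspace S"
  shows "S\<^sup>\<bottom>\<^sup>\<bottom> = closure S"
proof (intro equalityI subsetI)
  fix x assume x: "x \<in> S\<^sup>\<bottom>\<^sup>\<bottom>"
  obtain a where a: "a \<in> closure S" "x - a \<in> (closure S)\<^sup>\<bottom>"
    using orthogonal_projection_exists[OF subspace_closure[OF assms] closed_closure] .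
  have "a \<in> S\<^sup>\<bottom>\<^sup>\<bottom>"
    using a(1) orthogonal_comp_subset[of "closure S"] by (auto simp: orthogonal_comp_closure)
  with x have "x - a \<in> S\<^sup>\<bottom>\<^sup>\<bottom>"
    using subspace_diff[OF subspace_orthogonal_comp] by blast
  then have "x - a = 0"
    using a(2) orthogonal_comp_Int unfolding orthogonal_comp_closure by blast
  then show "x \<in> closure S" using a(1) by simp
next
  fix x assume "x \<in> closure S"
  then show "x \<in> S\<^sup>\<bottom>\<^sup>\<bottom>"
    using orthogonal_comp_subset[of "closure S"] by (auto simp: orthogonal_comp_closure)
qed

lemma closure_eq_UNIV_iff_orthogonal_comp:
  fixes S :: "'a::{real_inner, complete_space} set"
  assumes "subspace S"
  shows "closure S = UNIV \<longleftrightarrow> S\<^sup>\<bottom> \<subseteq> {0}"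
proof
  assume "closure S = UNIV"
  then show "S\<^sup>\<bottom> \<subseteq> {0}"
    using orthogonal_comp_closure[of S] by simp
next
  assume "S\<^sup>\<bottom> \<subseteq> {0}"
  then have "S\<^sup>\<bottom> = {0}"
    using subspace_0[OF subspace_orthogonal_comp[of S]] by blast
  then show "closure S = UNIV"
    using double_orthogonal_comp[OF assms] by simp
qed

text \<open>Uniform boundedness through Baire's theorem: some \<open>E n\<close> contains a ball,
  and comparing the values of \<open>b\<close> at the centre and at the boundary point in direction
  \<open>b\<close> bounds \<open>r * norm b\<close> by \<open>2 * n\<close>.\<close>

lemma weakly_bounded_imp_bounded:
  fixes B :: "'a::{real_inner, complete_space} set"
  assumes bdd: "\<And>x. \<exists>c. \<forall>b\<in>B. \<bar>inner b x\<bar> \<le> c"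
  obtains C where "\<And>b. b \<in> B \<Longrightarrow> norm b \<le> C"
proof -
  define E where "E n = {x. \<forall>b\<in>B. \<bar>inner b x\<bar> \<le> real n}" for n
  have closed: "closed (E n)" for n
  proof -
    have "E n = (\<Inter>b\<in>B. {x. \<bar>inner b x\<bar> \<le> real n})"
      by (auto simp: E_def)
    then show ?thesis
      by (simp add: closed_INT closed_Collect_le continuous_intros)
  qed
  have "(\<Union>n. E n) = UNIV"
  proof (intro equalityI subsetI UNIV_I)
    fix x
    obtain c where c: "\<forall>b\<in>B. \<bar>inner b x\<bar> \<le> c" using bdd by blast
    obtain n where "c \<le> real n" using real_arch_simple by blast
    with c have "x \<in> E n" unfolding E_def by (auto intro: order_trans)
    then show "x \<in> (\<Union>n. E n)" by blast
  qed
  moreover have "interior (\<Union>(range E)) = {}" if "\<And>n. interior (E n) = {}"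
    using Met_TC.metric_Baire_category_alt[of "range E"] that closed complete_UNIV
    by auto
  ultimately obtain n where "interior (E n) \<noteq> {}"
    by auto
  then obtain x0 r where r: "r > 0" "cball x0 r \<subseteq> E n"
    by (metis ex_in_conv mem_interior_cball)
  show ?thesis
  proof (rule that)
    fix b assume b: "b \<in> B"
    show "norm b \<le> 2 * real n / r"
    proof (cases "b = 0")
      case False
      let ?y = "(r / norm b) *\<^sub>R b"
      have "x0 + ?y \<in> cball x0 r" "x0 \<in> cball x0 r"
        using False r(1) by (auto simp: dist_norm)
      then have "\<bar>inner b (x0 + ?y)\<bar> \<le> real n" "\<bar>inner b x0\<bar> \<le> real n"
        using r(2) b unfolding E_def by blast+
      then have "inner b ?y \<le> 2 * real n"
        by (simp add: inner_add_right)
      moreover have "inner b ?y = r * norm b"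
        using False by (simp add: power2_norm_eq_inner[symmetric] power2_eq_square)
      ultimately show ?thesis using r(1) by (simp add: field_simps)
    qed (use r in simp)
  qed
qed

text \<open>The orthogonal projection onto \<open>B\<close> restricts to a bijection \<open>A \<rightarrow> B\<close> precisely when the space is the
  direct sum of \<open>A\<close> and the complement of \<open>B\<close>, and its adjoint is the projection onto \<open>A\<close> restricted to
  \<open>B\<close>. So the statement is that an adjoint of a bijective bounded operator is bijective.\<close>

lemma complementary_subspaces_swap:
  fixes A B :: "'a::{real_inner, complete_space} set"
  assumes A: "subspace A" "closed A" and B: "subspace B" "closed B"
    and inj: "A \<inter> B\<^sup>\<bottom> \<subseteq> {0}" and surj: "\<And>x. \<exists>a\<in>A. x - a \<in> B\<^sup>\<bottom>"
  shows "B \<inter> A\<^sup>\<bottom> \<subseteq> {0}" and "\<exists>b\<in>B. x - b \<in> A\<^sup>\<bottom>"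
proof -
  show "B \<inter> A\<^sup>\<bottom> \<subseteq> {0}"
  proof
    fix x assume x: "x \<in> B \<inter> A\<^sup>\<bottom>"
    obtain a where "a \<in> A" "x - a \<in> B\<^sup>\<bottom>" using surj by blast
    with x have "inner x (x - a) = 0" "inner a x = 0" by (auto simp: mem_orthogonal_comp)
    then show "x \<in> {0}" by (simp add: inner_diff_right inner_commute)
  qed
  have "\<exists>a\<in>A. x - a \<in> A\<^sup>\<bottom>" for x
    using orthogonal_projection_exists[OF A] by metis
  then obtain P where P: "\<And>x. P x \<in> A" "\<And>x. x - P x \<in> A\<^sup>\<bottom>" by metis
  have P_unique: "P x = a" if "a \<in> A" "x - a \<in> A\<^sup>\<bottom>" for x a
  proof -
    have "P x - a \<in> A" using A(1) P(1) that(1) by (simp add: subspace_diff)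
    moreover have "P x - a \<in> A\<^sup>\<bottom>"
      using subspace_diff[OF subspace_orthogonal_comp that(2) P(2)[of x]] by simp
    ultimately show ?thesis using orthogonal_comp_Int by fastforce
  qed
  have P_add: "P (x + y) = P x + P y" for x y
    using subspace_add[OF subspace_orthogonal_comp P(2)[of x] P(2)[of y]] A(1) P(1)
    by (intro P_unique) (auto simp: subspace_add algebra_simps)
  have P_scale: "P (c *\<^sub>R x) = c *\<^sub>R P x" for c x
    using subspace_scale[OF subspace_orthogonal_comp P(2)[of x], of c] A(1) P(1)
    by (intro P_unique) (auto simp: subspace_scale algebra_simps)
  have P_diff: "P (x - y) = P x - P y" for x y
    using P_add[of x "(-1) *\<^sub>R y"] P_scale[of "-1" y] by simp
  have P_inner: "inner a (P x) = inner a x" if "a \<in> A" for a x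
    using P(2)[of x] that by (simp add: mem_orthogonal_comp inner_diff_right)
  \<comment> \<open>Splitting \<open>x\<close> into \<open>a\<close> and a vector orthogonal to
    \<open>B\<close> gives \<open>inner b x = inner a (P b)\<close> for \<open>b\<close> in
    \<open>B\<close>. Hence the vectors of \<open>B\<close> with \<open>norm (P b) \<le> 1\<close>
    are weakly bounded, and then bounded in norm.\<close>
  have "\<exists>c. \<forall>b\<in>{b\<in>B. norm (P b) \<le> 1}. \<bar>inner b x\<bar> \<le> c" for x
  proof -
    obtain a where a: "a \<in> A" "x - a \<in> B\<^sup>\<bottom>" using surj by blast
    have "\<bar>inner b x\<bar> \<le> norm a" if "b \<in> B" "norm (P b) \<le> 1" for b
    proof -
      have "inner b x = inner a (P b)"
        using a that(1) by (simp add: P_inner) (simp add: mem_orthogonal_comp inner_diff_right inner_commute)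
      also have "\<bar>\<dots>\<bar> \<le> norm a * norm (P b)"
        by (rule Cauchy_Schwarz_ineq2)
      also have "\<dots> \<le> norm a"
        using that(2) by (simp add: mult_left_le)
      finally show ?thesis .
    qed
    then show ?thesis by blast
  qed
  then obtain C where "\<And>b. b \<in> {b\<in>B. norm (P b) \<le> 1} \<Longrightarrow> norm b \<le> C"
    using weakly_bounded_imp_bounded by blast
  then have C: "norm b \<le> C" if "b \<in> B" "norm (P b) \<le> 1" for b
    using that by simp
  \<comment> \<open>By homogeneity. If \<open>P b = 0\<close>, every multiple of \<open>b\<close>
    has norm at most \<open>C\<close>, which the multiple of norm \<open>\<bar>C\<bar> + 1\<close>
    contradicts unless \<open>b = 0\<close>.\<close>
  have bound: "norm b \<le> C * norm (P b)" if b: "b \<in> B" for b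
  proof (cases "P b = 0")
    case True
    have "b = 0"
    proof (rule ccontr)
      assume "b \<noteq> 0"
      let ?b = "((\<bar>C\<bar> + 1) / norm b) *\<^sub>R b"
      have "norm ?b \<le> C"
        using b B(1) True by (intro C) (auto simp: subspace_scale P_scale)
      then show False using \<open>b \<noteq> 0\<close> by simp
    qed
    then show ?thesis using True by simp
  next
    case False
    let ?b = "(1 / norm (P b)) *\<^sub>R b"
    have "norm ?b \<le> C"
      using b B(1) False by (intro C) (auto simp: subspace_scale P_scale)
    then show ?thesis using False by (simp add: field_simps)
  qed
  define R where "R = P ` B"
  have R: "subspace R"
    unfolding R_def
  proof (rule subspaceI)
    have "P 0 = 0" using P_scale[of 0 0] by simp
    then show "0 \<in> P ` B" using subspace_0[OF B(1)] by force
    show "x + y \<in> P ` B" if "x \<in> P ` B" "y \<in> P ` B" for x y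
      using that subspace_add[OF B(1)] by (auto simp: P_add[symmetric])
    show "c *\<^sub>R x \<in> P ` B" if "x \<in> P ` B" for c x
      using that subspace_scale[OF B(1)] by (auto simp: P_scale[symmetric])
  qed
  \<comment> \<open>The lower bound makes preimages in \<open>B\<close> of a convergent sequence
    Cauchy. Their limit is mapped to the right point because \<open>P\<close> does not increase
    norms.\<close>
  have "closed R"
    unfolding closed_sequential_limits
  proof (intro allI impI)
    fix y l assume y: "(\<forall>n. y n \<in> R) \<and> y \<longlonglongrightarrow> l"
    then have "\<forall>n. \<exists>b. b \<in> B \<and> y n = P b"
      unfolding R_def by auto
    from choice[OF this] obtain b where b: "\<And>n. b n \<in> B" "\<And>n. y n = P (b n)"
      by blast
    have "Cauchy b"
    proof (rule metric_CauchyI)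
      fix e :: real assume e: "e > 0"
      have cy: "Cauchy y" using y LIMSEQ_imp_Cauchy by metis
      have pos: "0 < e / (\<bar>C\<bar> + 1)" using e by (intro divide_pos_pos) simp_all
      obtain N where "\<forall>m\<ge>N. \<forall>n\<ge>N. dist (y m) (y n) < e / (\<bar>C\<bar> + 1)"
        using metric_CauchyD[OF cy pos] ..
      then have N: "dist (y m) (y n) < e / (\<bar>C\<bar> + 1)" if "m \<ge> N" "n \<ge> N" for m n
        using that by simp
      have "dist (b m) (b n) < e" if "m \<ge> N" "n \<ge> N" for m n
      proof -
        have "dist (b m) (b n) \<le> C * norm (P (b m - b n))"
          unfolding dist_norm using b(1) B(1) by (intro bound) (simp add: subspace_diff)
        also have "\<dots> = C * dist (y m) (y n)"
          by (simp add: P_diff b(2) dist_norm)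
        also have "\<dots> \<le> (\<bar>C\<bar> + 1) * dist (y m) (y n)"
          by (intro mult_right_mono) auto
        also have "\<dots> < e"
          using N[OF that] by (simp add: field_simps)
        finally show ?thesis .
      qed
      then show "\<exists>M. \<forall>m\<ge>M. \<forall>n\<ge>M. dist (b m) (b n) < e" by blast
    qed
    then obtain b0 where b0: "b \<longlonglongrightarrow> b0"
      using Cauchy_convergent convergent_def by blast
    have "b0 \<in> B" using closed_sequentially[OF B(2) _ b0] b(1) by blast
    have "y \<longlonglongrightarrow> P b0"
    proof (rule Lim_null_comparison[THEN LIM_zero_cancel])
      show "\<forall>\<^sub>F n in sequentially. norm (y n - P b0) \<le> norm (b n - b0)"
      proof (intro always_eventually allI)
        fix n
        have "(norm (y n - P b0))\<^sup>2 = inner (P (b n - b0)) (b n - b0)"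
          unfolding power2_norm_eq_inner b(2) P_diff[symmetric] by (rule P_inner[OF P(1)])
        also have "\<dots> \<le> norm (y n - P b0) * norm (b n - b0)"
          unfolding b(2) P_diff[symmetric] by (rule norm_cauchy_schwarz)
        finally show "norm (y n - P b0) \<le> norm (b n - b0)"
          by (cases "y n - P b0 = 0") (auto simp: power2_eq_square)
      qed
      show "(\<lambda>n. norm (b n - b0)) \<longlonglongrightarrow> 0"
        using b0 by (simp add: LIM_zero tendsto_norm_zero)
    qed
    then have "l = P b0" using y LIMSEQ_unique by blast
    then show "l \<in> R" unfolding R_def using \<open>b0 \<in> B\<close> by blast
  qed
  have RA: "a \<in> R" if a: "a \<in> A" for a
  proof -
    obtain r where r: "r \<in> R" "a - r \<in> R\<^sup>\<bottom>"
      using orthogonal_projection_exists[OF R \<open>closed R\<close>] .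
    have "a - r \<in> A"
      using a r(1) P(1) A(1) unfolding R_def by (auto simp: subspace_diff)
    moreover have "inner b (a - r) = 0" if "b \<in> B" for b
    proof -
      have "inner (P b) (a - r) = 0"
        using r(2) that unfolding R_def by (simp add: mem_orthogonal_comp)
      then show ?thesis using P_inner[OF \<open>a - r \<in> A\<close>, of b] by (simp add: inner_commute)
    qed
    ultimately have "a - r = 0"
      using inj by (auto simp: mem_orthogonal_comp)
    then show ?thesis using r(1) by simp
  qed
  from RA[OF P(1)[of x]] obtain b where b: "b \<in> B" "P x = P b" unfolding R_def by blast
  then have "x - b \<in> A\<^sup>\<bottom>"
    using P(2)[of "x - b"] by (simp add: P_diff)
  with b(1) show "\<exists>b\<in>B. x - b \<in> A\<^sup>\<bottom>" by blast
qed

section \<open>Continuity with respect to the test function topologies\<close>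

lemma topspace_seminorm_topology:
  assumes "\<And>i f. p i (f - f) = 0"
  shows "topspace (seminorm_topology X p) = X"
  unfolding seminorm_topology_def topology_generated_by_topspace
proof (intro equalityI subsetI)
  fix f assume f: "f \<in> X"
  \<comment> \<open>Any index would do here; \<open>undefined\<close> names one.\<close>
  have "f \<in> {g \<in> X. p undefined (g - f) < 1}" using f assms by simp
  moreover have "{g \<in> X. p undefined (g - f) < 1} \<in> {{g \<in> X. p i (g - f) < e} |i f e. f \<in> X \<and> e > 0}"
    using f by (auto intro!: exI[of _ undefined] exI[of _ f] exI[of _ 1])
  ultimately show "f \<in> \<Union>{{g \<in> X. p i (g - f) < e} |i f e. f \<in> X \<and> e > 0}" by blast
qed auto

text \<open>The balls centred at \<open>f\<close> are subbasic sets, so intersecting one of them for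
  each \<open>i\<close> in the finite set \<open>I\<close> gives an open neighbourhood on which
  \<open>u\<close> varies by less than \<open>e\<close>.\<close>

lemma continuous_map_seminorm_topology:
  fixes u :: "'n::finite fn \<Rightarrow> complex"
  assumes p0: "\<And>i f. p i (f - f) = 0"
    and diff: "\<And>f g. f \<in> X \<Longrightarrow> g \<in> X \<Longrightarrow> g - f \<in> X"
    and u: "\<And>f g. f \<in> X \<Longrightarrow> g \<in> X \<Longrightarrow> u (g - f) = u g - u f"
    and bound: "\<And>f. f \<in> X \<Longrightarrow> norm (u f) \<le> C * (\<Sum>i\<in>I. p i f)" and "0 \<le> C" "finite I"
  shows "continuous_map (seminorm_topology X p) euclidean u"
  unfolding continuous_map
proof (intro conjI allI impI)
  let ?T = "seminorm_topology X p"
  fix U :: "complex set" assume U: "openin euclidean U"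
  show "openin ?T {f \<in> topspace ?T. u f \<in> U}"
  proof (subst openin_subopen, intro ballI)
    fix f assume "f \<in> {f \<in> topspace ?T. u f \<in> U}"
    then have f: "f \<in> X" "u f \<in> U" by (auto simp: topspace_seminorm_topology p0)
    obtain e where e: "e > 0" "ball (u f) e \<subseteq> U"
      using U f(2) by (auto simp: open_contains_ball)
    \<comment> \<open>The summand 1 keeps the denominator positive when \<open>C\<close> or
      \<open>card I\<close> is 0, and makes the final estimate strict.\<close>
    define \<delta> where "\<delta> = e / (C * card I + 1)"
    have pos: "0 < C * card I + 1" using \<open>0 \<le> C\<close> by (simp add: add_nonneg_pos)
    have \<delta>: "\<delta> > 0" using e(1) pos by (simp add: \<delta>_def)
    \<comment> \<open>Intersecting with \<open>topspace ?T\<close> covers an empty \<open>I\<close>,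
      for which the intersection of the balls is the whole type.\<close>
    define V where "V = (\<Inter>i\<in>I. {g \<in> X. p i (g - f) < \<delta>}) \<inter> topspace ?T"
    have "openin ?T {g \<in> X. p i (g - f) < \<delta>}" for i
      unfolding seminorm_topology_def by (rule topology_generated_by_Basis) (use f \<delta> in blast)
    then have "openin ?T V"
      unfolding V_def using \<open>finite I\<close> by (intro openin_INT) auto
    moreover have "f \<in> V"
      using f \<delta> by (auto simp: V_def p0 topspace_seminorm_topology)
    moreover have "V \<subseteq> {f \<in> topspace ?T. u f \<in> U}"
    proof
      fix g assume g: "g \<in> V"
      then have gX: "g \<in> X" by (simp add: V_def topspace_seminorm_topology p0)
      have "norm (u g - u f) \<le> C * (\<Sum>i\<in>I. p i (g - f))"
        using bound[OF diff[OF f(1) gX]] u[OF f(1) gX] by simp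
      also have "\<dots> \<le> C * (\<Sum>i\<in>I. \<delta>)"
        using g \<open>0 \<le> C\<close> by (intro mult_left_mono sum_mono) (auto simp: V_def)
      also have "\<dots> < (C * card I + 1) * \<delta>"
        using \<delta> by (simp add: algebra_simps)
      also have "\<dots> = e" using pos by (simp add: \<delta>_def)
      finally have "u g \<in> U"
        using e(2) by (auto simp: dist_norm norm_minus_commute)
      then show "g \<in> {f \<in> topspace ?T. u f \<in> U}"
        using gX by (simp add: topspace_seminorm_topology p0)
    qed
    ultimately show "\<exists>V. openin ?T V \<and> f \<in> V \<and> V \<subseteq> {f \<in> topspace ?T. u f \<in> U}" by blast
  qed
qed simp

lemma partial_deriv_zero: "partial_deriv i (\<lambda>_. 0) = (\<lambda>_. 0)"
  by (rule ext) (rule partial_deriv_eq[OF has_derivative_const])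

lemma partial_derivs_zero: "partial_derivs is (\<lambda>_. 0) = (\<lambda>_. 0)"
  by (induction "is") (simp_all add: partial_deriv_zero)

lemma fun_diff_self: "f - f = (\<lambda>_. 0 :: complex)"
  by (simp add: fun_eq_iff)

lemma schwartz_seminorm_self: "schwartz_seminorm i (f - f) = 0"
  by (cases i) (simp add: schwartz_seminorm_def fun_diff_self partial_derivs_zero)

subsection \<open>Test functions\<close>

lemma partial_derivs_eq_0_outside:
  assumes "x \<notin> supp f"
  shows "partial_derivs is f x = 0"
  using assms
proof (induction "is" arbitrary: x)
  case Nil
  then show ?case using closure_subset[of "{x. f x \<noteq> 0}"] by (auto simp: supp_def)
next
  case (Cons i "is")
  have "(partial_derivs is f has_derivative (\<lambda>_. 0)) (at x)"
  proof (rule has_derivative_transform_within_open)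
    show "((\<lambda>_. 0) has_derivative (\<lambda>_. 0)) (at x)" by (rule has_derivative_const)
    show "open (- supp f)" by (simp add: supp_def open_Compl)
    show "x \<in> - supp f" using Cons.prems by simp
    show "0 = partial_derivs is f y" if "y \<in> - supp f" for y
      using Cons.IH[of y] that by simp
  qed
  then show ?case by (simp add: partial_deriv_eq)
qed

lemma bounded_times_partial_derivs:
  fixes f :: "'n::finite fn"
  assumes "smooth f" "compact (supp f)"
  shows "bdd_above (range (\<lambda>x. (1 + norm x) ^ k * norm (partial_derivs is f x)))"
proof -
  let ?h = "\<lambda>x. (1 + norm x) ^ k * norm (partial_derivs is f x)"
  have "continuous_on (supp f) (partial_derivs is f)"
    using assms(1) unfolding smooth_def
    by (meson continuous_on_subset differentiable_imp_continuous_on subset_UNIV)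
  then have "compact (?h ` supp f)"
    by (intro compact_continuous_image continuous_intros assms(2))
  then have "bdd_above (?h ` supp f)"
    by (intro bounded_imp_bdd_above compact_imp_bounded)
  then obtain b where b: "?h x \<le> b" if "x \<in> supp f" for x
    by (auto simp: bdd_above_def)
  have "?h x \<le> max b 0" for x
    using b[of x] partial_derivs_eq_0_outside[of x f "is"] by (cases "x \<in> supp f") auto
  then show ?thesis by (auto simp: bdd_above_def)
qed

lemma test_fns_subset_schwartz: "test_fns \<Omega> \<subseteq> schwartz"
  unfolding test_fns_def schwartz_def by (auto intro: bounded_times_partial_derivs)

lemma test_fns_mono: "A \<subseteq> B \<Longrightarrow> test_fns A \<subseteq> test_fns B"
  by (auto simp: test_fns_def)

lemma supp_subset: "{x. f x \<noteq> 0} \<subseteq> S \<Longrightarrow> closed S \<Longrightarrow> supp f \<subseteq> S"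
  unfolding supp_def by (rule closure_minimal)

lemma nonzero_subset_supp: "f x \<noteq> 0 \<Longrightarrow> x \<in> supp f"
  unfolding supp_def using closure_subset[of "{x. f x \<noteq> 0}"] by auto

lemma closed_supp: "closed (supp f)"
  by (simp add: supp_def)

lemma compact_supp_subset: "supp f \<subseteq> S \<Longrightarrow> compact S \<Longrightarrow> compact (supp f)"
  using compact_Int_closed[OF _ closed_supp, of S f] by (simp add: Int_absorb1)

lemma schwartz_smooth: "f \<in> schwartz \<Longrightarrow> smooth f"
  by (simp add: schwartz_def)

lemma test_fns_add:
  assumes "f \<in> test_fns \<Omega>" "g \<in> test_fns \<Omega>"
  shows "(\<lambda>x. f x + g x) \<in> test_fns \<Omega>"
proof -
  have s: "supp (\<lambda>x. f x + g x) \<subseteq> supp f \<union> supp g"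
  proof (intro supp_subset closed_Un closed_supp subsetI)
    fix x assume "x \<in> {x. f x + g x \<noteq> 0}"
    then have "f x \<noteq> 0 \<or> g x \<noteq> 0" by auto
    then show "x \<in> supp f \<union> supp g" using nonzero_subset_supp by blast
  qed
  moreover have "compact (supp f \<union> supp g)"
    using assms by (auto simp: test_fns_def)
  moreover have "(\<lambda>x. f x + g x) \<in> schwartz"
    using assms test_fns_subset_schwartz by (intro schwartz_add) auto
  ultimately show ?thesis
    using assms compact_supp_subset[OF s] by (auto simp: test_fns_def schwartz_smooth)
qed

lemma test_fns_cmult:
  assumes "f \<in> test_fns \<Omega>"
  shows "(\<lambda>x. c * f x) \<in> test_fns \<Omega>"
proof -
  have s: "supp (\<lambda>x. c * f x) \<subseteq> supp f"
    by (intro supp_subset closed_supp) (auto dest: nonzero_subset_supp)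
  moreover have "(\<lambda>x. c * f x) \<in> schwartz"
    using assms test_fns_subset_schwartz by (intro schwartz_cmult) auto
  ultimately show ?thesis
    using assms compact_supp_subset[OF s] by (auto simp: test_fns_def schwartz_smooth)
qed

lemma test_fns_zero: "(\<lambda>_. 0) \<in> test_fns \<Omega>"
proof -
  have "(\<lambda>x. 0 * gauss x) \<in> schwartz"
    by (rule schwartz_cmult[OF schwartz_gauss])
  from schwartz_smooth[OF this] show ?thesis by (simp add: test_fns_def supp_def)
qed

lemma test_fns_diff: "f \<in> test_fns \<Omega> \<Longrightarrow> g \<in> test_fns \<Omega> \<Longrightarrow> f - g \<in> test_fns \<Omega>"
  using test_fns_add[OF _ test_fns_cmult[of g \<Omega> "-1"], of f] by (simp add: fun_diff_def)

text \<open>The polynomial weight is bounded on \<open>K\<close>, and all derivatives vanish off the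
  support. The absolute value keeps the bound nonnegative when \<open>K\<close> is empty and the
  hypothesis leaves \<open>R\<close> arbitrary.\<close>

lemma schwartz_seminorm_le_of_supp:
  fixes f :: "'n::finite fn"
  assumes f: "f \<in> test_fns K" and R: "\<And>x. x \<in> K \<Longrightarrow> 1 + norm x \<le> R"
  shows "schwartz_seminorm (k, is) f \<le> \<bar>R\<bar> ^ k * (SUP x. norm (partial_derivs is f x))"
  unfolding schwartz_seminorm_def prod.case
proof (rule cSUP_least)
  fix x
  have bdd: "bdd_above (range (\<lambda>x. norm (partial_derivs is f x)))"
    using bounded_times_partial_derivs[of f 0] f by (simp add: test_fns_def)
  have le: "norm (partial_derivs is f x) \<le> (SUP x. norm (partial_derivs is f x))"
    by (rule cSUP_upper[OF UNIV_I bdd])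
  show "(1 + norm x) ^ k * norm (partial_derivs is f x) \<le> \<bar>R\<bar> ^ k * (SUP x. norm (partial_derivs is f x))"
  proof (cases "x \<in> supp f")
    case True
    then have "1 + norm x \<le> \<bar>R\<bar>" using f R[of x] by (auto simp: test_fns_def)
    then show ?thesis by (intro mult_mono power_mono le) auto
  next
    case False
    then show ?thesis
      using le order_trans[OF norm_ge_zero le] by (simp add: partial_derivs_eq_0_outside)
  qed
qed simp

text \<open>For anti-linear \<open>u\<close> the set \<open>W\<close> of functions with
  \<open>norm (u h) < e\<close> is convex and balanced, and continuity over each compact set makes
  its traces open. It is thus a basic neighbourhood of 0, and its translate by \<open>f\<close> is
  mapped into the ball of radius \<open>e\<close> about \<open>u f\<close>.\<close>

lemma continuous_map_test_topology:
  fixes u :: "'n::finite fn \<Rightarrow> complex"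
  assumes add: "\<And>f g. f \<in> test_fns \<Omega> \<Longrightarrow> g \<in> test_fns \<Omega> \<Longrightarrow> u (\<lambda>x. f x + g x) = u f + u g"
    and cmult: "\<And>f c. f \<in> test_fns \<Omega> \<Longrightarrow> u (\<lambda>x. c * f x) = cnj c * u f"
    and cont: "\<And>K. compact K \<Longrightarrow> K \<subseteq> \<Omega> \<Longrightarrow> continuous_map (test_fns_in_topology K) euclidean u"
  shows "continuous_map (test_topology \<Omega>) euclidean u"
  unfolding continuous_map
proof (intro conjI allI impI)
  let ?T = "test_topology \<Omega>"
  have topspace: "topspace ?T \<subseteq> test_fns \<Omega>"
    by (auto simp: test_topology_def)
  have diff: "u (g - f) = u g - u f" if "f \<in> test_fns \<Omega>" "g \<in> test_fns \<Omega>" for f g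
    using add[OF that(2) test_fns_cmult[OF that(1)], of "-1"] cmult[OF that(1), of "-1"]
    by (simp add: fun_diff_def)
  fix U :: "complex set" assume U: "openin euclidean U"
  show "openin ?T {f \<in> topspace ?T. u f \<in> U}"
  proof (subst openin_subopen, intro ballI)
    fix f assume "f \<in> {f \<in> topspace ?T. u f \<in> U}"
    then have f: "f \<in> test_fns \<Omega>" "u f \<in> U" using topspace by auto
    obtain e where e: "e > 0" "ball (u f) e \<subseteq> U"
      using U f(2) by (auto simp: open_contains_ball)
    define W where "W = {h \<in> test_fns \<Omega>. norm (u h) < e}"
    have u0: "u (\<lambda>_. 0) = 0"
      using cmult[OF f(1), of 0] by simp
    have "W \<in> test_nbhds \<Omega>"
      unfolding test_nbhds_def
    proof (intro CollectI conjI ballI allI impI)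
      show "W \<subseteq> test_fns \<Omega>" by (auto simp: W_def)
      have "(\<lambda>_. 0) \<in> W" using u0 e(1) by (simp add: W_def test_fns_zero)
      then show "W \<noteq> {}" by blast
      fix g h and t :: real assume gh: "g \<in> W" "h \<in> W" and t: "t \<in> {0..1}"
      then have mem: "g \<in> test_fns \<Omega>" "h \<in> test_fns \<Omega>" by (auto simp: W_def)
      have "u (\<lambda>x. of_real (1 - t) * g x + of_real t * h x) = of_real (1 - t) * u g + of_real t * u h"
        using add[OF test_fns_cmult[OF mem(1)] test_fns_cmult[OF mem(2)]] cmult[OF mem(1)] cmult[OF mem(2)]
        by (metis complex_cnj_complex_of_real)
      also have "norm \<dots> \<le> (1 - t) * norm (u g) + t * norm (u h)"
        using t by (intro order_trans[OF norm_triangle_ineq]) (simp add: norm_mult del: of_real_diff)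
      also have "\<dots> < e"
        using gh t by (intro convex_bound_lt) (auto simp: W_def)
      finally show "(\<lambda>x. of_real (1 - t) * g x + of_real t * h x) \<in> W"
        unfolding W_def using test_fns_add[OF test_fns_cmult[OF mem(1)] test_fns_cmult[OF mem(2)]] by simp
    next
      fix g and c :: complex assume "g \<in> W" "norm c \<le> 1"
      moreover from this have "norm c * norm (u g) \<le> norm (u g)"
        by (simp add: mult_left_le_one_le)
      ultimately show "(\<lambda>x. c * g x) \<in> W"
        by (auto simp: W_def cmult norm_mult test_fns_cmult)
    next
      fix K assume K: "compact K \<and> K \<subseteq> \<Omega>"
      have "topspace (test_fns_in_topology K) = test_fns K"
        unfolding test_fns_in_topology_def
        by (rule topspace_seminorm_topology) (simp add: fun_diff_self partial_derivs_zero)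
      then have "W \<inter> test_fns K = {h \<in> topspace (test_fns_in_topology K). u h \<in> ball 0 e}"
        using test_fns_mono K by (auto simp: W_def)
      moreover have "openin (test_fns_in_topology K) \<dots>"
      proof -
        have "openin euclidean (ball (0 :: complex) e)" by simp
        with cont[of K] K show ?thesis unfolding continuous_map by blast
      qed
      ultimately show "openin (test_fns_in_topology K) (W \<inter> test_fns K)" by simp
    qed
    then have "openin ?T {g \<in> test_fns \<Omega>. g - f \<in> W}"
      unfolding test_topology_def by (intro topology_generated_by_Basis) (use f(1) in blast)
    moreover have "f \<in> {g \<in> test_fns \<Omega>. g - f \<in> W}"
      using f(1) u0 e(1) by (simp add: W_def fun_diff_self test_fns_zero)
    moreover have "{g \<in> test_fns \<Omega>. g - f \<in> W} \<subseteq> {f \<in> topspace ?T. u f \<in> U}"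
    proof
      fix g assume g: "g \<in> {g \<in> test_fns \<Omega>. g - f \<in> W}"
      then have "norm (u g - u f) < e"
        using diff[OF f(1)] by (auto simp: W_def)
      then have "u g \<in> U"
        using e(2) by (auto simp: dist_norm norm_minus_commute)
      moreover have "g \<in> topspace ?T"
        using g openin_subset[OF \<open>openin ?T {g \<in> test_fns \<Omega>. g - f \<in> W}\<close>] by blast
      ultimately show "g \<in> {f \<in> topspace ?T. u f \<in> U}" by simp
    qed
    ultimately show "\<exists>V. openin ?T V \<and> f \<in> V \<and> V \<subseteq> {f \<in> topspace ?T. u f \<in> U}" by blast
  qed
qed simp

section \<open>Sobolev spaces as images of the Hilbert space\<close>

text \<open>The Bessel potential of order \<open>t\<close>, seen on the Fourier side; the exponent
  is halved because the base contains the square of the norm.\<close>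

definition weighted :: "real \<Rightarrow> 'n::finite fn \<Rightarrow> 'n fn" where
  "weighted t f = (\<lambda>\<xi>. of_real ((1 + (norm \<xi>)\<^sup>2) powr (t / 2)) * f \<xi>)"

lemma weight_ge_1: "1 \<le> 1 + (norm \<xi>)\<^sup>2"
  by simp

lemma weight_pos: "0 < 1 + (norm \<xi>)\<^sup>2"
  using weight_ge_1[of \<xi>] by linarith

lemma weighted_measurable [measurable]:
  assumes [measurable]: "f \<in> borel_measurable borel"
  shows "weighted t f \<in> borel_measurable borel"
  unfolding weighted_def by measurable

lemma norm_weighted_power2: "(norm (weighted t f \<xi>))\<^sup>2 = (1 + (norm \<xi>)\<^sup>2) powr t * (norm (f \<xi>))\<^sup>2"
proof -
  have "((1 + (norm \<xi>)\<^sup>2) powr (t / 2))\<^sup>2 = (1 + (norm \<xi>)\<^sup>2) powr t"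
    by (simp add: power2_eq_square powr_add[symmetric])
  then show ?thesis by (simp add: weighted_def norm_mult power_mult_distrib)
qed

lemma weighted_mult_cnj_weighted:
  assumes "r + t = 0"
  shows "weighted r f \<xi> * cnj (weighted t g \<xi>) = f \<xi> * cnj (g \<xi>)"
proof -
  have "(1 + (norm \<xi>)\<^sup>2) powr (r / 2) * (1 + (norm \<xi>)\<^sup>2) powr (t / 2) = 1"
    using weight_pos[of \<xi>] assms by (simp add: powr_add[symmetric] add_divide_distrib[symmetric])
  then have "complex_of_real ((1 + (norm \<xi>)\<^sup>2) powr (r / 2)) * of_real ((1 + (norm \<xi>)\<^sup>2) powr (t / 2)) = 1"
    by (simp only: of_real_mult[symmetric] of_real_1)
  then have "of_real ((1 + (norm \<xi>)\<^sup>2) powr (r / 2)) * of_real ((1 + (norm \<xi>)\<^sup>2) powr (t / 2)) * (f \<xi> * cnj (g \<xi>)) = f \<xi> * cnj (g \<xi>)"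
    by simp
  then show ?thesis by (simp add: weighted_def ac_simps)
qed

lemma weighted_mult_cnj: "weighted t f \<xi> * cnj (g \<xi>) = f \<xi> * cnj (weighted t g \<xi>)"
  by (simp add: weighted_def)

lemma weighted_inverse:
  fixes f :: "'n::finite fn"
  shows "weighted (- t) (weighted t f) = f"
proof
  fix \<xi> :: "real ^ 'n"
  have "(1 + (norm \<xi>)\<^sup>2) powr (- t / 2) * (1 + (norm \<xi>)\<^sup>2) powr (t / 2) = 1"
    using weight_pos[of \<xi>] by (simp add: powr_add[symmetric])
  then have "complex_of_real ((1 + (norm \<xi>)\<^sup>2) powr (- t / 2)) * of_real ((1 + (norm \<xi>)\<^sup>2) powr (t / 2)) = 1"
    by (simp only: of_real_mult[symmetric] of_real_1)
  then show "weighted (- t) (weighted t f) \<xi> = f \<xi>"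
    by (simp add: weighted_def mult.assoc[symmetric])
qed

lemma square_integrable_weighted_iff:
  "square_integrable (weighted s g) \<longleftrightarrow>
    g \<in> borel_measurable borel \<and> integrable lborel (\<lambda>\<xi>. (1 + (norm \<xi>)\<^sup>2) powr s * (norm (g \<xi>))\<^sup>2)"
proof -
  have "g \<in> borel_measurable borel" if "weighted s g \<in> borel_measurable borel"
    using weighted_measurable[OF that, of "- s"] by (simp add: weighted_inverse)
  then show ?thesis
    unfolding square_integrable_def norm_weighted_power2 using weighted_measurable by blast
qed

section \<open>Weighted estimates for transforms of Schwartz functions\<close>

definition fourier_seminorms :: "nat \<Rightarrow> (nat \<times> 'n::finite list) set" where
  "fourier_seminorms N = (\<lambda>is. (2 * CARD('n), is)) ` insert [] (range (\<lambda>j::'n. replicate (2 * N) j))"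

lemma finite_fourier_seminorms: "finite (fourier_seminorms N)"
  by (simp add: fourier_seminorms_def)

lemma weighted_fourier_le_decay:
  fixes t :: real
  obtains C N where "0 \<le> C" "\<And>f \<xi>. f \<in> (schwartz :: 'n::finite fn set) \<Longrightarrow>
    norm (weighted t (fourier f) \<xi>) \<le> C * (\<Sum>i\<in>fourier_seminorms N. schwartz_seminorm i f) * decay \<xi>"
proof -
  \<comment> \<open>The ceiling pays for the weight with exponent \<open>t / 2\<close>; the
    additional \<open>CARD('n)\<close> leaves a power that dominates \<open>1 / decay\<close> up to
    the factor \<open>2 ^ CARD('n)\<close>.\<close>
  define N where "N = nat \<lceil>max 0 (t / 2)\<rceil> + CARD('n)"
  obtain C where C: "0 \<le> C" and Cle: "\<And>f \<xi>. f \<in> (schwartz :: 'n fn set) \<Longrightarrow>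
      (1 + (norm \<xi>)\<^sup>2) ^ N * norm (fourier f \<xi>) \<le>
      C * (\<Sum>is\<in>insert [] (range (\<lambda>j. replicate (2 * N) j)). schwartz_seminorm (2 * CARD('n), is) f)"
    using fourier_decay[where 'n = 'n, of N] by blast
  show thesis
  proof (rule that[of "2 ^ CARD('n) * C" N])
    show "0 \<le> 2 ^ CARD('n) * C" using C by simp
    fix f :: "'n fn" and \<xi> :: "real ^ 'n" assume f: "f \<in> schwartz"
    let ?w = "1 + (norm \<xi>)\<^sup>2"
    let ?S = "\<Sum>i\<in>fourier_seminorms N. schwartz_seminorm i f"
    have S: "?S = (\<Sum>is\<in>insert [] (range (\<lambda>j. replicate (2 * N) j)). schwartz_seminorm (2 * CARD('n), is) f)"
      unfolding fourier_seminorms_def by (subst sum.reindex) (auto simp: inj_on_def)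
    have "t / 2 \<le> real (nat \<lceil>max 0 (t / 2)\<rceil>)"
      by linarith
    then have "?w powr (t / 2) \<le> ?w powr real (nat \<lceil>max 0 (t / 2)\<rceil>)"
      by (intro powr_mono weight_ge_1)
    also have "\<dots> = ?w ^ nat \<lceil>max 0 (t / 2)\<rceil>"
      by (rule powr_realpow[OF weight_pos])
    finally have "?w ^ CARD('n) * ?w powr (t / 2) \<le> ?w ^ N"
      by (simp add: N_def power_add mult.commute mult_left_mono)
    then have "?w ^ CARD('n) * norm (weighted t (fourier f) \<xi>) \<le> ?w ^ N * norm (fourier f \<xi>)"
      by (simp add: weighted_def norm_mult mult.assoc[symmetric] mult_right_mono)
    also have "\<dots> \<le> C * ?S"
      using Cle[OF f] by (simp only: S)
    finally have 1: "?w ^ CARD('n) * norm (weighted t (fourier f) \<xi>) \<le> C * ?S" .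
    have "(1 + norm \<xi>)\<^sup>2 \<le> 2 * ?w"
      using zero_le_power2[of "norm \<xi> - 1"] by (simp add: power2_diff power2_sum)
    then have "((1 + norm \<xi>)\<^sup>2) ^ CARD('n) \<le> (2 * ?w) ^ CARD('n)"
      by (intro power_mono) auto
    then have "(1 + norm \<xi>) ^ (2 * CARD('n)) * norm (weighted t (fourier f) \<xi>) \<le>
        2 ^ CARD('n) * (?w ^ CARD('n) * norm (weighted t (fourier f) \<xi>))"
      unfolding power_mult power_mult_distrib mult.assoc[symmetric] by (rule mult_right_mono) simp
    also have "\<dots> \<le> 2 ^ CARD('n) * (C * ?S)"
      by (intro mult_left_mono 1) simp
    finally have "(1 + norm \<xi>) ^ (2 * CARD('n)) * norm (weighted t (fourier f) \<xi>) \<le> 2 ^ CARD('n) * (C * ?S)" .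
    from norm_le_decay[where f = "weighted t (fourier f)", OF this] show "norm (weighted t (fourier f) \<xi>) \<le> 2 ^ CARD('n) * C * ?S * decay \<xi>"
      by (simp only: mult.assoc)
  qed
qed

lemma square_integrable_decay: "square_integrable (\<lambda>x. of_real (decay x))"
  unfolding square_integrable_def
proof
  show "(\<lambda>x. complex_of_real (decay x)) \<in> borel_measurable borel"
    unfolding decay_def by measurable
  then have [measurable]: "(\<lambda>x. complex_of_real (decay (x :: real ^ 'a))) \<in> borel_measurable borel" .
  show "integrable lborel (\<lambda>x::real ^ 'a. (norm (complex_of_real (decay x)))\<^sup>2)"
  proof (rule Bochner_Integration.integrable_bound[OF integrable_decay])
    have "decay x \<le> 1" for x :: "real ^ 'a"
    proof -
      have "1 \<le> (1 + norm x) ^ (2 * CARD('a))" by (rule one_le_power) simp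
      then show ?thesis
        unfolding decay_def divide_inverse mult_1_left inverse_le_1_iff by blast
    qed
    then have "(decay x)\<^sup>2 \<le> decay x" for x :: "real ^ 'a"
      using decay_pos[of x] by (simp add: power2_eq_square mult_left_le)
    then show "AE x in lborel. norm ((norm (complex_of_real (decay (x :: real ^ 'a))))\<^sup>2) \<le> norm (decay x)"
      by (simp add: order_trans[OF _ abs_ge_self])
  qed measurable
qed

lemma square_integrable_weighted_fourier:
  fixes f :: "'n::finite fn"
  assumes f: "f \<in> schwartz"
  shows "square_integrable (weighted t (fourier f))"
proof -
  obtain C N where C: "\<And>f \<xi>. f \<in> (schwartz :: 'n fn set) \<Longrightarrow>
    norm (weighted t (fourier f) \<xi>) \<le> C * (\<Sum>i\<in>fourier_seminorms N. schwartz_seminorm i f) * decay \<xi>"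
    using weighted_fourier_le_decay[of t] by metis
  let ?D = "C * (\<Sum>i\<in>fourier_seminorms N. schwartz_seminorm i f)"
  show ?thesis
  proof (rule square_integrable_bound[OF square_integrable_decay square_integrable_decay])
    show "weighted t (fourier f) \<in> borel_measurable borel"
      using schwartz_measurable[OF f] by measurable
    fix \<xi>
    have "(norm (weighted t (fourier f) \<xi>))\<^sup>2 \<le> (?D * decay \<xi>)\<^sup>2"
      by (intro power_mono C f) simp
    then show "(norm (weighted t (fourier f) \<xi>))\<^sup>2 \<le>
        ?D\<^sup>2 * (norm (complex_of_real (decay \<xi>)))\<^sup>2 + 0 * (norm (complex_of_real (decay \<xi>)))\<^sup>2"
      by (simp add: power_mult_distrib)
  qed
qed

text \<open>Here \<open>h\<close> is the weighted transform: the functional has transform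
  \<open>weighted (- s) h\<close>. Placing the weight on the test function makes the integrand a
  product of two square-integrable functions when \<open>h\<close> is one.\<close>

definition hs_functional :: "real \<Rightarrow> 'n::finite fn \<Rightarrow> 'n fn \<Rightarrow> complex" where
  "hs_functional s h = (\<lambda>f. if f \<in> schwartz then \<integral>\<xi>. h \<xi> * cnj (weighted (- s) (fourier f) \<xi>) \<partial>lborel else 0)"

lemma hs_functional_eq:
  "f \<in> schwartz \<Longrightarrow> hs_functional s h f = (\<integral>\<xi>. weighted (- s) h \<xi> * cnj (fourier f \<xi>) \<partial>lborel)"
  by (simp add: hs_functional_def weighted_mult_cnj)

lemma hs_functional_integrable:
  assumes "square_integrable h" "f \<in> schwartz"
  shows "integrable lborel (\<lambda>\<xi>. h \<xi> * cnj (weighted t (fourier f) \<xi>))"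
  by (intro square_integrable_mult_cnj_integrable square_integrable_weighted_fourier assms)

lemma weighted_fourier_add:
  assumes "f \<in> schwartz" "g \<in> schwartz"
  shows "weighted t (fourier (\<lambda>x. f x + g x)) = (\<lambda>\<xi>. weighted t (fourier f) \<xi> + weighted t (fourier g) \<xi>)"
  by (simp add: weighted_def fourier_add[OF schwartz_integrable[OF assms(1)] schwartz_integrable[OF assms(2)]] distrib_left)

lemma weighted_fourier_cmult:
  "weighted t (fourier (\<lambda>x. c * f x)) = (\<lambda>\<xi>. c * weighted t (fourier f) \<xi>)"
  by (simp add: weighted_def fourier_cmult fun_eq_iff)

lemma hs_functional_add:
  assumes h: "square_integrable h" and "f \<in> schwartz" "g \<in> schwartz"
  shows "hs_functional s h (\<lambda>x. f x + g x) = hs_functional s h f + hs_functional s h g"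
  using assms
  by (simp add: hs_functional_def schwartz_add weighted_fourier_add distrib_left hs_functional_integrable)

lemma hs_functional_cmult:
  assumes "f \<in> schwartz"
  shows "hs_functional s h (\<lambda>x. c * f x) = cnj c * hs_functional s h f"
  using assms by (simp add: hs_functional_def schwartz_cmult weighted_fourier_cmult mult.left_commute)

lemma hs_functional_diff_arg:
  assumes "square_integrable h" and "f \<in> schwartz" "g \<in> schwartz"
  shows "hs_functional s h (g - f) = hs_functional s h g - hs_functional s h f"
  using hs_functional_add[OF assms(1,3) schwartz_cmult[OF assms(2), of "-1"], of s] hs_functional_cmult[OF assms(2), of s h "-1"]
  by (simp add: fun_diff_def)

lemma hs_functional_diff:
  assumes "square_integrable h" "square_integrable k"
  shows "hs_functional s (\<lambda>\<xi>. h \<xi> - k \<xi>) = hs_functional s h - hs_functional s k"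
  using assms by (auto simp: fun_eq_iff hs_functional_def left_diff_distrib hs_functional_integrable)

text \<open>The transform of \<open>f\<close> is dominated by a multiple of \<open>decay\<close>,
  which is square integrable like \<open>h\<close>. As the constants are free of \<open>f\<close>,
  this one estimate yields continuity for the Schwartz topology and for the test function
  topology.\<close>

lemma hs_functional_bound:
  fixes h :: "'n::finite fn"
  assumes h: "square_integrable h"
  obtains C N where "0 \<le> C" "\<And>f. f \<in> schwartz \<Longrightarrow>
    norm (hs_functional s h f) \<le> C * (\<Sum>i\<in>fourier_seminorms N. schwartz_seminorm i f)"
proof -
  obtain C N where C: "0 \<le> C" "\<And>f \<xi>. f \<in> (schwartz :: 'n fn set) \<Longrightarrow>
    norm (weighted (- s) (fourier f) \<xi>) \<le> C * (\<Sum>i\<in>fourier_seminorms N. schwartz_seminorm i f) * decay \<xi>"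
    using weighted_fourier_le_decay[of "- s"] by metis
  let ?I = "\<integral>\<xi>. norm (h \<xi> * cnj (of_real (decay \<xi>))) \<partial>lborel"
  show thesis
  proof (rule that[of "C * ?I" N])
    show "0 \<le> C * ?I" using C(1) by simp
    fix f :: "'n fn" assume f: "f \<in> schwartz"
    let ?S = "\<Sum>i\<in>fourier_seminorms N. schwartz_seminorm i f"
    have "norm (hs_functional s h f) \<le> (\<integral>\<xi>. norm (h \<xi> * cnj (weighted (- s) (fourier f) \<xi>)) \<partial>lborel)"
      using f by (simp add: hs_functional_def)
    also have "\<dots> \<le> (\<integral>\<xi>. C * ?S * norm (h \<xi> * cnj (of_real (decay \<xi>))) \<partial>lborel)"
    proof (rule Bochner_Integration.integral_mono)
      show "integrable lborel (\<lambda>\<xi>. norm (h \<xi> * cnj (weighted (- s) (fourier f) \<xi>)))"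
        by (intro integrable_norm hs_functional_integrable h f)
      show "integrable lborel (\<lambda>\<xi>. C * ?S * norm (h \<xi> * cnj (of_real (decay \<xi>))))"
        by (intro integrable_mult_right integrable_norm square_integrable_mult_cnj_integrable h square_integrable_decay)
      fix \<xi>
      have "norm (h \<xi>) * norm (weighted (- s) (fourier f) \<xi>) \<le> norm (h \<xi>) * (C * ?S * decay \<xi>)"
        by (intro mult_left_mono C(2) f) simp
      then show "norm (h \<xi> * cnj (weighted (- s) (fourier f) \<xi>)) \<le> C * ?S * norm (h \<xi> * cnj (of_real (decay \<xi>)))"
        using decay_pos[of \<xi>] by (simp add: norm_mult ac_simps)
    qed
    also have "\<dots> = C * ?I * ?S"
      by (simp add: ac_simps)
    finally show "norm (hs_functional s h f) \<le> C * ?I * ?S" .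
  qed
qed

lemma hs_functional_tempered:
  fixes h :: "'n::finite fn"
  assumes h: "square_integrable h"
  shows "hs_functional s h \<in> tempered"
proof -
  obtain C N where C: "0 \<le> C" "\<And>f. f \<in> schwartz \<Longrightarrow>
    norm (hs_functional s h f) \<le> C * (\<Sum>i\<in>fourier_seminorms N. schwartz_seminorm i f)"
    using hs_functional_bound[OF h] by metis
  have cont: "continuous_map schwartz_topology euclidean (hs_functional s h)"
    unfolding schwartz_topology_def
    by (rule continuous_map_seminorm_topology[OF schwartz_seminorm_self schwartz_diff
          hs_functional_diff_arg[OF h] C(2) C(1) finite_fourier_seminorms])
  show ?thesis
    unfolding tempered_def antidual_def
    by (intro CollectI conjI ballI allI impI hs_functional_add[OF h] hs_functional_cmult cont)
      (simp_all add: hs_functional_def)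
qed

text \<open>On functions supported in a compact \<open>K\<close> the polynomial weights are at most
  \<open>\<bar>1 + R\<bar> ^ (2 * CARD('n))\<close>, so the tempered estimate passes to the
  seminorms of \<open>test_fns_in_topology K\<close>.\<close>

lemma hs_functional_restrict_distribution:
  fixes h :: "'n::finite fn"
  assumes h: "square_integrable h"
  shows "dist_restrict \<Omega> (hs_functional s h) \<in> distributions \<Omega>"
proof -
  let ?u = "dist_restrict \<Omega> (hs_functional s h)"
  obtain C N where C: "0 \<le> C" "\<And>f. f \<in> schwartz \<Longrightarrow>
    norm (hs_functional s h f) \<le> C * (\<Sum>i\<in>fourier_seminorms N. schwartz_seminorm i f)"
    using hs_functional_bound[OF h] by metis
  note sub = subsetD[OF test_fns_subset_schwartz]
  have add: "?u (\<lambda>x. f x + g x) = ?u f + ?u g" if "f \<in> test_fns \<Omega>" "g \<in> test_fns \<Omega>" for f g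
    using that by (simp add: dist_restrict_def test_fns_add hs_functional_add[OF h] sub)
  have cmult: "?u (\<lambda>x. c * f x) = cnj c * ?u f" if "f \<in> test_fns \<Omega>" for f c
    using that by (simp add: dist_restrict_def test_fns_cmult hs_functional_cmult sub)
  have "continuous_map (test_fns_in_topology K) euclidean ?u" if K: "compact K" "K \<subseteq> \<Omega>" for K
  proof -
    let ?p = "\<lambda>is f. SUP x. norm (partial_derivs is f x)"
    obtain R where R: "\<And>x. x \<in> K \<Longrightarrow> norm x \<le> R"
      using compact_imp_bounded[OF K(1)] by (auto simp: bounded_iff)
    show ?thesis
      unfolding test_fns_in_topology_def
    proof (rule continuous_map_seminorm_topology)
    show "?p is (f - f) = 0" for "is" and f :: "'n fn"
      by (simp add: fun_diff_self partial_derivs_zero)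
    show "f \<in> test_fns K \<Longrightarrow> g \<in> test_fns K \<Longrightarrow> g - f \<in> test_fns K" for f g
      by (rule test_fns_diff)
    have KO: "f \<in> test_fns \<Omega>" if "f \<in> test_fns K" for f
      using that test_fns_mono[OF K(2)] by blast
    show "?u (g - f) = ?u g - ?u f" if "f \<in> test_fns K" "g \<in> test_fns K" for f g
      using that by (simp add: dist_restrict_def KO test_fns_diff hs_functional_diff_arg[OF h] sub)
    show "norm (?u f) \<le> C * \<bar>1 + R\<bar> ^ (2 * CARD('n)) * (\<Sum>is\<in>snd ` fourier_seminorms N. ?p is f)"
      if f: "f \<in> test_fns K" for f
    proof -
      have "norm (?u f) \<le> C * (\<Sum>i\<in>fourier_seminorms N. schwartz_seminorm i f)"
        using C(2)[OF sub[OF f]] KO[OF f] by (simp add: dist_restrict_def)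
      also have "\<dots> \<le> C * (\<Sum>i\<in>fourier_seminorms N. \<bar>1 + R\<bar> ^ (2 * CARD('n)) * ?p (snd i) f)"
      proof (intro mult_left_mono sum_mono C(1))
        fix i :: "nat \<times> 'n list" assume "i \<in> fourier_seminorms N"
        then have "i = (2 * CARD('n), snd i)" by (auto simp: fourier_seminorms_def)
        moreover have "schwartz_seminorm (2 * CARD('n), snd i) f \<le> \<bar>1 + R\<bar> ^ (2 * CARD('n)) * ?p (snd i) f"
          using R by (intro schwartz_seminorm_le_of_supp[OF f]) simp
        ultimately show "schwartz_seminorm i f \<le> \<bar>1 + R\<bar> ^ (2 * CARD('n)) * ?p (snd i) f"
          by metis
      qed
      also have "(\<Sum>i\<in>fourier_seminorms N. \<bar>1 + R\<bar> ^ (2 * CARD('n)) * ?p (snd i) f) =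
          \<bar>1 + R\<bar> ^ (2 * CARD('n)) * (\<Sum>is\<in>snd ` fourier_seminorms N. ?p is f)"
        by (subst sum.reindex) (auto simp: inj_on_def fourier_seminorms_def sum_distrib_left)
      finally show ?thesis by (simp add: mult.assoc)
    qed
    show "0 \<le> C * \<bar>1 + R\<bar> ^ (2 * CARD('n))" using C(1) by simp
    qed (simp add: finite_fourier_seminorms)
  qed
  from continuous_map_test_topology[OF add cmult this] add cmult show ?thesis
    unfolding distributions_def antidual_def by (auto simp: dist_restrict_def)
qed

section \<open>Uniqueness of the transform and the Sobolev norm\<close>

lemma is_fourier_fn_hs_functional:
  assumes h: "square_integrable h"
  shows "is_fourier_fn s (hs_functional s h) (weighted (- s) h)"
  unfolding is_fourier_fn_def
proof (intro conjI)
  have sq: "square_integrable (weighted s (weighted (- s) h))"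
    using h weighted_inverse[of "- s" h] by simp
  then show "weighted (- s) h \<in> borel_measurable lborel"
    "integrable lborel (\<lambda>\<xi>. (1 + (norm \<xi>)\<^sup>2) powr s * (norm (weighted (- s) h \<xi>))\<^sup>2)"
    unfolding square_integrable_weighted_iff by auto
  show "fourier_dist (hs_functional s h) = dist_of_fn (weighted (- s) h)"
  proof
    fix f
    show "fourier_dist (hs_functional s h) f = dist_of_fn (weighted (- s) h) f"
    proof (cases "f \<in> schwartz")
      case True
      then show ?thesis
        by (simp add: fourier_dist_def dist_of_fn_def hs_functional_eq schwartz_uminus_arg schwartz_fourier fourier_inverse_right)
    qed (simp add: fourier_dist_def dist_of_fn_def)
  qed
qed

lemma schwartz_eq_fourier:
  assumes "f \<in> schwartz"
  obtains f' where "f' \<in> schwartz" "fourier f' = f"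
  using assms by (intro that[of "\<lambda>\<xi>. fourier f (- \<xi>)"])
    (auto simp: schwartz_uminus_arg schwartz_fourier fourier_inverse_right)

lemma is_fourier_fn_square_integrable: "is_fourier_fn s u g \<Longrightarrow> square_integrable (weighted s g)"
  by (simp add: is_fourier_fn_def square_integrable_weighted_iff)

text \<open>Since \<open>f\<close> is itself the transform of a Schwartz function, opposite weights
  on the two factors exhibit the integrand as a product of square-integrable functions.\<close>

lemma is_fourier_fn_integrable:
  assumes "is_fourier_fn s u g" "f \<in> schwartz"
  shows "integrable lborel (\<lambda>\<xi>. g \<xi> * cnj (f \<xi>))"
proof -
  obtain f' where f': "f' \<in> schwartz" "fourier f' = f"
    using schwartz_eq_fourier[OF assms(2)] .
  have "integrable lborel (\<lambda>\<xi>. weighted s g \<xi> * cnj (weighted (- s) (fourier f') \<xi>))"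
    by (intro hs_functional_integrable is_fourier_fn_square_integrable[OF assms(1)] f')
  then show ?thesis by (simp add: weighted_mult_cnj_weighted f')
qed

text \<open>Two transforms of \<open>u\<close> act alike on Schwartz functions, which separate them.
  Consequently the choice made by \<open>SOME\<close> in \<open>Hs_norm\<close> does not affect the
  norm.\<close>

lemma is_fourier_fn_unique:
  fixes g g' :: "'n::finite fn"
  assumes g: "is_fourier_fn s u g" and g': "is_fourier_fn s u g'"
  shows "AE \<xi> in lborel. g \<xi> = g' \<xi>"
proof -
  have [measurable]: "g \<in> borel_measurable borel" "g' \<in> borel_measurable borel"
    using g g' by (auto simp: is_fourier_fn_def)
  have "AE \<xi> in lborel. g \<xi> - g' \<xi> = 0"
  proof (rule AE_zero_of_schwartz_orthogonal)
    show "(\<lambda>\<xi>. g \<xi> - g' \<xi>) \<in> borel_measurable borel" by measurable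
    have c: "cnj (gauss \<xi>) = gauss \<xi>" for \<xi> :: "real ^ 'n"
      by (simp add: gauss_def)
    show "integrable lborel (\<lambda>\<xi>. (g \<xi> - g' \<xi>) * gauss \<xi>)"
      using is_fourier_fn_integrable[OF g schwartz_gauss] is_fourier_fn_integrable[OF g' schwartz_gauss]
      by (simp add: left_diff_distrib c)
    fix f :: "'n fn" assume f: "f \<in> schwartz"
    have "dist_of_fn g f = dist_of_fn g' f"
      using g g' by (simp add: is_fourier_fn_def)
    then show "(\<integral>\<xi>. (g \<xi> - g' \<xi>) * cnj (f \<xi>) \<partial>lborel) = 0"
      using f is_fourier_fn_integrable[OF g f] is_fourier_fn_integrable[OF g' f]
      by (simp add: left_diff_distrib dist_of_fn_def)
  qed
  then show ?thesis by eventually_elim simp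
qed

text \<open>Inversion recovers \<open>u f\<close> as \<open>fourier_dist u (fourier f)\<close>, so
  \<open>u\<close> is determined by any transform \<open>g\<close>, and
  \<open>h = weighted s g\<close> represents it.\<close>

lemma Hs_eq: "Hs s = hs_functional s ` Collect square_integrable"
proof (intro equalityI subsetI)
  fix u :: "'a fn \<Rightarrow> complex" assume "u \<in> Hs s"
  then obtain g where u: "u \<in> tempered" and g: "is_fourier_fn s u g"
    by (auto simp: Hs_def)
  have "u f = hs_functional s (weighted s g) f" for f
  proof (cases "f \<in> schwartz")
    case True
    have "u f = fourier_dist u (fourier f)"
      using True by (simp add: fourier_dist_def schwartz_fourier fourier_inversion)
    also have "\<dots> = (\<integral>\<xi>. g \<xi> * cnj (fourier f \<xi>) \<partial>lborel)"
      using g True by (simp add: is_fourier_fn_def dist_of_fn_def schwartz_fourier)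
    finally show ?thesis using True by (simp add: hs_functional_eq weighted_inverse)
  next
    case False
    then show ?thesis using u by (simp add: tempered_def antidual_def hs_functional_def)
  qed
  then have "u = hs_functional s (weighted s g)" by (rule ext)
  then show "u \<in> hs_functional s ` Collect square_integrable"
    using is_fourier_fn_square_integrable[OF g] by blast
next
  fix u :: "'a fn \<Rightarrow> complex" assume "u \<in> hs_functional s ` Collect square_integrable"
  then show "u \<in> Hs s"
    unfolding Hs_def using hs_functional_tempered is_fourier_fn_hs_functional by blast
qed

lemma Hs_norm_hs_functional:
  assumes h: "square_integrable h"
  shows "Hs_norm s (hs_functional s h) = norm (abs_L2 h)"
proof -
  define g where "g = (SOME g. is_fourier_fn s (hs_functional s h) g)"
  have g: "is_fourier_fn s (hs_functional s h) g"
    unfolding g_def by (rule someI[where P = "is_fourier_fn s (hs_functional s h)", OF is_fourier_fn_hs_functional[OF h]])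
  have sq: "square_integrable (weighted s g)"
    by (rule is_fourier_fn_square_integrable[OF g])
  have "AE \<xi> in lborel. g \<xi> = weighted (- s) h \<xi>"
    by (rule is_fourier_fn_unique[OF g is_fourier_fn_hs_functional[OF h]])
  then have "AE \<xi> in lborel. weighted s g \<xi> = weighted s (weighted (- s) h) \<xi>"
    by eventually_elim (simp add: weighted_def)
  then have "abs_L2 (weighted s g) = abs_L2 h"
    using weighted_inverse[of "- s" h] by (simp add: abs_L2_eq_iff[OF sq h])
  then show ?thesis
    using norm_abs_L2[OF sq] by (simp add: Hs_norm_def Let_def g_def[symmetric] norm_weighted_power2)
qed

section \<open>The isometry of L2 onto the Sobolev space\<close>

lemma hs_functional_abs_L2_cong:
  assumes "square_integrable h" "square_integrable k" "abs_L2 h = abs_L2 k"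
  shows "hs_functional s h = hs_functional s k"
proof
  fix f
  have ae: "AE \<xi> in lborel. h \<xi> = k \<xi>"
    using assms by (simp add: abs_L2_eq_iff)
  show "hs_functional s h f = hs_functional s k f"
  proof (cases "f \<in> schwartz")
    case True
    have "AE \<xi> in lborel. h \<xi> * cnj (weighted (- s) (fourier f) \<xi>) = k \<xi> * cnj (weighted (- s) (fourier f) \<xi>)"
      using ae by eventually_elim simp
    then have "(\<integral>\<xi>. h \<xi> * cnj (weighted (- s) (fourier f) \<xi>) \<partial>lborel) = (\<integral>\<xi>. k \<xi> * cnj (weighted (- s) (fourier f) \<xi>) \<partial>lborel)"
      by (intro integral_cong_AE borel_measurable_integrable hs_functional_integrable assms True)
    then show ?thesis using True by (simp add: hs_functional_def)
  qed (simp add: hs_functional_def)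
qed

definition hs_of_L2 :: "real \<Rightarrow> 'n::finite L2 \<Rightarrow> 'n fn \<Rightarrow> complex" where
  "hs_of_L2 s x = hs_functional s (SOME h. square_integrable h \<and> abs_L2 h = x)"

lemma hs_of_L2_abs_L2:
  assumes "square_integrable h"
  shows "hs_of_L2 s (abs_L2 h) = hs_functional s h"
proof -
  have "square_integrable h \<and> abs_L2 h = abs_L2 h" using assms by simp
  then have "square_integrable (SOME k. square_integrable k \<and> abs_L2 k = abs_L2 h) \<and>
      abs_L2 (SOME k. square_integrable k \<and> abs_L2 k = abs_L2 h) = abs_L2 h"
    by (rule someI[where P = "\<lambda>k. square_integrable k \<and> abs_L2 k = abs_L2 h"])
  then show ?thesis
    unfolding hs_of_L2_def by (intro hs_functional_abs_L2_cong assms) auto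
qed

lemma Hs_eq_range: "Hs s = range (hs_of_L2 s)"
  unfolding Hs_eq
proof (intro equalityI subsetI)
  fix u :: "'a fn \<Rightarrow> complex" assume "u \<in> hs_functional s ` Collect square_integrable"
  then obtain h where h: "square_integrable h" "u = hs_functional s h" by auto
  then have "u = hs_of_L2 s (abs_L2 h)" by (simp add: hs_of_L2_abs_L2)
  then show "u \<in> range (hs_of_L2 s)" by simp
next
  fix u :: "'a fn \<Rightarrow> complex" assume "u \<in> range (hs_of_L2 s)"
  then obtain x where x: "u = hs_of_L2 s x" by blast
  obtain h where h: "square_integrable h" "x = abs_L2 h" by (rule L2_cases)
  show "u \<in> hs_functional s ` Collect square_integrable"
    using h by (simp add: x hs_of_L2_abs_L2)
qed

lemma hs_of_L2_diff: "hs_of_L2 s (x - y) = hs_of_L2 s x - hs_of_L2 s y"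
proof -
  obtain h k where h: "square_integrable h" "x = abs_L2 h" and k: "square_integrable k" "y = abs_L2 k"
    by (meson L2_cases)
  show ?thesis
    using h(1) k(1) unfolding h(2) k(2)
    by (simp add: abs_L2_diff hs_of_L2_abs_L2 hs_functional_diff square_integrable_diff)
qed

lemma Hs_norm_hs_of_L2: "Hs_norm s (hs_of_L2 s x) = norm x"
proof -
  obtain h where "square_integrable h" "x = abs_L2 h" by (rule L2_cases)
  then show ?thesis by (simp add: hs_of_L2_abs_L2 Hs_norm_hs_functional)
qed

lemma hs_of_L2_eq_iff: "hs_of_L2 s x = hs_of_L2 s y \<longleftrightarrow> x = y"
proof
  assume "hs_of_L2 s x = hs_of_L2 s y"
  then have "hs_of_L2 s (x - y) = hs_of_L2 s (x - x)"
    unfolding hs_of_L2_diff by (simp add: fun_diff_self fun_diff_def)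
  then have "norm (x - y) = norm (x - x)"
    by (metis Hs_norm_hs_of_L2)
  then show "x = y" by simp
qed simp

lemma hs_of_L2_restrict_distribution: "dist_restrict \<Omega> (hs_of_L2 s x) \<in> distributions \<Omega>"
proof -
  obtain h where "square_integrable h" "x = abs_L2 h" by (rule L2_cases)
  then show ?thesis by (simp add: hs_of_L2_abs_L2 hs_functional_restrict_distribution)
qed

lemma hs_of_L2_cmult: "f \<in> schwartz \<Longrightarrow> hs_of_L2 s x (\<lambda>y. c * f y) = cnj c * hs_of_L2 s x f"
  unfolding hs_of_L2_def by (rule hs_functional_cmult)

text \<open>The coordinate in \<open>L2\<close> of a Schwartz function \<open>f\<close> regarded as
  an element of \<open>H^t\<close>: the map \<open>hs_of_L2 t\<close> sends it back to
  \<open>dist_of_fn f\<close>.\<close>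

definition fourier_L2 :: "real \<Rightarrow> 'n::finite fn \<Rightarrow> 'n L2" where
  "fourier_L2 t f = abs_L2 (weighted t (fourier f))"

lemma Re_hs_of_L2:
  assumes f: "f \<in> schwartz"
  shows "Re (hs_of_L2 s x f) = inner x (fourier_L2 (- s) f)"
proof -
  obtain h where h: "square_integrable h" "x = abs_L2 h" by (rule L2_cases)
  then show ?thesis
    using f by (simp add: hs_of_L2_abs_L2 fourier_L2_def inner_abs_L2 square_integrable_weighted_fourier hs_functional_def)
qed

lemma hs_of_L2_fourier_L2:
  assumes "\<phi> \<in> schwartz"
  shows "hs_of_L2 s (fourier_L2 s \<phi>) = dist_of_fn \<phi>"
  unfolding fourier_L2_def hs_of_L2_abs_L2[OF square_integrable_weighted_fourier[OF assms]]
  by (auto simp: hs_functional_def dist_of_fn_def weighted_mult_cnj_weighted fourier_parseval assms)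

definition test_L2 :: "real \<Rightarrow> (real ^ 'n::finite) set \<Rightarrow> 'n L2 set" where
  "test_L2 t \<Omega> = fourier_L2 t ` test_fns \<Omega>"

lemma subspace_test_L2: "subspace (test_L2 t \<Omega>)"
proof (rule subspaceI)
  note sub = subsetD[OF test_fns_subset_schwartz]
  show add: "x + y \<in> test_L2 t \<Omega>" if x: "x \<in> test_L2 t \<Omega>" and y: "y \<in> test_L2 t \<Omega>" for x y
  proof -
    obtain f where f: "f \<in> test_fns \<Omega>" "x = fourier_L2 t f"
      using x unfolding test_L2_def by blast
    obtain g where g: "g \<in> test_fns \<Omega>" "y = fourier_L2 t g"
      using y unfolding test_L2_def by blast
    have "x + y = fourier_L2 t (\<lambda>x. f x + g x)"
      using sub[OF f(1)] sub[OF g(1)] unfolding f(2) g(2) fourier_L2_def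
      by (simp add: abs_L2_add square_integrable_weighted_fourier weighted_fourier_add)
    then show ?thesis
      using test_fns_add[OF f(1) g(1)] by (simp add: test_L2_def)
  qed
  show scale: "c *\<^sub>R x \<in> test_L2 t \<Omega>" if x: "x \<in> test_L2 t \<Omega>" for c x
  proof -
    obtain f where f: "f \<in> test_fns \<Omega>" "x = fourier_L2 t f"
      using x unfolding test_L2_def by blast
    have "c *\<^sub>R x = fourier_L2 t (\<lambda>x. of_real c * f x)"
      using sub[OF f(1)] unfolding f(2) fourier_L2_def
      by (simp add: abs_L2_scaleR square_integrable_weighted_fourier weighted_fourier_cmult)
    then show ?thesis
      using test_fns_cmult[OF f(1)] by (simp add: test_L2_def)
  qed
  have "fourier_L2 t (\<lambda>_. 0) \<in> test_L2 t \<Omega>"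
    unfolding test_L2_def by (rule imageI[OF test_fns_zero])
  from scale[OF this, of 0] show "0 \<in> test_L2 t \<Omega>" by simp
qed

text \<open>The inner product only sees real parts, but \<open>test_fns \<Omega>\<close> is closed under multiplication by \<open>\<i>\<close>.\<close>

lemma dist_restrict_hs_of_L2_eq_iff:
  "dist_restrict \<Omega> (hs_of_L2 s x) = dist_restrict \<Omega> (hs_of_L2 s y) \<longleftrightarrow> x - y \<in> (test_L2 (- s) \<Omega>)\<^sup>\<bottom>"
proof -
  have sub: "f \<in> schwartz" if "f \<in> test_fns \<Omega>" for f
    using that test_fns_subset_schwartz by blast
  have "dist_restrict \<Omega> (hs_of_L2 s x) = dist_restrict \<Omega> (hs_of_L2 s y) \<longleftrightarrow>
      (\<forall>f\<in>test_fns \<Omega>. hs_of_L2 s (x - y) f = 0)"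
    by (auto simp: dist_restrict_def fun_eq_iff hs_of_L2_diff)
  also have "\<dots> \<longleftrightarrow> (\<forall>f\<in>test_fns \<Omega>. Re (hs_of_L2 s (x - y) f) = 0)"
  proof
    assume re: "\<forall>f\<in>test_fns \<Omega>. Re (hs_of_L2 s (x - y) f) = 0"
    show "\<forall>f\<in>test_fns \<Omega>. hs_of_L2 s (x - y) f = 0"
    proof
      fix f assume f: "f \<in> test_fns \<Omega>"
      have "Re (hs_of_L2 s (x - y) (\<lambda>z. \<i> * f z)) = 0"
        using re test_fns_cmult[OF f] by blast
      then have "Im (hs_of_L2 s (x - y) f) = 0"
        by (simp add: hs_of_L2_cmult[OF sub[OF f]])
      then show "hs_of_L2 s (x - y) f = 0"
        using re f by (simp add: complex_eq_iff)
    qed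
  qed simp
  also have "\<dots> \<longleftrightarrow> (\<forall>f\<in>test_fns \<Omega>. inner (fourier_L2 (- s) f) (x - y) = 0)"
    using Re_hs_of_L2[OF sub, of _ s "x - y"] by (simp add: inner_commute)
  also have "\<dots> \<longleftrightarrow> x - y \<in> (test_L2 (- s) \<Omega>)\<^sup>\<bottom>"
    by (simp add: mem_orthogonal_comp test_L2_def)
  finally show ?thesis .
qed

section \<open>Restriction in terms of subspaces of L2\<close>

lemma Hs_on_eq: "Hs_on s \<Omega> = dist_restrict \<Omega> ` range (hs_of_L2 s)"
  unfolding Hs_on_def Hs_eq_range using hs_of_L2_restrict_distribution by auto

lemma dist_of_fn_image: "dist_of_fn ` test_fns \<Omega> = hs_of_L2 s ` test_L2 s \<Omega>"
  unfolding test_L2_def image_image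
  by (intro image_cong refl hs_of_L2_fourier_L2[symmetric] subsetD[OF test_fns_subset_schwartz])

lemma Hs_tilde_eq: "Hs_tilde s \<Omega> = hs_of_L2 s ` closure (test_L2 s \<Omega>)"
proof -
  have "hs_of_L2 s x \<in> Hs_tilde s \<Omega> \<longleftrightarrow> x \<in> closure (test_L2 s \<Omega>)" for x
    unfolding Hs_tilde_def norm_closure_def dist_of_fn_image[of \<Omega> s] closure_approachable
    by (simp add: Hs_eq_range hs_of_L2_diff[symmetric] Hs_norm_hs_of_L2 dist_norm norm_minus_commute)
  moreover have "Hs_tilde s \<Omega> \<subseteq> range (hs_of_L2 s)"
    unfolding Hs_tilde_def norm_closure_def Hs_eq_range by auto
  ultimately show ?thesis by blast
qed

text \<open>The extensions of one restriction form a coset of the complement of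
  \<open>test_L2 (- s) \<Omega>\<close>, so \<open>Hs_on_norm\<close> is a quotient norm, the
  distance to that complement. Comparing by \<open><\<close> avoids an appeal to attainment of the
  infimum.\<close>

lemma Hs_on_norm_less_iff:
  "Hs_on_norm s \<Omega> (dist_restrict \<Omega> (hs_of_L2 s x)) < e \<longleftrightarrow> (\<exists>k\<in>(test_L2 (- s) \<Omega>)\<^sup>\<bottom>. norm (x - k) < e)"
proof -
  define A where "A = {Hs_norm s U |U. U \<in> Hs s \<and> dist_restrict \<Omega> U = dist_restrict \<Omega> (hs_of_L2 s x)}"
  have A: "A = {norm z |z. z - x \<in> (test_L2 (- s) \<Omega>)\<^sup>\<bottom>}"
    unfolding A_def Hs_eq_range dist_restrict_hs_of_L2_eq_iff[symmetric]
    by (auto simp: Hs_norm_hs_of_L2) (metis Hs_norm_hs_of_L2 rangeI)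
  have "x - x \<in> (test_L2 (- s) \<Omega>)\<^sup>\<bottom>"
    using subspace_0[OF subspace_orthogonal_comp] by simp
  then have ne: "A \<noteq> {}" unfolding A by blast
  have "bdd_below A" unfolding A by (intro bdd_belowI[of _ 0]) auto
  then have "Hs_on_norm s \<Omega> (dist_restrict \<Omega> (hs_of_L2 s x)) < e \<longleftrightarrow> (\<exists>a\<in>A. a < e)"
    unfolding Hs_on_norm_def A_def[symmetric] by (rule cInf_less_iff[OF ne])
  also have "\<dots> \<longleftrightarrow> (\<exists>z. z - x \<in> (test_L2 (- s) \<Omega>)\<^sup>\<bottom> \<and> norm z < e)"
    unfolding A by blast
  also have "\<dots> \<longleftrightarrow> (\<exists>k\<in>(test_L2 (- s) \<Omega>)\<^sup>\<bottom>. norm (x - k) < e)"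
  proof safe
    fix z assume "z - x \<in> (test_L2 (- s) \<Omega>)\<^sup>\<bottom>" "norm z < e"
    then show "\<exists>k\<in>(test_L2 (- s) \<Omega>)\<^sup>\<bottom>. norm (x - k) < e"
      using subspace_neg[OF subspace_orthogonal_comp, of "z - x"] by (intro bexI[of _ "x - z"]) auto
  next
    fix k assume "k \<in> (test_L2 (- s) \<Omega>)\<^sup>\<bottom>" "norm (x - k) < e"
    then show "\<exists>z. z - x \<in> (test_L2 (- s) \<Omega>)\<^sup>\<bottom> \<and> norm z < e"
      using subspace_neg[OF subspace_orthogonal_comp, of k] by (intro exI[of _ "x - k"]) auto
  qed
  finally show ?thesis .
qed

lemma inj_on_dist_restrict_iff:
  "inj_on (dist_restrict \<Omega>) (Hs_tilde s \<Omega>) \<longleftrightarrow> closure (test_L2 s \<Omega>) \<inter> (test_L2 (- s) \<Omega>)\<^sup>\<bottom> \<subseteq> {0}"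
proof -
  let ?A = "closure (test_L2 s \<Omega>)"
  have A: "subspace ?A" by (intro subspace_closure subspace_test_L2)
  have "inj_on (dist_restrict \<Omega>) (Hs_tilde s \<Omega>) \<longleftrightarrow>
      (\<forall>x\<in>?A. \<forall>y\<in>?A. x - y \<in> (test_L2 (- s) \<Omega>)\<^sup>\<bottom> \<longrightarrow> x = y)"
    unfolding Hs_tilde_eq inj_on_def by (simp add: dist_restrict_hs_of_L2_eq_iff hs_of_L2_eq_iff)
  also have "\<dots> \<longleftrightarrow> ?A \<inter> (test_L2 (- s) \<Omega>)\<^sup>\<bottom> \<subseteq> {0}"
  proof safe
    fix x assume "\<forall>x\<in>?A. \<forall>y\<in>?A. x - y \<in> (test_L2 (- s) \<Omega>)\<^sup>\<bottom> \<longrightarrow> x = y"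
      and "x \<in> ?A" "x \<in> (test_L2 (- s) \<Omega>)\<^sup>\<bottom>"
    then show "x = 0" using subspace_0[OF A] by force
  next
    fix x y assume "?A \<inter> (test_L2 (- s) \<Omega>)\<^sup>\<bottom> \<subseteq> {0}" "x \<in> ?A" "y \<in> ?A" "x - y \<in> (test_L2 (- s) \<Omega>)\<^sup>\<bottom>"
    then have "x - y = 0" using subspace_diff[OF A] by blast
    then show "x = y" by simp
  qed
  finally show ?thesis .
qed

lemma dist_restrict_surj_iff:
  "dist_restrict \<Omega> ` Hs_tilde s \<Omega> = Hs_on s \<Omega> \<longleftrightarrow>
    (\<forall>x. \<exists>a\<in>closure (test_L2 s \<Omega>). x - a \<in> (test_L2 (- s) \<Omega>)\<^sup>\<bottom>)"
proof -
  have "dist_restrict \<Omega> ` Hs_tilde s \<Omega> = Hs_on s \<Omega> \<longleftrightarrow>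
      (\<forall>x. \<exists>a\<in>closure (test_L2 s \<Omega>). dist_restrict \<Omega> (hs_of_L2 s x) = dist_restrict \<Omega> (hs_of_L2 s a))"
    unfolding Hs_tilde_eq Hs_on_eq by blast
  then show ?thesis by (simp only: dist_restrict_hs_of_L2_eq_iff)
qed

lemma bij_betw_dist_restrict_swap:
  assumes "bij_betw (dist_restrict \<Omega>) (Hs_tilde s \<Omega>) (Hs_on s \<Omega>)"
  shows "bij_betw (dist_restrict \<Omega>) (Hs_tilde (- s) \<Omega>) (Hs_on (- s) \<Omega>)"
proof -
  have closed_subspace: "subspace (closure (test_L2 t \<Omega>))" "closed (closure (test_L2 t \<Omega>))" for t
    by (simp_all add: subspace_closure subspace_test_L2)
  show ?thesis
    using assms complementary_subspaces_swap[OF closed_subspace[of s] closed_subspace[of "- s"]]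
    unfolding bij_betw_def inj_on_dist_restrict_iff dist_restrict_surj_iff orthogonal_comp_closure
    by simp
qed

text \<open>Density for a quotient norm is density of the sum of \<open>V\<close> and the kernel,
  and the complement of a sum is the intersection of the complements. Because \<open>V\<close>
  enters only through its complement, one statement covers \<open>test_L2 s \<Omega>\<close>, which
  yields \<open>Hs_zero\<close>, and its closure, which yields the image of
  \<open>Hs_tilde\<close>.\<close>

lemma norm_closure_dist_restrict_iff:
  assumes V: "subspace V" and V_perp: "V\<^sup>\<bottom> = (test_L2 s \<Omega>)\<^sup>\<bottom>"
  shows "norm_closure (Hs_on s \<Omega>) (Hs_on_norm s \<Omega>) (dist_restrict \<Omega> ` hs_of_L2 s ` V) = Hs_on s \<Omega> \<longleftrightarrow>
    inj_on (dist_restrict \<Omega>) (Hs_tilde (- s) \<Omega>)"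
proof -
  let ?K = "(test_L2 (- s) \<Omega>)\<^sup>\<bottom>"
  define M where "M = {v + k |v k. v \<in> V \<and> k \<in> ?K}"
  have M: "subspace M"
    unfolding M_def by (rule subspace_sums[OF V subspace_orthogonal_comp])
  have diff: "dist_restrict \<Omega> (hs_of_L2 s x) - dist_restrict \<Omega> (hs_of_L2 s v) = dist_restrict \<Omega> (hs_of_L2 s (x - v))" for x v
    by (auto simp: dist_restrict_def hs_of_L2_diff fun_eq_iff)
  have Collect_eq: "{u \<in> S. P u} = S \<longleftrightarrow> (\<forall>u\<in>S. P u)" for S and P :: "('a fn \<Rightarrow> complex) \<Rightarrow> bool"
    by blast
  have "norm_closure (Hs_on s \<Omega>) (Hs_on_norm s \<Omega>) (dist_restrict \<Omega> ` hs_of_L2 s ` V) = Hs_on s \<Omega> \<longleftrightarrow>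
      (\<forall>x. \<forall>e>0. \<exists>v\<in>V. Hs_on_norm s \<Omega> (dist_restrict \<Omega> (hs_of_L2 s x) - dist_restrict \<Omega> (hs_of_L2 s v)) < e)"
    unfolding norm_closure_def Hs_on_eq Collect_eq by simp
  also have "\<dots> \<longleftrightarrow> (\<forall>x. \<forall>e>0. \<exists>v\<in>V. \<exists>k\<in>?K. norm (x - v - k) < e)"
    unfolding diff Hs_on_norm_less_iff ..
  also have "\<dots> \<longleftrightarrow> (\<forall>x. x \<in> closure M)"
  proof -
    have "dist (v + k) x = norm (x - v - k)" for v k x :: "'a L2"
      by (simp add: dist_norm norm_minus_commute diff_diff_eq)
    then have "(\<exists>y\<in>M. dist y x < e) \<longleftrightarrow> (\<exists>v\<in>V. \<exists>k\<in>?K. norm (x - v - k) < e)" for x e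
      unfolding M_def by fastforce
    then show ?thesis by (simp add: closure_approachable)
  qed
  also have "\<dots> \<longleftrightarrow> closure M = UNIV" by auto
  also have "\<dots> \<longleftrightarrow> M\<^sup>\<bottom> \<subseteq> {0}"
    by (rule closure_eq_UNIV_iff_orthogonal_comp[OF M])
  also have "M\<^sup>\<bottom> = V\<^sup>\<bottom> \<inter> ?K\<^sup>\<bottom>"
  proof (intro equalityI subsetI IntI)
    fix x assume x: "x \<in> M\<^sup>\<bottom>"
    have "V \<subseteq> M" unfolding M_def using subspace_0[OF subspace_orthogonal_comp] by force
    then show "x \<in> V\<^sup>\<bottom>" using x orthogonal_comp_anti_mono by blast
    have "?K \<subseteq> M" unfolding M_def using subspace_0[OF V] by force
    then show "x \<in> ?K\<^sup>\<bottom>" using x orthogonal_comp_anti_mono by blast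
  next
    fix x assume "x \<in> V\<^sup>\<bottom> \<inter> ?K\<^sup>\<bottom>"
    then show "x \<in> M\<^sup>\<bottom>"
      by (auto simp: M_def mem_orthogonal_comp inner_add_left)
  qed
  also have "\<dots> = closure (test_L2 (- s) \<Omega>) \<inter> (test_L2 s \<Omega>)\<^sup>\<bottom>"
    by (simp add: V_perp double_orthogonal_comp subspace_test_L2 Int_commute)
  also have "\<dots> \<subseteq> {0} \<longleftrightarrow> inj_on (dist_restrict \<Omega>) (Hs_tilde (- s) \<Omega>)"
    by (simp add: inj_on_dist_restrict_iff)
  finally show ?thesis .
qed

theorem lemma2p7:
  fixes \<Omega> :: "(real ^ 'n::finite) set" and s :: real
  assumes "open \<Omega>" and "\<Omega> \<noteq> {}"
  shows "(bij_betw (dist_restrict \<Omega>) (Hs_tilde s \<Omega>) (Hs_on s \<Omega>) \<longleftrightarrow>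
            bij_betw (dist_restrict \<Omega>) (Hs_tilde (- s) \<Omega>) (Hs_on (- s) \<Omega>)) \<and>
         (inj_on (dist_restrict \<Omega>) (Hs_tilde (- s) \<Omega>) \<longleftrightarrow>
            norm_closure (Hs_on s \<Omega>) (Hs_on_norm s \<Omega>) (dist_restrict \<Omega> ` Hs_tilde s \<Omega>) = Hs_on s \<Omega>) \<and>
         (inj_on (dist_restrict \<Omega>) (Hs_tilde (- s) \<Omega>) \<longleftrightarrow> Hs_zero s \<Omega> = Hs_on s \<Omega>)"
proof (intro conjI)
  show "bij_betw (dist_restrict \<Omega>) (Hs_tilde s \<Omega>) (Hs_on s \<Omega>) \<longleftrightarrow>
      bij_betw (dist_restrict \<Omega>) (Hs_tilde (- s) \<Omega>) (Hs_on (- s) \<Omega>)"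
    using bij_betw_dist_restrict_swap[of \<Omega> s] bij_betw_dist_restrict_swap[of \<Omega> "- s"] by auto
  show "inj_on (dist_restrict \<Omega>) (Hs_tilde (- s) \<Omega>) \<longleftrightarrow>
      norm_closure (Hs_on s \<Omega>) (Hs_on_norm s \<Omega>) (dist_restrict \<Omega> ` Hs_tilde s \<Omega>) = Hs_on s \<Omega>"
    unfolding Hs_tilde_eq[of s]
    using norm_closure_dist_restrict_iff[OF subspace_closure[OF subspace_test_L2] orthogonal_comp_closure] by blast
  show "inj_on (dist_restrict \<Omega>) (Hs_tilde (- s) \<Omega>) \<longleftrightarrow> Hs_zero s \<Omega> = Hs_on s \<Omega>"
    unfolding Hs_zero_def image_image[of "dist_restrict \<Omega>" dist_of_fn, symmetric] dist_of_fn_image[of \<Omega> s]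
    using norm_closure_dist_restrict_iff[OF subspace_test_L2 refl] by blast
qed

end
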